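(* Let $E$ be an arbitrary graph, $R$ a unital commutative ring, $I$ an ideal of $R$, and $A$ an $I$-basic graded ideal of $L_R(E)$. Put $H = A\cap E^0$ and $S=\{v\in B_H : v^H\in A\}$. Then $$L_R(E)/A\;\cong\; L_{R/I}\bigl(E\backslash(H,S)\bigr)$$ as $R/I$-algebras.
   Context: A directed graph $E=(E^0,E^1,r,s)$ has vertex set $E^0$, edge set $E^1$, and range and source maps $r,s:E^1\to E^0$. A vertex $v$ is regular if $0<|s^{-1}(v)|<\infty$ and an infinite emitter if $|s^{-1}(v)|=\infty$. A path is a finite sequence of edges $e_1\cdots e_n$ with $r(e_i)=s(e_{i+1})$; vertices are paths of length $0$. For a unital commutative ring $R$, the Leavitt path algebra $L_R(E)$ is the (not necessarily unital) $R$-algebra generated by pairwise orthogonal idempotents $\{v:v\in E^0\}$ and elements $\{e,e^*:e\in E^1\}$ subject to: $s(e)e=e=er(e)$; $r(e)e^*=e^*=e^*s(e)$; $e^*e=r(e)$ and $e^*f=0$ for $e\ne f$ in $E^1$; and $v=\sum_{s(e)=v}ee^*$ for every regular vertex $v$. It is $\mathbb Z$-graded by $\deg v=0$, $\deg e=1$, $\deg e^*=-1$. Ideals are two-sided; an ideal is graded if it is the direct sum of its intersections with the homogeneous components. Write $v\ge w$ if there is a path from $v$ to $w$. A subset $H\subseteq E^0$ is hereditary if $v\in H$, $v\ge w$ imply $w\in H$; a hereditary $H$ is saturated if for every regular $v$, $r(s^{-1}(v))\subseteq H$ implies $v\in H$. For a hereditary saturated $H$, $B_H$ (the breaking vertices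 of $H$) is the set of infinite emitters $v\notin H$ with $0<|s^{-1}(v)\cap r^{-1}(E^0\setminus H)|<\infty$, and for $v\in B_H$, $v^H:=v-\sum_{s(e)=v,\,r(e)\notin H}ee^*\in L_R(E)$. An admissible pair is $(H,S)$ with $H$ hereditary saturated and $S\subseteq B_H$; $\mathcal T_E^*$ is the set of all admissible pairs other than $(\emptyset,\emptyset)$. The saturated function associated to a graded ideal $A$ of $L_R(E)$ is the map $f$ from $\mathcal T_E^*$ to the set of ideals of $R$ given by $$f((H,S))=\{r\in R: rv\in A\ \forall v\in H \text{ and } rw^H\in A\ \forall w\in S\}.$$ For an ideal $I$ of $R$, a graded ideal $A$ is called $I$-basic if its associated saturated function $f$ satisfies $\mathrm{Im}(f)=\{I,R\}$ or $\mathrm{Im}(f)=\{I\}$. The quotient graph $E\backslash(H,S)$ has vertices $(E^0\setminus H)\cup\{v':v\in B_H\setminus S\}$ and edges $\{e\in E^1:r(e)\notin H\}\cup\{e':e\in E^1,\ r(e)\in B_H\setminus S\}$, with $r,s$ extended by $s(e')=s(e)$ and $r(e')=r(e)'$. The $R/I$-algebra structure on $L_R(E)/A$ is given by $(r+I)m:=rm$; this makes sense because $I\cdot L_R(E)\subseteq A$. *)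

theory Defs
  imports "HOL-Algebra.QuotRing" "HOL-Algebra.Module" "Graph_Theory.Digraph" "Graph_Theory.Arc_Walk"
begin

section \<open>Algebras given by generators and relations\<close>

text \<open>
  Algebras over a commutative ring \<open>R\<close> are records of type \<^typ>\<open>('r, 'a) module\<close>. They need not be
  unital: the field \<^const>\<open>one\<close> carries no information. For this reason the
  locales \<^locale>\<open>ring\<close>, \<^locale>\<open>ideal\<close> and \<^locale>\<open>algebra\<close> do not apply to them.
\<close>

datatype ('r, 'g) alg_expr =
    AZero
  | AGen 'g
  | AAdd "('r, 'g) alg_expr" "('r, 'g) alg_expr"
  | ANeg "('r, 'g) alg_expr"
  | AMul "('r, 'g) alg_expr" "('r, 'g) alg_expr"
  | AScale 'r "('r, 'g) alg_expr"

inductive_set alg_exprs :: "('r, 'm) ring_scheme \<Rightarrow> 'g set \<Rightarrow> ('r, 'g) alg_expr set"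
  for R and G where
  zero: "AZero \<in> alg_exprs R G"
| gen: "g \<in> G \<Longrightarrow> AGen g \<in> alg_exprs R G"
| add: "\<lbrakk>x \<in> alg_exprs R G; y \<in> alg_exprs R G\<rbrakk> \<Longrightarrow> AAdd x y \<in> alg_exprs R G"
| neg: "x \<in> alg_exprs R G \<Longrightarrow> ANeg x \<in> alg_exprs R G"
| mul: "\<lbrakk>x \<in> alg_exprs R G; y \<in> alg_exprs R G\<rbrakk> \<Longrightarrow> AMul x y \<in> alg_exprs R G"
| scale: "\<lbrakk>r \<in> carrier R; x \<in> alg_exprs R G\<rbrakk> \<Longrightarrow> AScale r x \<in> alg_exprs R G"

text \<open>
  The least congruence on expressions that contains \<open>Rel\<close> and makes the quotient an associative,
  not necessarily unital, \<open>R\<close>-algebra. The quotient is therefore the \<open>R\<close>-algebra generated by \<open>G\<close>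
  subject to the relations \<open>x = y\<close> for \<open>(x, y) \<in> Rel\<close>.
\<close>

inductive_set alg_cong ::
    "('r, 'm) ring_scheme \<Rightarrow> 'g set \<Rightarrow> (('r, 'g) alg_expr \<times> ('r, 'g) alg_expr) set \<Rightarrow>
     (('r, 'g) alg_expr \<times> ('r, 'g) alg_expr) set"
  for R (structure) and G and Rel where
  rel: "\<lbrakk>(x, y) \<in> Rel; x \<in> alg_exprs R G; y \<in> alg_exprs R G\<rbrakk> \<Longrightarrow> (x, y) \<in> alg_cong R G Rel"
| refl: "x \<in> alg_exprs R G \<Longrightarrow> (x, x) \<in> alg_cong R G Rel"
| sym: "(x, y) \<in> alg_cong R G Rel \<Longrightarrow> (y, x) \<in> alg_cong R G Rel"
| trans: "\<lbrakk>(x, y) \<in> alg_cong R G Rel; (y, z) \<in> alg_cong R G Rel\<rbrakk> \<Longrightarrow> (x, z) \<in> alg_cong R G Rel"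
| add_cong: "\<lbrakk>(x, x') \<in> alg_cong R G Rel; (y, y') \<in> alg_cong R G Rel\<rbrakk>
    \<Longrightarrow> (AAdd x y, AAdd x' y') \<in> alg_cong R G Rel"
| neg_cong: "(x, x') \<in> alg_cong R G Rel \<Longrightarrow> (ANeg x, ANeg x') \<in> alg_cong R G Rel"
| mul_cong: "\<lbrakk>(x, x') \<in> alg_cong R G Rel; (y, y') \<in> alg_cong R G Rel\<rbrakk>
    \<Longrightarrow> (AMul x y, AMul x' y') \<in> alg_cong R G Rel"
| scale_cong: "\<lbrakk>r \<in> carrier R; (x, x') \<in> alg_cong R G Rel\<rbrakk>
    \<Longrightarrow> (AScale r x, AScale r x') \<in> alg_cong R G Rel"
| add_assoc: "\<lbrakk>x \<in> alg_exprs R G; y \<in> alg_exprs R G; z \<in> alg_exprs R G\<rbrakk>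
    \<Longrightarrow> (AAdd (AAdd x y) z, AAdd x (AAdd y z)) \<in> alg_cong R G Rel"
| add_comm: "\<lbrakk>x \<in> alg_exprs R G; y \<in> alg_exprs R G\<rbrakk> \<Longrightarrow> (AAdd x y, AAdd y x) \<in> alg_cong R G Rel"
| add_zero: "x \<in> alg_exprs R G \<Longrightarrow> (AAdd AZero x, x) \<in> alg_cong R G Rel"
| add_neg: "x \<in> alg_exprs R G \<Longrightarrow> (AAdd (ANeg x) x, AZero) \<in> alg_cong R G Rel"
| mul_assoc: "\<lbrakk>x \<in> alg_exprs R G; y \<in> alg_exprs R G; z \<in> alg_exprs R G\<rbrakk>
    \<Longrightarrow> (AMul (AMul x y) z, AMul x (AMul y z)) \<in> alg_cong R G Rel"
| distrib_left: "\<lbrakk>x \<in> alg_exprs R G; y \<in> alg_exprs R G; z \<in> alg_exprs R G\<rbrakk>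
    \<Longrightarrow> (AMul x (AAdd y z), AAdd (AMul x y) (AMul x z)) \<in> alg_cong R G Rel"
| distrib_right: "\<lbrakk>x \<in> alg_exprs R G; y \<in> alg_exprs R G; z \<in> alg_exprs R G\<rbrakk>
    \<Longrightarrow> (AMul (AAdd x y) z, AAdd (AMul x z) (AMul y z)) \<in> alg_cong R G Rel"
| scale_add: "\<lbrakk>r \<in> carrier R; x \<in> alg_exprs R G; y \<in> alg_exprs R G\<rbrakk>
    \<Longrightarrow> (AScale r (AAdd x y), AAdd (AScale r x) (AScale r y)) \<in> alg_cong R G Rel"
| add_scale: "\<lbrakk>r \<in> carrier R; s \<in> carrier R; x \<in> alg_exprs R G\<rbrakk>
    \<Longrightarrow> (AScale (r \<oplus> s) x, AAdd (AScale r x) (AScale s x)) \<in> alg_cong R G Rel"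
| scale_scale: "\<lbrakk>r \<in> carrier R; s \<in> carrier R; x \<in> alg_exprs R G\<rbrakk>
    \<Longrightarrow> (AScale (r \<otimes> s) x, AScale r (AScale s x)) \<in> alg_cong R G Rel"
| scale_one: "x \<in> alg_exprs R G \<Longrightarrow> (AScale \<one> x, x) \<in> alg_cong R G Rel"
| scale_mul_left: "\<lbrakk>r \<in> carrier R; x \<in> alg_exprs R G; y \<in> alg_exprs R G\<rbrakk>
    \<Longrightarrow> (AScale r (AMul x y), AMul (AScale r x) y) \<in> alg_cong R G Rel"
| scale_mul_right: "\<lbrakk>r \<in> carrier R; x \<in> alg_exprs R G; y \<in> alg_exprs R G\<rbrakk>
    \<Longrightarrow> (AScale r (AMul x y), AMul x (AScale r y)) \<in> alg_cong R G Rel"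

definition presented_algebra ::
    "('r, 'm) ring_scheme \<Rightarrow> 'g set \<Rightarrow> (('r, 'g) alg_expr \<times> ('r, 'g) alg_expr) set \<Rightarrow>
     ('r, ('r, 'g) alg_expr set) module" where
  "presented_algebra R G Rel =
    \<lparr> carrier = alg_exprs R G // alg_cong R G Rel,
      mult = \<lambda>X Y. \<Union>x\<in>X. \<Union>y\<in>Y. alg_cong R G Rel `` {AMul x y},
      one = undefined,
      zero = alg_cong R G Rel `` {AZero},
      add = \<lambda>X Y. \<Union>x\<in>X. \<Union>y\<in>Y. alg_cong R G Rel `` {AAdd x y},
      smult = \<lambda>r X. \<Union>x\<in>X. alg_cong R G Rel `` {AScale r x} \<rparr>"

definition two_sided_ideal :: "'a set \<Rightarrow> ('a, 'm) ring_scheme \<Rightarrow> bool" where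
  "two_sided_ideal A L \<longleftrightarrow> additive_subgroup A L \<and>
     (\<forall>a\<in>A. \<forall>x\<in>carrier L. x \<otimes>\<^bsub>L\<^esub> a \<in> A \<and> a \<otimes>\<^bsub>L\<^esub> x \<in> A)"

text \<open>
  \<open>L / A\<close> with the scalar multiplication \<open>(r + I) (x + A) = r x + A\<close> of \<open>R / I\<close>, a single coset
  whenever \<open>A\<close> is stable under scalars and \<open>I \<cdot> L \<subseteq> A\<close>. The union follows \<^const>\<open>rcoset_mult\<close>.
\<close>

definition quotient_algebra ::
    "('r, 'a, 'm) module_scheme \<Rightarrow> 'a set \<Rightarrow> ('r set, 'a set) module" where
  "quotient_algebra L A =
    \<lparr> carrier = carrier (L Quot A),
      mult = mult (L Quot A),
      one = one (L Quot A),
      zero = zero (L Quot A),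
      add = add (L Quot A),
      smult = \<lambda>c X. \<Union>r\<in>c. \<Union>x\<in>X. A +>\<^bsub>L\<^esub> (r \<odot>\<^bsub>L\<^esub> x) \<rparr>"

definition algebra_isos ::
    "('k, 'n) ring_scheme \<Rightarrow> ('k, 'a, 'm) module_scheme \<Rightarrow> ('k, 'b, 'p) module_scheme \<Rightarrow>
     ('a \<Rightarrow> 'b) set" where
  "algebra_isos K M N =
    {\<phi> \<in> iso M N \<inter> iso (add_monoid M) (add_monoid N).
      \<forall>k\<in>carrier K. \<forall>x\<in>carrier M. \<phi> (k \<odot>\<^bsub>M\<^esub> x) = k \<odot>\<^bsub>N\<^esub> \<phi> x}"


section \<open>Leavitt path algebras\<close>

text \<open>
  The source and range maps of a graph \<open>E\<close> are \<open>tail E\<close> and \<open>head E\<close>, and \<open>s\<^sup>-\<^sup>1(v)\<close> is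
  \<open>out_arcs E v\<close>.
\<close>

datatype ('v, 'e) lpa_gen = Vertex 'v | Edge 'e | Ghost 'e

definition regular_vertex :: "('v, 'e) pre_digraph \<Rightarrow> 'v \<Rightarrow> bool" where
  "regular_vertex E v \<longleftrightarrow> v \<in> verts E \<and> out_arcs E v \<noteq> {} \<and> finite (out_arcs E v)"

definition infinite_emitter :: "('v, 'e) pre_digraph \<Rightarrow> 'v \<Rightarrow> bool" where
  "infinite_emitter E v \<longleftrightarrow> v \<in> verts E \<and> infinite (out_arcs E v)"

definition lpa_gens :: "('v, 'e) pre_digraph \<Rightarrow> ('v, 'e) lpa_gen set" where
  "lpa_gens E = Vertex ` verts E \<union> Edge ` arcs E \<union> Ghost ` arcs E"

text \<open>
  In \<open>ck2\<close> the finite sum over \<open>s\<^sup>-\<^sup>1(v)\<close> is written out along every enumeration of this set; all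
  of these expressions are congruent anyway.
\<close>

inductive_set lpa_rels ::
    "('v, 'e) pre_digraph \<Rightarrow>
     (('r, ('v, 'e) lpa_gen) alg_expr \<times> ('r, ('v, 'e) lpa_gen) alg_expr) set"
  for E where
  idem: "v \<in> verts E \<Longrightarrow>
    (AMul (AGen (Vertex v)) (AGen (Vertex v)), AGen (Vertex v)) \<in> lpa_rels E"
| orth: "\<lbrakk>v \<in> verts E; w \<in> verts E; v \<noteq> w\<rbrakk> \<Longrightarrow>
    (AMul (AGen (Vertex v)) (AGen (Vertex w)), AZero) \<in> lpa_rels E"
| source_edge: "e \<in> arcs E \<Longrightarrow>
    (AMul (AGen (Vertex (tail E e))) (AGen (Edge e)), AGen (Edge e)) \<in> lpa_rels E"
| edge_range: "e \<in> arcs E \<Longrightarrow>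
    (AMul (AGen (Edge e)) (AGen (Vertex (head E e))), AGen (Edge e)) \<in> lpa_rels E"
| range_ghost: "e \<in> arcs E \<Longrightarrow>
    (AMul (AGen (Vertex (head E e))) (AGen (Ghost e)), AGen (Ghost e)) \<in> lpa_rels E"
| ghost_source: "e \<in> arcs E \<Longrightarrow>
    (AMul (AGen (Ghost e)) (AGen (Vertex (tail E e))), AGen (Ghost e)) \<in> lpa_rels E"
| ck1_same: "e \<in> arcs E \<Longrightarrow>
    (AMul (AGen (Ghost e)) (AGen (Edge e)), AGen (Vertex (head E e))) \<in> lpa_rels E"
| ck1_diff: "\<lbrakk>e \<in> arcs E; f \<in> arcs E; e \<noteq> f\<rbrakk> \<Longrightarrow>
    (AMul (AGen (Ghost e)) (AGen (Edge f)), AZero) \<in> lpa_rels E"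
| ck2: "\<lbrakk>regular_vertex E v; distinct es; set es = out_arcs E v\<rbrakk> \<Longrightarrow>
    (AGen (Vertex v),
     foldr (\<lambda>e. AAdd (AMul (AGen (Edge e)) (AGen (Ghost e)))) es AZero) \<in> lpa_rels E"

definition lpa ::
    "('r, 'm) ring_scheme \<Rightarrow> ('v, 'e) pre_digraph \<Rightarrow>
     ('r, ('r, ('v, 'e) lpa_gen) alg_expr set) module" where
  "lpa R E = presented_algebra R (lpa_gens E) (lpa_rels E)"

definition lpa_incl ::
    "('r, 'm) ring_scheme \<Rightarrow> ('v, 'e) pre_digraph \<Rightarrow> ('v, 'e) lpa_gen \<Rightarrow>
     ('r, ('v, 'e) lpa_gen) alg_expr set" where
  "lpa_incl R E g = alg_cong R (lpa_gens E) (lpa_rels E) `` {AGen g}"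

fun gen_degree :: "('v, 'e) lpa_gen \<Rightarrow> int" where
  "gen_degree (Vertex v) = 0"
| "gen_degree (Edge e) = 1"
| "gen_degree (Ghost e) = - 1"

text \<open>
  The \<open>\<int>\<close>-grading determined by the degrees of the generators: the least family of submodules that
  contains each generator in its degree and is multiplicative.
\<close>

inductive lpa_homogeneous ::
    "('r, 'm) ring_scheme \<Rightarrow> ('v, 'e) pre_digraph \<Rightarrow> int \<Rightarrow>
     ('r, ('v, 'e) lpa_gen) alg_expr set \<Rightarrow> bool"
  for R and E where
  zero: "lpa_homogeneous R E n \<zero>\<^bsub>lpa R E\<^esub>"
| gen: "g \<in> lpa_gens E \<Longrightarrow> lpa_homogeneous R E (gen_degree g) (lpa_incl R E g)"
| add: "\<lbrakk>lpa_homogeneous R E n x; lpa_homogeneous R E n y\<rbrakk> \<Longrightarrow>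
    lpa_homogeneous R E n (x \<oplus>\<^bsub>lpa R E\<^esub> y)"
| smult: "\<lbrakk>r \<in> carrier R; lpa_homogeneous R E n x\<rbrakk> \<Longrightarrow>
    lpa_homogeneous R E n (r \<odot>\<^bsub>lpa R E\<^esub> x)"
| mult: "\<lbrakk>lpa_homogeneous R E m x; lpa_homogeneous R E n y\<rbrakk> \<Longrightarrow>
    lpa_homogeneous R E (m + n) (x \<otimes>\<^bsub>lpa R E\<^esub> y)"

definition graded_ideal ::
    "('r, 'm) ring_scheme \<Rightarrow> ('v, 'e) pre_digraph \<Rightarrow>
     ('r, ('v, 'e) lpa_gen) alg_expr set set \<Rightarrow> bool" where
  "graded_ideal R E A \<longleftrightarrow> two_sided_ideal A (lpa R E) \<and>
     (\<forall>a\<in>A. \<exists>!c. (\<forall>n. c n \<in> A \<and> lpa_homogeneous R E n (c n)) \<and>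
        finite {n. c n \<noteq> \<zero>\<^bsub>lpa R E\<^esub>} \<and>
        a = (\<Oplus>\<^bsub>lpa R E\<^esub>n\<in>{n. c n \<noteq> \<zero>\<^bsub>lpa R E\<^esub>}. c n))"


section \<open>Admissible pairs and basic ideals\<close>

definition hereditary :: "('v, 'e) pre_digraph \<Rightarrow> 'v set \<Rightarrow> bool" where
  "hereditary E H \<longleftrightarrow> H \<subseteq> verts E \<and>
     (\<forall>v w. v \<in> H \<longrightarrow> (\<exists>p. pre_digraph.awalk E v p w) \<longrightarrow> w \<in> H)"

definition saturated :: "('v, 'e) pre_digraph \<Rightarrow> 'v set \<Rightarrow> bool" where
  "saturated E H \<longleftrightarrow>
     (\<forall>v. regular_vertex E v \<longrightarrow> head E ` out_arcs E v \<subseteq> H \<longrightarrow> v \<in> H)"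

definition arcs_leaving :: "('v, 'e) pre_digraph \<Rightarrow> 'v set \<Rightarrow> 'v \<Rightarrow> 'e set" where
  "arcs_leaving E H v = {e \<in> out_arcs E v. head E e \<notin> H}"

definition breaking_vertices :: "('v, 'e) pre_digraph \<Rightarrow> 'v set \<Rightarrow> 'v set" where
  "breaking_vertices E H = {v. infinite_emitter E v \<and> v \<notin> H \<and>
     arcs_leaving E H v \<noteq> {} \<and> finite (arcs_leaving E H v)}"

definition breaking_elem ::
    "('r, 'm) ring_scheme \<Rightarrow> ('v, 'e) pre_digraph \<Rightarrow> 'v set \<Rightarrow> 'v \<Rightarrow>
     ('r, ('v, 'e) lpa_gen) alg_expr set" where
  "breaking_elem R E H v = lpa_incl R E (Vertex v) \<ominus>\<^bsub>lpa R E\<^esub>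
     (\<Oplus>\<^bsub>lpa R E\<^esub>e\<in>arcs_leaving E H v. lpa_incl R E (Edge e) \<otimes>\<^bsub>lpa R E\<^esub> lpa_incl R E (Ghost e))"

definition admissible_pairs :: "('v, 'e) pre_digraph \<Rightarrow> ('v set \<times> 'v set) set" where
  "admissible_pairs E = {(H, S). hereditary E H \<and> saturated E H \<and> S \<subseteq> breaking_vertices E H}"

definition saturated_function ::
    "('r, 'm) ring_scheme \<Rightarrow> ('v, 'e) pre_digraph \<Rightarrow>
     ('r, ('v, 'e) lpa_gen) alg_expr set set \<Rightarrow> 'v set \<times> 'v set \<Rightarrow> 'r set" where
  "saturated_function R E A = (\<lambda>(H, S). {r \<in> carrier R.
     (\<forall>v\<in>H. r \<odot>\<^bsub>lpa R E\<^esub> lpa_incl R E (Vertex v) \<in> A) \<and>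
     (\<forall>w\<in>S. r \<odot>\<^bsub>lpa R E\<^esub> breaking_elem R E H w \<in> A)})"

definition basic_graded_ideal ::
    "('r, 'm) ring_scheme \<Rightarrow> ('v, 'e) pre_digraph \<Rightarrow> 'r set \<Rightarrow>
     ('r, ('v, 'e) lpa_gen) alg_expr set set \<Rightarrow> bool" where
  "basic_graded_ideal R E I A \<longleftrightarrow> graded_ideal R E A \<and>
     (let Im = saturated_function R E A ` (admissible_pairs E - {({}, {})})
      in Im = {I, carrier R} \<or> Im = {I})"


section \<open>The quotient graph\<close>

text \<open>\<open>Primed x\<close> is the new copy \<open>x'\<close> of a vertex or edge \<open>x\<close>.\<close>

datatype 'a copy = Plain 'a | Primed 'a

definition quotient_graph ::
    "('v, 'e) pre_digraph \<Rightarrow> 'v set \<Rightarrow> 'v set \<Rightarrow> ('v copy, 'e copy) pre_digraph" where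
  "quotient_graph E H S =
    \<lparr> verts = Plain ` (verts E - H) \<union> Primed ` (breaking_vertices E H - S),
      arcs = Plain ` {e \<in> arcs E. head E e \<notin> H} \<union>
        Primed ` {e \<in> arcs E. head E e \<in> breaking_vertices E H - S},
      tail = \<lambda>x. case x of Plain e \<Rightarrow> Plain (tail E e) | Primed e \<Rightarrow> Plain (tail E e),
      head = \<lambda>x. case x of Plain e \<Rightarrow> Plain (head E e) | Primed e \<Rightarrow> Primed (head E e) \<rparr>"

end

theory Submission
  imports Defs
begin

text \<open>
  Write \<open>L = L\<^sub>R(E)\<close>, \<open>K = R / I\<close> and \<open>F = E\(H,S)\<close>. The generators of \<open>L\<^sub>K(F)\<close> can be found inside
  \<open>L / A\<close>. A vertex \<open>v\<close> of \<open>E\<close> outside \<open>H\<close> and outside \<open>B\<^sub>H - S\<close> is represented by its coset. A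
  vertex \<open>v \<in> B\<^sub>H - S\<close> is the sum of two orthogonal idempotents: the finite sum of all \<open>e e*\<close> over
  the edges \<open>e\<close> from \<open>v\<close> to the complement of \<open>H\<close> represents the vertex \<open>v\<close> of \<open>F\<close>, and \<open>v\<^sup>H\<close>
  represents \<open>v'\<close>. An edge of \<open>F\<close> over \<open>e\<close> is represented by the product of \<open>e\<close> with the idempotent
  at its range. Modulo \<open>A\<close> the vertices of \<open>H\<close> and the elements \<open>v\<^sup>H\<close> with \<open>v \<in> S\<close> vanish, which is
  what makes these elements satisfy the relations of \<open>F\<close> (\<open>quotient_leavitt_family\<close>). The resulting
  homomorphism \<open>\<Psi> : L\<^sub>K(F) \<rightarrow> L / A\<close> is onto because every generator of \<open>L\<close> becomes a sum of at most
  two of the representatives (\<open>generators_in_span\<close>). The isomorphism is its inverse.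

  Injectivity of \<open>\<Psi>\<close> is an instance of graded uniqueness (\<open>graded_uniqueness\<close>): an ideal of \<open>L\<^sub>K(F)\<close>
  that contains no nonzero scalar multiple of a vertex contains no nonzero homogeneous element. A
  homogeneous element \<open>x\<close> is a combination of products \<open>\<alpha> \<beta>*\<close> of paths and ghost paths, and the
  proof is by induction on a bound for the lengths of the \<open>\<beta>\<close>. For every edge \<open>f\<close> the element
  \<open>x f\<close> needs a smaller bound, so it is \<open>0\<close>. Hence, for each vertex \<open>v\<close>, \<open>x v\<close> equals
  \<open>q - \<Sum> q e e*\<close>, where \<open>q\<close> is a combination of paths ending at \<open>v\<close> and \<open>e\<close> runs over a finite set
  \<open>D\<close> of edges from \<open>v\<close> such that \<open>q f = 0\<close> for all other edges \<open>f\<close> from \<open>v\<close>. If \<open>v\<close> is regular,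
  then the relation at \<open>v\<close> turns this into \<open>0\<close>. If \<open>v\<close> is an infinite emitter, then there is an edge
  \<open>f\<close> outside \<open>D\<close>, and \<open>q f = 0\<close> forces \<open>q = 0\<close>. If \<open>v\<close> is a sink, then \<open>x v = q\<close> is a
  combination of paths in the ideal, and ghost edges on the left strip it down to multiples of
  vertices.

  The kernel of \<open>\<Psi>\<close> is spanned by homogeneous elements because \<open>\<Psi>\<close> maps homogeneous elements to
  cosets of homogeneous elements (\<open>\<Psi>_graded\<close>), \<open>A\<close> is graded, and homogeneous components in \<open>L\<close> are
  unique (\<open>homog_sum_zero\<close>). That it contains no multiple of a vertex is where \<open>A\<close> being
  \<open>I\<close>-basic enters. If \<open>r v \<in> A\<close> with \<open>v \<notin> H\<close>, then the vertices \<open>w\<close> with \<open>r w \<in> A\<close> form a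
  hereditary saturated set, and the saturated function takes on it a value that contains \<open>r\<close> but
  not \<open>1\<close>; this value must be \<open>I\<close>, so \<open>r \<in> I\<close>. If \<open>r v\<^sup>H \<in> A\<close> with \<open>v \<in> B\<^sub>H - S\<close>, then the pair
  \<open>(H, {v})\<close> gives \<open>r \<in> I\<close> in the same way. The pair \<open>(E\<^sup>0, \<emptyset>)\<close>, finally, gives \<open>I L \<subseteq> A\<close>.
\<close>

section \<open>Nonunital algebras and their homomorphisms\<close>

locale nonunital_algebra = Module.module K T for K and T (structure) +
  assumes mult_closed [simp, intro]: "\<lbrakk>x \<in> carrier T; y \<in> carrier T\<rbrakk> \<Longrightarrow> x \<otimes> y \<in> carrier T"
    and mult_assoc: "\<lbrakk>x \<in> carrier T; y \<in> carrier T; z \<in> carrier T\<rbrakk> \<Longrightarrow> x \<otimes> y \<otimes> z = x \<otimes> (y \<otimes> z)"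
    and mult_r_distr:
      "\<lbrakk>x \<in> carrier T; y \<in> carrier T; z \<in> carrier T\<rbrakk> \<Longrightarrow> x \<otimes> (y \<oplus> z) = x \<otimes> y \<oplus> x \<otimes> z"
    and mult_l_distr:
      "\<lbrakk>x \<in> carrier T; y \<in> carrier T; z \<in> carrier T\<rbrakk> \<Longrightarrow> (x \<oplus> y) \<otimes> z = x \<otimes> z \<oplus> y \<otimes> z"
    and smult_mult_left:
      "\<lbrakk>k \<in> carrier K; x \<in> carrier T; y \<in> carrier T\<rbrakk> \<Longrightarrow> (k \<odot> x) \<otimes> y = k \<odot> (x \<otimes> y)"
    and smult_mult_right:
      "\<lbrakk>k \<in> carrier K; x \<in> carrier T; y \<in> carrier T\<rbrakk> \<Longrightarrow> x \<otimes> (k \<odot> y) = k \<odot> (x \<otimes> y)"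
begin

lemma mult_l_zero [simp]:
  assumes "x \<in> carrier T" shows "\<zero> \<otimes> x = \<zero>"
proof -
  have "\<zero> \<otimes> x \<oplus> \<zero> \<otimes> x = \<zero> \<otimes> x"
    using mult_l_distr[of \<zero> \<zero> x] assms by simp
  then show ?thesis using assms by (metis M.add.r_cancel_one' M.zero_closed mult_closed)
qed

lemma mult_r_zero [simp]:
  assumes "x \<in> carrier T" shows "x \<otimes> \<zero> = \<zero>"
proof -
  have "x \<otimes> \<zero> \<oplus> x \<otimes> \<zero> = x \<otimes> \<zero>"
    using mult_r_distr[of x \<zero> \<zero>] assms by simp
  then show ?thesis using assms by (metis M.add.r_cancel_one' M.zero_closed mult_closed)
qed

lemma mult_l_minus:
  assumes "x \<in> carrier T" "y \<in> carrier T" shows "(\<ominus> x) \<otimes> y = \<ominus> (x \<otimes> y)"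
proof -
  have "(\<ominus> x) \<otimes> y \<oplus> x \<otimes> y = \<zero>"
    using mult_l_distr[of "\<ominus> x" x y] assms by (simp add: M.l_neg)
  then show ?thesis using assms by (metis M.minus_equality M.a_inv_closed mult_closed)
qed

lemma mult_r_minus:
  assumes "x \<in> carrier T" "y \<in> carrier T" shows "x \<otimes> (\<ominus> y) = \<ominus> (x \<otimes> y)"
proof -
  have "x \<otimes> (\<ominus> y) \<oplus> x \<otimes> y = \<zero>"
    using mult_r_distr[of x "\<ominus> y" y] assms by (simp add: M.l_neg)
  then show ?thesis using assms by (metis M.minus_equality M.a_inv_closed mult_closed)
qed

lemma finsum_mult_left:
  assumes "finite D" "x \<in> carrier T" "f \<in> D \<rightarrow> carrier T"
  shows "(\<Oplus>i\<in>D. f i) \<otimes> x = (\<Oplus>i\<in>D. f i \<otimes> x)"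
  using assms(1,3)
proof (induction rule: finite_induct)
  case empty then show ?case using assms(2) by simp
next
  case (insert i D)
  then show ?case using assms(2) by (simp add: Pi_def mult_l_distr)
qed

lemma finsum_mult_right:
  assumes "finite D" "x \<in> carrier T" "f \<in> D \<rightarrow> carrier T"
  shows "x \<otimes> (\<Oplus>i\<in>D. f i) = (\<Oplus>i\<in>D. x \<otimes> f i)"
  using assms(1,3)
proof (induction rule: finite_induct)
  case empty then show ?case using assms(2) by simp
next
  case (insert i D)
  then show ?case using assms(2) by (simp add: Pi_def mult_r_distr)
qed

lemma finsum_only:
  assumes "finite D" "i \<in> D" "x \<in> carrier T"
    and "f i = x" and "\<And>j. j \<in> D \<Longrightarrow> j \<noteq> i \<Longrightarrow> f j = \<zero>"
  shows "(\<Oplus>j\<in>D. f j) = x"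
proof -
  have "(\<Oplus>j\<in>D. f j) = (\<Oplus>j\<in>D. if i = j then x else \<zero>)"
    by (rule M.finsum_cong') (use assms in auto)
  also have "\<dots> = x"
    using M.finsum_singleton[OF assms(2,1), of "\<lambda>_. x"] assms(3) by simp
  finally show ?thesis .
qed

lemma finsum_all_zero:
  assumes "\<And>i. i \<in> D \<Longrightarrow> f i = \<zero>"
  shows "(\<Oplus>i\<in>D. f i) = \<zero>"
proof -
  have "(\<Oplus>i\<in>D. f i) = (\<Oplus>i\<in>D. \<zero>)"
    by (rule M.finsum_cong') (use assms in auto)
  then show ?thesis by simp
qed

lemma finsum_extend:
  assumes "finite D'" "D \<subseteq> D'" "f \<in> D \<rightarrow> carrier T"
    and "\<And>i. i \<in> D' - D \<Longrightarrow> f i = \<zero>"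
  shows "(\<Oplus>i\<in>D'. f i) = (\<Oplus>i\<in>D. f i)"
proof -
  have fin: "finite D" using assms finite_subset by blast
  have "(\<Oplus>i\<in>D \<union> (D' - D). f i) = (\<Oplus>i\<in>D. f i) \<oplus> (\<Oplus>i\<in>D' - D. f i)"
    by (rule M.finsum_Un_disjoint) (use assms fin in auto)
  moreover have "(\<Oplus>i\<in>D' - D. f i) = \<zero>"
    by (rule finsum_all_zero) (use assms in auto)
  moreover have "D \<union> (D' - D) = D'" using assms by auto
  moreover have "(\<Oplus>i\<in>D. f i) \<in> carrier T" using assms(3) by (rule M.finsum_closed)
  ultimately show ?thesis by simp
qed

end

definition algebra_hom ::
  "('k, 'n) ring_scheme \<Rightarrow> ('k, 'a, 'm) module_scheme \<Rightarrow> ('k, 'b, 'p) module_scheme \<Rightarrow> ('a \<Rightarrow> 'b) \<Rightarrow> bool"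
  where "algebra_hom K M N \<phi> \<longleftrightarrow> \<phi> \<in> carrier M \<rightarrow> carrier N \<and>
    (\<forall>x\<in>carrier M. \<forall>y\<in>carrier M.
       \<phi> (x \<oplus>\<^bsub>M\<^esub> y) = \<phi> x \<oplus>\<^bsub>N\<^esub> \<phi> y \<and> \<phi> (x \<otimes>\<^bsub>M\<^esub> y) = \<phi> x \<otimes>\<^bsub>N\<^esub> \<phi> y) \<and>
    (\<forall>k\<in>carrier K. \<forall>x\<in>carrier M. \<phi> (k \<odot>\<^bsub>M\<^esub> x) = k \<odot>\<^bsub>N\<^esub> \<phi> x)"

lemma algebra_homD:
  assumes "algebra_hom K M N \<phi>"
  shows "x \<in> carrier M \<Longrightarrow> \<phi> x \<in> carrier N"
    and "\<lbrakk>x \<in> carrier M; y \<in> carrier M\<rbrakk> \<Longrightarrow> \<phi> (x \<oplus>\<^bsub>M\<^esub> y) = \<phi> x \<oplus>\<^bsub>N\<^esub> \<phi> y"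
    and "\<lbrakk>x \<in> carrier M; y \<in> carrier M\<rbrakk> \<Longrightarrow> \<phi> (x \<otimes>\<^bsub>M\<^esub> y) = \<phi> x \<otimes>\<^bsub>N\<^esub> \<phi> y"
    and "\<lbrakk>k \<in> carrier K; x \<in> carrier M\<rbrakk> \<Longrightarrow> \<phi> (k \<odot>\<^bsub>M\<^esub> x) = k \<odot>\<^bsub>N\<^esub> \<phi> x"
  using assms unfolding algebra_hom_def by auto

lemma algebra_hom_abelian_group_hom:
  assumes "nonunital_algebra K M" "nonunital_algebra K N" "algebra_hom K M N \<phi>"
  shows "abelian_group_hom M N \<phi>"
proof -
  interpret M: nonunital_algebra K M by fact
  interpret N: nonunital_algebra K N by fact
  show ?thesis
    by (rule abelian_group_homI)
       (use assms(3) M.M.abelian_group_axioms N.M.abelian_group_axioms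
         M.M.a_group N.M.a_group in \<open>auto simp: algebra_hom_def group_hom_def group_hom_axioms_def hom_def\<close>)
qed

lemma algebra_hom_zero:
  assumes "nonunital_algebra K M" "nonunital_algebra K N" "algebra_hom K M N \<phi>"
  shows "\<phi> \<zero>\<^bsub>M\<^esub> = \<zero>\<^bsub>N\<^esub>"
proof -
  interpret abelian_group_hom M N \<phi> using assms by (rule algebra_hom_abelian_group_hom)
  show ?thesis by simp
qed

lemma algebra_hom_finsum:
  assumes "nonunital_algebra K M" "nonunital_algebra K N" "algebra_hom K M N \<phi>"
    and "finite D" "f \<in> D \<rightarrow> carrier M"
  shows "\<phi> (\<Oplus>\<^bsub>M\<^esub>i\<in>D. f i) = (\<Oplus>\<^bsub>N\<^esub>i\<in>D. \<phi> (f i))"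
  using assms(4,5)
proof (induction rule: finite_induct)
  case empty
  interpret M: nonunital_algebra K M by fact
  interpret N: nonunital_algebra K N by fact
  show ?case by (simp add: algebra_hom_zero[OF assms(1-3)])
next
  case (insert i D)
  interpret M: nonunital_algebra K M by fact
  interpret N: nonunital_algebra K N by fact
  show ?case
    using insert
    by (simp add: M.M.finsum_insert N.M.finsum_insert M.M.finsum_closed Pi_def algebra_homD[OF assms(3)])
qed

lemma bij_algebra_hom_inverse:
  assumes M: "nonunital_algebra K M" and \<phi>: "algebra_hom K M N \<phi>"
    and bij: "bij_betw \<phi> (carrier M) (carrier N)"
  shows "inv_into (carrier M) \<phi> \<in> algebra_isos K N M"
proof -
  interpret M: nonunital_algebra K M by fact
  let ?\<psi> = "inv_into (carrier M) \<phi>"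
  have inv: "?\<psi> (\<phi> x) = x" if "x \<in> carrier M" for x
    using bij that by (simp add: bij_betw_inv_into_left)
  have onto: "\<exists>x\<in>carrier M. y = \<phi> x" if "y \<in> carrier N" for y
    using bij that by (auto simp: bij_betw_def)
  have mult: "?\<psi> (y \<otimes>\<^bsub>N\<^esub> z) = ?\<psi> y \<otimes>\<^bsub>M\<^esub> ?\<psi> z"
    and add: "?\<psi> (y \<oplus>\<^bsub>N\<^esub> z) = ?\<psi> y \<oplus>\<^bsub>M\<^esub> ?\<psi> z"
    if yz: "y \<in> carrier N" "z \<in> carrier N" for y z
  proof -
    obtain a b where "a \<in> carrier M" "y = \<phi> a" "b \<in> carrier M" "z = \<phi> b"
      using yz onto by blast
    then show "?\<psi> (y \<otimes>\<^bsub>N\<^esub> z) = ?\<psi> y \<otimes>\<^bsub>M\<^esub> ?\<psi> z" "?\<psi> (y \<oplus>\<^bsub>N\<^esub> z) = ?\<psi> y \<oplus>\<^bsub>M\<^esub> ?\<psi> z"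
      by (simp_all add: inv algebra_homD(2,3)[OF \<phi>, symmetric])
  qed
  have smult: "?\<psi> (k \<odot>\<^bsub>N\<^esub> y) = k \<odot>\<^bsub>M\<^esub> ?\<psi> y" if ky: "k \<in> carrier K" "y \<in> carrier N" for k y
  proof -
    obtain a where "a \<in> carrier M" "y = \<phi> a"
      using ky onto by blast
    then show ?thesis
      using ky by (simp add: inv algebra_homD(4)[OF \<phi>, symmetric])
  qed
  have "bij_betw ?\<psi> (carrier N) (carrier M)"
    using bij by (rule bij_betw_inv_into)
  then show ?thesis
    by (auto simp: algebra_isos_def iso_def hom_def mult add smult bij_betw_def)
qed

section \<open>Algebras given by generators and relations\<close>

locale presentation = cring K for K :: "('k, 'n) ring_scheme" (structure) +
  fixes G :: "'g set" and Rel :: "(('k, 'g) alg_expr \<times> ('k, 'g) alg_expr) set"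
begin

abbreviation expr_class :: "('k, 'g) alg_expr \<Rightarrow> ('k, 'g) alg_expr set" where
  "expr_class x \<equiv> alg_cong K G Rel `` {x}"

abbreviation PA :: "('k, ('k, 'g) alg_expr set) module" where
  "PA \<equiv> presented_algebra K G Rel"

lemma alg_cong_exprs:
  assumes "(x, y) \<in> alg_cong K G Rel"
  shows "x \<in> alg_exprs K G \<and> y \<in> alg_exprs K G"
  using assms by induction (auto intro: alg_exprs.intros)

lemma equiv_alg_cong: "equiv (alg_exprs K G) (alg_cong K G Rel)"
proof (rule equivI)
  show "alg_cong K G Rel \<subseteq> alg_exprs K G \<times> alg_exprs K G"
    using alg_cong_exprs by auto
  show "refl_on (alg_exprs K G) (alg_cong K G Rel)"
    using alg_cong_exprs by (auto simp: refl_on_def intro: alg_cong.refl)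
  show "sym (alg_cong K G Rel)" by (auto simp: sym_def intro: alg_cong.sym)
  show "trans (alg_cong K G Rel)" by (auto simp: trans_def intro: alg_cong.trans)
qed

lemma expr_class_eqI: "(x, y) \<in> alg_cong K G Rel \<Longrightarrow> expr_class x = expr_class y"
  using equiv_alg_cong by (rule equiv_class_eq)

lemma expr_class_closed: "x \<in> alg_exprs K G \<Longrightarrow> expr_class x \<in> carrier PA"
  by (simp add: presented_algebra_def quotientI)

lemma carrier_PA_cases:
  assumes "X \<in> carrier PA"
  obtains x where "x \<in> alg_exprs K G" "X = expr_class x"
  using assms by (auto simp: presented_algebra_def elim: quotientE)

lemma zero_PA: "\<zero>\<^bsub>PA\<^esub> = expr_class AZero"
  by (simp add: presented_algebra_def)

lemma add_expr_class:
  assumes "x \<in> alg_exprs K G" "y \<in> alg_exprs K G"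
  shows "expr_class x \<oplus>\<^bsub>PA\<^esub> expr_class y = expr_class (AAdd x y)"
proof -
  have "congruent2 (alg_cong K G Rel) (alg_cong K G Rel) (\<lambda>x y. expr_class (AAdd x y))"
    by (rule congruent2I', rule expr_class_eqI, rule alg_cong.add_cong)
  then show ?thesis
    using assms by (simp add: presented_algebra_def UN_equiv_class2[OF equiv_alg_cong equiv_alg_cong])
qed

lemma mult_expr_class:
  assumes "x \<in> alg_exprs K G" "y \<in> alg_exprs K G"
  shows "expr_class x \<otimes>\<^bsub>PA\<^esub> expr_class y = expr_class (AMul x y)"
proof -
  have "congruent2 (alg_cong K G Rel) (alg_cong K G Rel) (\<lambda>x y. expr_class (AMul x y))"
    by (rule congruent2I', rule expr_class_eqI, rule alg_cong.mul_cong)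
  then show ?thesis
    using assms by (simp add: presented_algebra_def UN_equiv_class2[OF equiv_alg_cong equiv_alg_cong])
qed

lemma smult_expr_class:
  assumes "k \<in> carrier K" "x \<in> alg_exprs K G"
  shows "k \<odot>\<^bsub>PA\<^esub> expr_class x = expr_class (AScale k x)"
proof -
  have "congruent (alg_cong K G Rel) (\<lambda>x. expr_class (AScale k x))"
    by (rule congruentI, rule expr_class_eqI, rule alg_cong.scale_cong[OF assms(1)])
  then show ?thesis
    using assms by (simp add: presented_algebra_def UN_equiv_class[OF equiv_alg_cong])
qed

lemmas expr_class_ops = zero_PA add_expr_class mult_expr_class smult_expr_class

lemmas alg_cong_laws = alg_cong.add_assoc alg_cong.mul_assoc alg_cong.distrib_left
  alg_cong.distrib_right alg_cong.scale_add alg_cong.add_scale alg_cong.scale_scale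
  alg_cong.scale_one

lemma abelian_group_PA: "abelian_group PA"
proof (rule abelian_groupI)
  fix X Y assume "X \<in> carrier PA" "Y \<in> carrier PA"
  then show "X \<oplus>\<^bsub>PA\<^esub> Y \<in> carrier PA"
    by (elim carrier_PA_cases) (auto simp: expr_class_ops intro: expr_class_closed alg_exprs.intros)
next
  show "\<zero>\<^bsub>PA\<^esub> \<in> carrier PA" by (simp add: zero_PA expr_class_closed alg_exprs.zero)
next
  fix X Y Z assume "X \<in> carrier PA" "Y \<in> carrier PA" "Z \<in> carrier PA"
  then show "X \<oplus>\<^bsub>PA\<^esub> Y \<oplus>\<^bsub>PA\<^esub> Z = X \<oplus>\<^bsub>PA\<^esub> (Y \<oplus>\<^bsub>PA\<^esub> Z)"
    by (elim carrier_PA_cases)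
       (simp add: expr_class_ops alg_exprs.intros expr_class_eqI alg_cong.add_assoc)
next
  fix X Y assume "X \<in> carrier PA" "Y \<in> carrier PA"
  then show "X \<oplus>\<^bsub>PA\<^esub> Y = Y \<oplus>\<^bsub>PA\<^esub> X"
    by (elim carrier_PA_cases)
       (simp add: expr_class_ops alg_exprs.intros expr_class_eqI alg_cong.add_comm)
next
  fix X assume "X \<in> carrier PA"
  then show "\<zero>\<^bsub>PA\<^esub> \<oplus>\<^bsub>PA\<^esub> X = X"
    by (elim carrier_PA_cases)
       (simp add: expr_class_ops alg_exprs.intros expr_class_eqI alg_cong.add_zero)
next
  fix X assume "X \<in> carrier PA"
  then obtain x where x: "x \<in> alg_exprs K G" "X = expr_class x" by (elim carrier_PA_cases)
  then have "expr_class (ANeg x) \<oplus>\<^bsub>PA\<^esub> X = \<zero>\<^bsub>PA\<^esub>"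
    by (simp add: expr_class_ops alg_exprs.intros expr_class_eqI alg_cong.add_neg)
  then show "\<exists>Y\<in>carrier PA. Y \<oplus>\<^bsub>PA\<^esub> X = \<zero>\<^bsub>PA\<^esub>"
    using x by (blast intro: expr_class_closed alg_exprs.neg)
qed

lemma module_PA: "Module.module K PA"
proof (rule Module.moduleI)
  show "cring K" by (rule is_cring)
  show "abelian_group PA" by (rule abelian_group_PA)
qed ((elim carrier_PA_cases,
      simp add: expr_class_ops alg_exprs.intros expr_class_closed expr_class_eqI alg_cong_laws)+)

lemma nonunital_algebra_PA: "nonunital_algebra K PA"
proof (rule nonunital_algebra.intro[OF module_PA], unfold_locales)
  fix X Y assume "X \<in> carrier PA" "Y \<in> carrier PA"
  then show "X \<otimes>\<^bsub>PA\<^esub> Y \<in> carrier PA"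
    by (elim carrier_PA_cases) (auto simp: expr_class_ops intro: expr_class_closed alg_exprs.intros)
next
  fix k X Y assume k: "k \<in> carrier K" and "X \<in> carrier PA" "Y \<in> carrier PA"
  then obtain x y where x: "x \<in> alg_exprs K G" "X = expr_class x"
      and y: "y \<in> alg_exprs K G" "Y = expr_class y"
    by (elim carrier_PA_cases)
  show "k \<odot>\<^bsub>PA\<^esub> X \<otimes>\<^bsub>PA\<^esub> Y = k \<odot>\<^bsub>PA\<^esub> (X \<otimes>\<^bsub>PA\<^esub> Y)"
    using k x y
    by (simp add: expr_class_ops alg_exprs.intros expr_class_eqI
        alg_cong.scale_mul_left[THEN alg_cong.sym])
  show "X \<otimes>\<^bsub>PA\<^esub> (k \<odot>\<^bsub>PA\<^esub> Y) = k \<odot>\<^bsub>PA\<^esub> (X \<otimes>\<^bsub>PA\<^esub> Y)"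
    using k x y
    by (simp add: expr_class_ops alg_exprs.intros expr_class_eqI
        alg_cong.scale_mul_right[THEN alg_cong.sym])
qed ((elim carrier_PA_cases,
      simp add: expr_class_ops alg_exprs.intros expr_class_closed expr_class_eqI alg_cong_laws)+)

lemma a_inv_expr_class:
  assumes "x \<in> alg_exprs K G"
  shows "\<ominus>\<^bsub>PA\<^esub> expr_class x = expr_class (ANeg x)"
proof -
  interpret PA: nonunital_algebra K PA by (rule nonunital_algebra_PA)
  have "expr_class (ANeg x) \<oplus>\<^bsub>PA\<^esub> expr_class x = \<zero>\<^bsub>PA\<^esub>"
    using assms by (simp add: expr_class_ops alg_exprs.intros expr_class_eqI alg_cong.add_neg)
  then show ?thesis
    using assms by (simp add: PA.M.minus_equality expr_class_closed alg_exprs.neg)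
qed

lemma carrier_PA_induct [consumes 1, case_names zero gen add neg mult smult]:
  assumes "X \<in> carrier PA"
    and "P \<zero>\<^bsub>PA\<^esub>"
    and "\<And>g. g \<in> G \<Longrightarrow> P (expr_class (AGen g))"
    and "\<And>X Y. \<lbrakk>X \<in> carrier PA; Y \<in> carrier PA; P X; P Y\<rbrakk> \<Longrightarrow> P (X \<oplus>\<^bsub>PA\<^esub> Y)"
    and "\<And>X. \<lbrakk>X \<in> carrier PA; P X\<rbrakk> \<Longrightarrow> P (\<ominus>\<^bsub>PA\<^esub> X)"
    and "\<And>X Y. \<lbrakk>X \<in> carrier PA; Y \<in> carrier PA; P X; P Y\<rbrakk> \<Longrightarrow> P (X \<otimes>\<^bsub>PA\<^esub> Y)"
    and "\<And>k X. \<lbrakk>k \<in> carrier K; X \<in> carrier PA; P X\<rbrakk> \<Longrightarrow> P (k \<odot>\<^bsub>PA\<^esub> X)"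
  shows "P X"
proof -
  have "P (expr_class x)" if "x \<in> alg_exprs K G" for x
    using that
  proof induction
    case zero then show ?case using assms(2) by (simp add: zero_PA)
  next
    case (gen g) then show ?case by (rule assms(3))
  next
    case (add x y) then show ?case
      using assms(4)[of "expr_class x" "expr_class y"] by (simp add: add_expr_class expr_class_closed)
  next
    case (neg x) then show ?case
      using assms(5)[of "expr_class x"] by (simp add: a_inv_expr_class expr_class_closed)
  next
    case (mul x y) then show ?case
      using assms(6)[of "expr_class x" "expr_class y"] by (simp add: mult_expr_class expr_class_closed)
  next
    case (scale k x) then show ?case
      using assms(7)[of k "expr_class x"] by (simp add: smult_expr_class expr_class_closed)
  qed
  then show ?thesis using assms(1) by (elim carrier_PA_cases) simp
qed

end

fun alg_eval :: "('k, 'a, 'm) module_scheme \<Rightarrow> ('g \<Rightarrow> 'a) \<Rightarrow> ('k, 'g) alg_expr \<Rightarrow> 'a" where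
  "alg_eval T \<gamma> AZero = \<zero>\<^bsub>T\<^esub>"
| "alg_eval T \<gamma> (AGen g) = \<gamma> g"
| "alg_eval T \<gamma> (AAdd x y) = alg_eval T \<gamma> x \<oplus>\<^bsub>T\<^esub> alg_eval T \<gamma> y"
| "alg_eval T \<gamma> (ANeg x) = \<ominus>\<^bsub>T\<^esub> alg_eval T \<gamma> x"
| "alg_eval T \<gamma> (AMul x y) = alg_eval T \<gamma> x \<otimes>\<^bsub>T\<^esub> alg_eval T \<gamma> y"
| "alg_eval T \<gamma> (AScale k x) = k \<odot>\<^bsub>T\<^esub> alg_eval T \<gamma> x"

text \<open>
  A class of expressions has a single value under evaluation as soon as the images of the
  generators satisfy the relations (\<open>presented_hom_class\<close>); this value is the image of the class.
\<close>

definition presented_hom ::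
  "('k, 'a, 'm) module_scheme \<Rightarrow> ('g \<Rightarrow> 'a) \<Rightarrow> ('k, 'g) alg_expr set \<Rightarrow> 'a" where
  "presented_hom T \<gamma> X = the_elem (alg_eval T \<gamma> ` X)"

context nonunital_algebra
begin

lemma alg_eval_closed:
  assumes "x \<in> alg_exprs K G" "\<gamma> \<in> G \<rightarrow> carrier T"
  shows "alg_eval T \<gamma> x \<in> carrier T"
  using assms by induction auto

text \<open>
  Each clause of \<^const>\<open>alg_cong\<close> is a relation, an algebra axiom or a closure rule, so evaluation
  respects all of them.
\<close>

lemma alg_eval_cong:
  assumes "(x, y) \<in> alg_cong K G Rel" and \<gamma>: "\<gamma> \<in> G \<rightarrow> carrier T"
    and rel: "\<And>x y. (x, y) \<in> Rel \<Longrightarrow> alg_eval T \<gamma> x = alg_eval T \<gamma> y"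
  shows "alg_eval T \<gamma> x = alg_eval T \<gamma> y"
  using assms(1)
  by induction
     (simp_all add: rel alg_eval_closed[OF _ \<gamma>] M.a_ac M.r_neg mult_assoc mult_r_distr
        mult_l_distr smult_r_distr smult_l_distr smult_assoc1 smult_mult_left smult_mult_right)

lemma presented_hom_class:
  assumes \<gamma>: "\<gamma> \<in> G \<rightarrow> carrier T"
    and rel: "\<And>x y. (x, y) \<in> Rel \<Longrightarrow> alg_eval T \<gamma> x = alg_eval T \<gamma> y"
    and x: "x \<in> alg_exprs K G"
  shows "presented_hom T \<gamma> (alg_cong K G Rel `` {x}) = alg_eval T \<gamma> x"
proof -
  have "alg_eval T \<gamma> y = alg_eval T \<gamma> x" if "y \<in> alg_cong K G Rel `` {x}" for y
    using alg_eval_cong[OF _ \<gamma> rel, of x y] that by simp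
  moreover have "x \<in> alg_cong K G Rel `` {x}"
    using alg_cong.refl[OF x] by simp
  ultimately have "alg_eval T \<gamma> ` (alg_cong K G Rel `` {x}) = {alg_eval T \<gamma> x}"
    by blast
  then show ?thesis by (simp add: presented_hom_def)
qed

theorem presented_hom:
  assumes \<gamma>: "\<gamma> \<in> G \<rightarrow> carrier T"
    and rel: "\<And>x y. (x, y) \<in> Rel \<Longrightarrow> alg_eval T \<gamma> x = alg_eval T \<gamma> y"
  shows "algebra_hom K (presented_algebra K G Rel) T (presented_hom T \<gamma>)"
proof -
  interpret P: presentation K G Rel ..
  note cl = presented_hom_class[OF \<gamma> rel]
  show ?thesis
    unfolding algebra_hom_def
  proof (intro conjI ballI)
    show "presented_hom T \<gamma> \<in> carrier P.PA \<rightarrow> carrier T"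
      by (auto elim!: P.carrier_PA_cases simp: cl alg_eval_closed[OF _ \<gamma>])
  qed (elim P.carrier_PA_cases, simp add: P.expr_class_ops cl alg_exprs.intros)+
qed

end

section \<open>Leavitt families\<close>

text \<open>
  Elements of an algebra that satisfy the defining relations of \<open>L\<^sub>K(E)\<close>, with the relation at a
  regular vertex stated as a sum over its set of edges.
\<close>

locale leavitt_family = nonunital_algebra K T for K and T (structure) +
  fixes E :: "('v, 'e) pre_digraph" and \<gamma> :: "('v, 'e) lpa_gen \<Rightarrow> 'b"
  assumes wf: "wf_digraph E"
    and gens_closed: "\<gamma> \<in> lpa_gens E \<rightarrow> carrier T"
    and vertex_idem: "v \<in> verts E \<Longrightarrow> \<gamma> (Vertex v) \<otimes> \<gamma> (Vertex v) = \<gamma> (Vertex v)"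
    and vertex_orth:
      "\<lbrakk>v \<in> verts E; w \<in> verts E; v \<noteq> w\<rbrakk> \<Longrightarrow> \<gamma> (Vertex v) \<otimes> \<gamma> (Vertex w) = \<zero>"
    and tail_edge: "e \<in> arcs E \<Longrightarrow> \<gamma> (Vertex (tail E e)) \<otimes> \<gamma> (Edge e) = \<gamma> (Edge e)"
    and edge_head: "e \<in> arcs E \<Longrightarrow> \<gamma> (Edge e) \<otimes> \<gamma> (Vertex (head E e)) = \<gamma> (Edge e)"
    and head_ghost: "e \<in> arcs E \<Longrightarrow> \<gamma> (Vertex (head E e)) \<otimes> \<gamma> (Ghost e) = \<gamma> (Ghost e)"
    and ghost_tail: "e \<in> arcs E \<Longrightarrow> \<gamma> (Ghost e) \<otimes> \<gamma> (Vertex (tail E e)) = \<gamma> (Ghost e)"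
    and ghost_edge_same: "e \<in> arcs E \<Longrightarrow> \<gamma> (Ghost e) \<otimes> \<gamma> (Edge e) = \<gamma> (Vertex (head E e))"
    and ghost_edge_diff:
      "\<lbrakk>e \<in> arcs E; f \<in> arcs E; e \<noteq> f\<rbrakk> \<Longrightarrow> \<gamma> (Ghost e) \<otimes> \<gamma> (Edge f) = \<zero>"
    and regular_sum:
      "regular_vertex E v \<Longrightarrow> \<gamma> (Vertex v) = (\<Oplus>e\<in>out_arcs E v. \<gamma> (Edge e) \<otimes> \<gamma> (Ghost e))"
begin

abbreviation vx :: "'v \<Rightarrow> 'b" where "vx v \<equiv> \<gamma> (Vertex v)"
abbreviation ed :: "'e \<Rightarrow> 'b" where "ed e \<equiv> \<gamma> (Edge e)"
abbreviation gh :: "'e \<Rightarrow> 'b" where "gh e \<equiv> \<gamma> (Ghost e)"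

lemma gen_closed [simp]:
  "v \<in> verts E \<Longrightarrow> vx v \<in> carrier T" "e \<in> arcs E \<Longrightarrow> ed e \<in> carrier T"
  "e \<in> arcs E \<Longrightarrow> gh e \<in> carrier T"
  using gens_closed by (auto simp: lpa_gens_def)

lemma ends_in_verts [simp]:
  "e \<in> arcs E \<Longrightarrow> tail E e \<in> verts E" "e \<in> arcs E \<Longrightarrow> head E e \<in> verts E"
  using wf by (simp_all add: wf_digraph_def)

lemma vertex_mult:
  "\<lbrakk>v \<in> verts E; w \<in> verts E\<rbrakk> \<Longrightarrow> vx v \<otimes> vx w = (if v = w then vx v else \<zero>)"
  by (simp add: vertex_idem vertex_orth)

lemma vertex_edge:
  assumes "v \<in> verts E" "e \<in> arcs E"
  shows "vx v \<otimes> ed e = (if v = tail E e then ed e else \<zero>)"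
proof -
  have "vx v \<otimes> ed e = vx v \<otimes> vx (tail E e) \<otimes> ed e"
    using assms by (simp add: mult_assoc tail_edge)
  then show ?thesis using assms by (simp add: vertex_mult tail_edge)
qed

lemma edge_vertex:
  assumes "v \<in> verts E" "e \<in> arcs E"
  shows "ed e \<otimes> vx v = (if v = head E e then ed e else \<zero>)"
proof -
  have "ed e \<otimes> vx v = ed e \<otimes> (vx (head E e) \<otimes> vx v)"
    using assms by (simp add: mult_assoc[symmetric] edge_head)
  then show ?thesis using assms by (simp add: vertex_mult edge_head)
qed

lemma vertex_ghost:
  assumes "v \<in> verts E" "e \<in> arcs E"
  shows "vx v \<otimes> gh e = (if v = head E e then gh e else \<zero>)"
proof -
  have "vx v \<otimes> gh e = vx v \<otimes> vx (head E e) \<otimes> gh e"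
    using assms by (simp add: mult_assoc head_ghost)
  then show ?thesis using assms by (simp add: vertex_mult head_ghost)
qed

lemma ghost_vertex:
  assumes "v \<in> verts E" "e \<in> arcs E"
  shows "gh e \<otimes> vx v = (if v = tail E e then gh e else \<zero>)"
proof -
  have "gh e \<otimes> vx v = gh e \<otimes> (vx (tail E e) \<otimes> vx v)"
    using assms by (simp add: mult_assoc[symmetric] ghost_tail)
  then show ?thesis using assms by (simp add: vertex_mult ghost_tail)
qed

lemma ghost_edge:
  "\<lbrakk>e \<in> arcs E; f \<in> arcs E\<rbrakk> \<Longrightarrow> gh e \<otimes> ed f = (if e = f then vx (head E e) else \<zero>)"
  by (simp add: ghost_edge_same ghost_edge_diff)

lemmas gen_mult = vertex_mult vertex_edge edge_vertex vertex_ghost ghost_vertex ghost_edge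

lemma gen_mult_assoc:
  assumes "x \<in> carrier T"
  shows "\<lbrakk>v \<in> verts E; w \<in> verts E\<rbrakk> \<Longrightarrow> vx v \<otimes> (vx w \<otimes> x) = (if v = w then vx v \<otimes> x else \<zero>)"
    and "\<lbrakk>v \<in> verts E; e \<in> arcs E\<rbrakk> \<Longrightarrow> vx v \<otimes> (ed e \<otimes> x) = (if v = tail E e then ed e \<otimes> x else \<zero>)"
    and "\<lbrakk>v \<in> verts E; e \<in> arcs E\<rbrakk> \<Longrightarrow> ed e \<otimes> (vx v \<otimes> x) = (if v = head E e then ed e \<otimes> x else \<zero>)"
    and "\<lbrakk>v \<in> verts E; e \<in> arcs E\<rbrakk> \<Longrightarrow> vx v \<otimes> (gh e \<otimes> x) = (if v = head E e then gh e \<otimes> x else \<zero>)"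
    and "\<lbrakk>v \<in> verts E; e \<in> arcs E\<rbrakk> \<Longrightarrow> gh e \<otimes> (vx v \<otimes> x) = (if v = tail E e then gh e \<otimes> x else \<zero>)"
    and "\<lbrakk>e \<in> arcs E; f \<in> arcs E\<rbrakk> \<Longrightarrow>
      gh e \<otimes> (ed f \<otimes> x) = (if e = f then vx (head E e) \<otimes> x else \<zero>)"
  using assms by (auto simp: mult_assoc[symmetric] gen_mult)

lemma alg_eval_edge_ghost_sum:
  assumes "distinct es" "set es \<subseteq> arcs E"
  shows "alg_eval T \<gamma> (foldr (\<lambda>e. AAdd (AMul (AGen (Edge e)) (AGen (Ghost e)))) es AZero) =
    (\<Oplus>e\<in>set es. ed e \<otimes> gh e)"
  using assms by (induction es) (auto simp: M.finsum_insert Pi_def subset_iff)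

lemma alg_eval_lpa_rels:
  assumes "(x, y) \<in> lpa_rels E"
  shows "alg_eval T \<gamma> x = alg_eval T \<gamma> y"
  using assms
proof cases
  case (ck2 v es)
  then have "alg_eval T \<gamma> y = (\<Oplus>e\<in>out_arcs E v. ed e \<otimes> gh e)"
    by (simp add: alg_eval_edge_ghost_sum subset_iff out_arcs_def)
  then show ?thesis using ck2 regular_sum by simp
qed (simp_all add: gen_mult)

theorem lpa_hom: "algebra_hom K (lpa K E) T (presented_hom T \<gamma>)"
  unfolding lpa_def using gens_closed alg_eval_lpa_rels by (rule presented_hom)

theorem lpa_hom_incl:
  assumes "g \<in> lpa_gens E"
  shows "presented_hom T \<gamma> (lpa_incl K E g) = \<gamma> g"
  unfolding lpa_incl_def
  by (simp add: presented_hom_class[OF gens_closed alg_eval_lpa_rels alg_exprs.gen[OF assms]])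

end

section \<open>Leavitt path algebras and their local units\<close>

text \<open>
  Keeping the algebra and its generators as parameters makes the index-free notation of the
  structure \<open>T\<close> available for computations in the Leavitt path algebra.
\<close>

locale leavitt_path_algebra =
  fixes K :: "('k, 'n) ring_scheme" and T (structure) and E :: "('v, 'e) pre_digraph" and \<gamma>
  assumes K_cring: "cring K" and wf_E: "wf_digraph E"
    and T_eq: "T = lpa K E" and \<gamma>_eq: "\<gamma> = lpa_incl K E"
begin

lemma presentation_axioms: "presentation K"
  using K_cring by (rule presentation.intro)

end

sublocale leavitt_path_algebra \<subseteq> pres: presentation K "lpa_gens E" "lpa_rels E"
  by (rule presentation_axioms)

context leavitt_path_algebra
begin

lemma T_presented: "T = presented_algebra K (lpa_gens E) (lpa_rels E)"
  by (simp add: T_eq lpa_def)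

lemma \<gamma>_class: "\<gamma> g = alg_cong K (lpa_gens E) (lpa_rels E) `` {AGen g}"
  by (simp add: \<gamma>_eq lpa_incl_def)

lemma nonunital_algebra_T: "nonunital_algebra K T"
  unfolding T_presented by (rule pres.nonunital_algebra_PA)

end

sublocale leavitt_path_algebra \<subseteq> nonunital_algebra K T
  by (rule nonunital_algebra_T)

context leavitt_path_algebra
begin

lemma AGen_expr:
  "v \<in> verts E \<Longrightarrow> AGen (Vertex v) \<in> alg_exprs K (lpa_gens E)"
  "e \<in> arcs E \<Longrightarrow> AGen (Edge e) \<in> alg_exprs K (lpa_gens E)"
  "e \<in> arcs E \<Longrightarrow> AGen (Ghost e) \<in> alg_exprs K (lpa_gens E)"
  by (auto intro!: alg_exprs.gen simp: lpa_gens_def)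

lemma class_add:
  "\<lbrakk>x \<in> alg_exprs K (lpa_gens E); y \<in> alg_exprs K (lpa_gens E)\<rbrakk> \<Longrightarrow>
    pres.expr_class (AAdd x y) = pres.expr_class x \<oplus> pres.expr_class y"
  by (simp add: T_presented pres.add_expr_class)

lemma class_mult:
  "\<lbrakk>x \<in> alg_exprs K (lpa_gens E); y \<in> alg_exprs K (lpa_gens E)\<rbrakk> \<Longrightarrow>
    pres.expr_class (AMul x y) = pres.expr_class x \<otimes> pres.expr_class y"
  by (simp add: T_presented pres.mult_expr_class)

lemma class_edge_ghost_sum:
  assumes "distinct es" "set es \<subseteq> arcs E"
  defines "s \<equiv> foldr (\<lambda>e. AAdd (AMul (AGen (Edge e)) (AGen (Ghost e)))) es AZero"
  shows "s \<in> alg_exprs K (lpa_gens E) \<and>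
    pres.expr_class s = (\<Oplus>e\<in>set es. \<gamma> (Edge e) \<otimes> \<gamma> (Ghost e))"
  using assms(1,2) unfolding s_def
proof (induction es)
  case Nil
  then show ?case by (simp add: pres.zero_PA[symmetric] T_presented[symmetric] alg_exprs.zero)
next
  case (Cons e es)
  have e: "AGen (Edge e) \<in> alg_exprs K (lpa_gens E)" "AGen (Ghost e) \<in> alg_exprs K (lpa_gens E)"
    using Cons.prems by (auto intro!: alg_exprs.gen simp: lpa_gens_def)
  have "\<gamma> (Edge f) \<otimes> \<gamma> (Ghost f) \<in> carrier T" if "f \<in> arcs E" for f
    using that
    by (intro mult_closed) (simp_all add: \<gamma>_class T_presented pres.expr_class_closed AGen_expr)
  then have "(\<Oplus>f\<in>set (e # es). \<gamma> (Edge f) \<otimes> \<gamma> (Ghost f)) =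
      \<gamma> (Edge e) \<otimes> \<gamma> (Ghost e) \<oplus> (\<Oplus>f\<in>set es. \<gamma> (Edge f) \<otimes> \<gamma> (Ghost f))"
    using Cons.prems by (simp add: M.finsum_insert Pi_def subset_iff)
  then show ?case
    using Cons e by (simp add: \<gamma>_class class_mult class_add alg_exprs.intros)
qed

lemma class_rel:
  assumes "(x, y) \<in> lpa_rels E" "x \<in> alg_exprs K (lpa_gens E)" "y \<in> alg_exprs K (lpa_gens E)"
  shows "pres.expr_class x = pres.expr_class y"
  using assms by (intro pres.expr_class_eqI alg_cong.rel)

lemma leavitt_family_T: "leavitt_family K T E \<gamma>"
proof (rule leavitt_family.intro[OF nonunital_algebra_T], unfold_locales)
  show "\<gamma> \<in> lpa_gens E \<rightarrow> carrier T"
    by (auto simp: \<gamma>_class T_presented intro!: pres.expr_class_closed alg_exprs.gen)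
next
  fix v assume v: "regular_vertex E v"
  then obtain es where es: "distinct es" "set es = out_arcs E v"
    using finite_distinct_list unfolding regular_vertex_def by metis
  then show "\<gamma> (Vertex v) = (\<Oplus>e\<in>out_arcs E v. \<gamma> (Edge e) \<otimes> \<gamma> (Ghost e))"
    using class_edge_ghost_sum[of es] class_rel[OF lpa_rels.ck2[OF v es]] v
    by (auto simp: \<gamma>_class AGen_expr regular_vertex_def out_arcs_def)
next
  have ends: "tail E e \<in> verts E" "head E e \<in> verts E" if "e \<in> arcs E" for e
    using that wf_E by (simp_all add: wf_digraph_def)
  show "v \<in> verts E \<Longrightarrow> \<gamma> (Vertex v) \<otimes> \<gamma> (Vertex v) = \<gamma> (Vertex v)"
    "\<lbrakk>v \<in> verts E; w \<in> verts E; v \<noteq> w\<rbrakk> \<Longrightarrow> \<gamma> (Vertex v) \<otimes> \<gamma> (Vertex w) = \<zero>"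
    "e \<in> arcs E \<Longrightarrow> \<gamma> (Vertex (tail E e)) \<otimes> \<gamma> (Edge e) = \<gamma> (Edge e)"
    "e \<in> arcs E \<Longrightarrow> \<gamma> (Edge e) \<otimes> \<gamma> (Vertex (head E e)) = \<gamma> (Edge e)"
    "e \<in> arcs E \<Longrightarrow> \<gamma> (Vertex (head E e)) \<otimes> \<gamma> (Ghost e) = \<gamma> (Ghost e)"
    "e \<in> arcs E \<Longrightarrow> \<gamma> (Ghost e) \<otimes> \<gamma> (Vertex (tail E e)) = \<gamma> (Ghost e)"
    "e \<in> arcs E \<Longrightarrow> \<gamma> (Ghost e) \<otimes> \<gamma> (Edge e) = \<gamma> (Vertex (head E e))"
    "\<lbrakk>e \<in> arcs E; f \<in> arcs E; e \<noteq> f\<rbrakk> \<Longrightarrow> \<gamma> (Ghost e) \<otimes> \<gamma> (Edge f) = \<zero>" for v w e f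
    by (simp_all add: \<gamma>_class T_presented pres.mult_expr_class pres.zero_PA AGen_expr ends
        class_rel lpa_rels.intros alg_exprs.intros(1,5))
qed (use wf_E in \<open>simp_all add: wf_digraph_def\<close>)

end

sublocale leavitt_path_algebra \<subseteq> leavitt_family K T E \<gamma>
  by (rule leavitt_family_T)

context leavitt_path_algebra
begin

lemma lpa_induct [consumes 1, case_names zero gen add neg mult smult]:
  assumes "x \<in> carrier T"
    and "P \<zero>"
    and "\<And>g. g \<in> lpa_gens E \<Longrightarrow> P (\<gamma> g)"
    and "\<And>x y. \<lbrakk>x \<in> carrier T; y \<in> carrier T; P x; P y\<rbrakk> \<Longrightarrow> P (x \<oplus> y)"
    and "\<And>x. \<lbrakk>x \<in> carrier T; P x\<rbrakk> \<Longrightarrow> P (\<ominus> x)"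
    and "\<And>x y. \<lbrakk>x \<in> carrier T; y \<in> carrier T; P x; P y\<rbrakk> \<Longrightarrow> P (x \<otimes> y)"
    and "\<And>k x. \<lbrakk>k \<in> carrier K; x \<in> carrier T; P x\<rbrakk> \<Longrightarrow> P (k \<odot> x)"
  shows "P x"
  using assms unfolding T_presented \<gamma>_class by (rule pres.carrier_PA_induct)

definition vsum :: "'v set \<Rightarrow> ('k, ('v, 'e) lpa_gen) alg_expr set" where
  "vsum V = (\<Oplus>v\<in>V. vx v)"

lemma vsum_closed: "V \<subseteq> verts E \<Longrightarrow> vsum V \<in> carrier T"
  unfolding vsum_def by (rule M.finsum_closed) auto

lemma vertex_in_vsum:
  assumes "finite V" "V \<subseteq> verts E" "v \<in> V"
  shows "vsum V \<otimes> vx v = vx v" "vx v \<otimes> vsum V = vx v"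
proof -
  have v: "vx v \<in> carrier T" using assms by auto
  have closed: "vx \<in> V \<rightarrow> carrier T" using assms by auto
  show "vsum V \<otimes> vx v = vx v"
    unfolding vsum_def finsum_mult_left[OF assms(1) v closed]
    by (rule finsum_only[OF assms(1,3) v]) (use assms in \<open>simp_all add: vertex_mult subset_iff\<close>)
  show "vx v \<otimes> vsum V = vx v"
    unfolding vsum_def finsum_mult_right[OF assms(1) v closed]
    by (rule finsum_only[OF assms(1,3) v]) (use assms in \<open>simp_all add: vertex_mult subset_iff\<close>)
qed

lemma vsum_unit_gen:
  assumes g: "g \<in> lpa_gens E"
  obtains v w where "v \<in> verts E" "w \<in> verts E" "vx v \<otimes> \<gamma> g = \<gamma> g" "\<gamma> g \<otimes> vx w = \<gamma> g"
proof (cases g)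
  case (Vertex v)
  then show ?thesis using g that[of v v] by (auto simp: lpa_gens_def vertex_idem)
next
  case (Edge e)
  then show ?thesis
    using g that[of "tail E e" "head E e"] by (auto simp: lpa_gens_def tail_edge edge_head)
next
  case (Ghost e)
  then show ?thesis
    using g that[of "head E e" "tail E e"] by (auto simp: lpa_gens_def head_ghost ghost_tail)
qed

text \<open>
  There is no unit, but a sufficiently large finite sum of vertices acts as one on a given element.
  Asking this of all larger sets makes the property stable under sums and products: the union of two
  sets carries whatever either of them carries.
\<close>

definition carries :: "'v set \<Rightarrow> ('k, ('v, 'e) lpa_gen) alg_expr set \<Rightarrow> bool" where
  "carries V x \<longleftrightarrow> finite V \<and> V \<subseteq> verts E \<and>
    (\<forall>V'. finite V' \<and> V \<subseteq> V' \<and> V' \<subseteq> verts E \<longrightarrow> vsum V' \<otimes> x = x \<and> x \<otimes> vsum V' = x)"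

lemma carries_unit:
  assumes "carries V x" "finite V'" "V \<subseteq> V'" "V' \<subseteq> verts E"
  shows "vsum V' \<otimes> x = x" "x \<otimes> vsum V' = x"
  using assms by (auto simp: carries_def)

lemma carries_finite: "carries V x \<Longrightarrow> finite V \<and> V \<subseteq> verts E"
  by (simp add: carries_def)

lemma ex_carries:
  assumes "x \<in> carrier T"
  shows "\<exists>V. carries V x"
  using assms
proof (induction rule: lpa_induct)
  case zero
  have "carries {} \<zero>" by (simp add: vsum_closed carries_def)
  then show ?case by blast
next
  case (gen g)
  obtain v w where vw: "v \<in> verts E" "w \<in> verts E" "vx v \<otimes> \<gamma> g = \<gamma> g" "\<gamma> g \<otimes> vx w = \<gamma> g"
    using gen by (rule vsum_unit_gen)
  have g: "\<gamma> g \<in> carrier T" using gen gens_closed by auto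
  have "carries {v, w} (\<gamma> g)"
    unfolding carries_def
  proof (intro conjI allI impI)
    fix V' assume V': "finite V' \<and> {v, w} \<subseteq> V' \<and> V' \<subseteq> verts E"
    then have u: "vsum V' \<in> carrier T" by (simp add: vsum_closed)
    have "vsum V' \<otimes> (vx v \<otimes> \<gamma> g) = vx v \<otimes> \<gamma> g"
      using V' u vw(1) g by (simp add: mult_assoc[symmetric] vertex_in_vsum)
    then show "vsum V' \<otimes> \<gamma> g = \<gamma> g" by (simp add: vw)
    have "\<gamma> g \<otimes> vx w \<otimes> vsum V' = \<gamma> g \<otimes> vx w"
      using V' u vw(2) g by (simp add: mult_assoc vertex_in_vsum)
    then show "\<gamma> g \<otimes> vsum V' = \<gamma> g" by (simp add: vw)
  qed (use vw in auto)
  then show ?case by blast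
next
  case (add x y)
  then obtain V W where VW: "carries V x" "carries W y" by blast
  have "carries (V \<union> W) (x \<oplus> y)"
    unfolding carries_def
  proof (intro conjI allI impI)
    fix V' assume V': "finite V' \<and> V \<union> W \<subseteq> V' \<and> V' \<subseteq> verts E"
    then show "vsum V' \<otimes> (x \<oplus> y) = x \<oplus> y" "(x \<oplus> y) \<otimes> vsum V' = x \<oplus> y"
      using add.hyps VW by (simp_all add: mult_r_distr mult_l_distr vsum_closed carries_unit)
  qed (use VW[THEN carries_finite] in auto)
  then show ?case by blast
next
  case (neg x)
  then obtain V where "carries V x" by blast
  then have "carries V (\<ominus> x)"
    using neg.hyps by (simp add: carries_def mult_r_minus mult_l_minus vsum_closed)
  then show ?case by blast
next
  case (mult x y)
  then obtain V W where VW: "carries V x" "carries W y" by blast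
  have "carries (V \<union> W) (x \<otimes> y)"
    unfolding carries_def
  proof (intro conjI allI impI)
    fix V' assume V': "finite V' \<and> V \<union> W \<subseteq> V' \<and> V' \<subseteq> verts E"
    then show "x \<otimes> y \<otimes> vsum V' = x \<otimes> y"
      using mult.hyps VW by (simp add: mult_assoc vsum_closed carries_unit)
    show "vsum V' \<otimes> (x \<otimes> y) = x \<otimes> y"
      using mult.hyps VW V' by (simp add: mult_assoc[symmetric] vsum_closed carries_unit)
  qed (use VW[THEN carries_finite] in auto)
  then show ?case by blast
next
  case (smult k x)
  then obtain V where "carries V x" by blast
  then have "carries V (k \<odot> x)"
    using smult.hyps by (simp add: carries_def smult_mult_left smult_mult_right vsum_closed)
  then show ?case by blast
qed

lemma local_unit:
  assumes "x \<in> carrier T"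
  obtains V where "finite V" "V \<subseteq> verts E" "vsum V \<otimes> x = x" "x \<otimes> vsum V = x"
proof -
  obtain V where "carries V x" using ex_carries[OF assms] by blast
  then show ?thesis
    using that[of V] carries_finite[of V x] carries_unit[of V x V] by simp
qed

text \<open>
  Two-sided ideals are closed under scalars although the algebra has no unit: \<open>k x = (k u) x\<close> for a
  local unit \<open>u\<close> of \<open>x\<close>.
\<close>

lemma ideal_smult_closed:
  assumes J: "two_sided_ideal J T" and k: "k \<in> carrier K" and x: "x \<in> J"
  shows "k \<odot> x \<in> J"
proof -
  have xT: "x \<in> carrier T"
    using J x by (auto simp: two_sided_ideal_def dest: additive_subgroup.a_subset)
  obtain V where V: "V \<subseteq> verts E" "vsum V \<otimes> x = x" using local_unit[OF xT] by metis
  then have "k \<odot> x = (k \<odot> vsum V) \<otimes> x"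
    using k xT by (simp add: smult_mult_left vsum_closed)
  then show ?thesis using J x k V(1) by (simp add: two_sided_ideal_def vsum_closed)
qed

end

section \<open>The grading\<close>

text \<open>
  Uniqueness of homogeneous components is not visible in the presentation. It is obtained from an
  action on sequences indexed by the integers, in which a generator of degree \<open>d\<close> multiplies all
  entries and moves them \<open>d\<close> places. Both sides of each relation have the same degree, so the action
  descends to the Leavitt path algebra, and a homogeneous element of degree \<open>d\<close> moves entries by
  exactly \<open>d\<close> places. The sequences are in effect Laurent series in a variable that records degrees.
\<close>

fun shift_act ::
  "('k, 'a, 'm) module_scheme \<Rightarrow> (('v, 'e) lpa_gen \<Rightarrow> 'a) \<Rightarrow> ('k, ('v, 'e) lpa_gen) alg_expr \<Rightarrow>
   (int \<Rightarrow> 'a) \<Rightarrow> int \<Rightarrow> 'a" where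
  "shift_act T \<gamma> AZero F n = \<zero>\<^bsub>T\<^esub>"
| "shift_act T \<gamma> (AGen g) F n = \<gamma> g \<otimes>\<^bsub>T\<^esub> F (n - gen_degree g)"
| "shift_act T \<gamma> (AAdd x y) F n = shift_act T \<gamma> x F n \<oplus>\<^bsub>T\<^esub> shift_act T \<gamma> y F n"
| "shift_act T \<gamma> (ANeg x) F n = \<ominus>\<^bsub>T\<^esub> shift_act T \<gamma> x F n"
| "shift_act T \<gamma> (AMul x y) F n = shift_act T \<gamma> x (shift_act T \<gamma> y F) n"
| "shift_act T \<gamma> (AScale k x) F n = k \<odot>\<^bsub>T\<^esub> shift_act T \<gamma> x F n"

context leavitt_family
begin

lemma shift_act_closed:
  assumes "x \<in> alg_exprs K (lpa_gens E)" "\<And>n. F n \<in> carrier T"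
  shows "shift_act T \<gamma> x F n \<in> carrier T"
  using assms
  by (induction arbitrary: F n) (use gens_closed in auto)

lemma shift_act_add:
  assumes "x \<in> alg_exprs K (lpa_gens E)" "\<And>n. F n \<in> carrier T" "\<And>n. G n \<in> carrier T"
  shows "shift_act T \<gamma> x (\<lambda>n. F n \<oplus> G n) n = shift_act T \<gamma> x F n \<oplus> shift_act T \<gamma> x G n"
  using assms
proof (induction arbitrary: F G n)
  case zero then show ?case by simp
next
  case (gen g)
  then show ?case using gens_closed by (simp add: mult_r_distr Pi_def)
next
  case (add x y)
  then show ?case by (simp add: shift_act_closed M.a_ac)
next
  case (neg x)
  then show ?case by (simp add: shift_act_closed M.minus_add)
next
  case (mul x y)
  have "shift_act T \<gamma> y (\<lambda>n. F n \<oplus> G n) = (\<lambda>n. shift_act T \<gamma> y F n \<oplus> shift_act T \<gamma> y G n)"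
    using mul by blast
  then show ?case using mul by (simp add: shift_act_closed)
next
  case (scale k x)
  then show ?case by (simp add: shift_act_closed smult_r_distr)
qed

lemma shift_act_smult:
  assumes "x \<in> alg_exprs K (lpa_gens E)" "\<And>n. F n \<in> carrier T" "k \<in> carrier K"
  shows "shift_act T \<gamma> x (\<lambda>n. k \<odot> F n) n = k \<odot> shift_act T \<gamma> x F n"
  using assms
proof (induction arbitrary: F n)
  case zero then show ?case by simp
next
  case (gen g)
  then show ?case using gens_closed by (simp add: smult_mult_right Pi_def)
next
  case (add x y)
  then show ?case by (simp add: shift_act_closed smult_r_distr)
next
  case (neg x)
  then show ?case by (simp add: shift_act_closed smult_r_minus)
next
  case (mul x y)
  have "shift_act T \<gamma> y (\<lambda>n. k \<odot> F n) = (\<lambda>n. k \<odot> shift_act T \<gamma> y F n)"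
    using mul by blast
  then show ?case using mul by (simp add: shift_act_closed)
next
  case (scale l x)
  then show ?case
    by (simp add: shift_act_closed smult_assoc1[symmetric] R.m_comm)
qed

lemma shift_act_edge_ghost_sum:
  assumes "distinct es" "set es \<subseteq> arcs E" "\<And>n. F n \<in> carrier T"
  shows "shift_act T \<gamma> (foldr (\<lambda>e. AAdd (AMul (AGen (Edge e)) (AGen (Ghost e)))) es AZero) F n =
    (\<Oplus>e\<in>set es. ed e \<otimes> gh e) \<otimes> F n"
  using assms
proof (induction es)
  case Nil then show ?case by simp
next
  case (Cons e es)
  have "(\<Oplus>f\<in>set es. ed f \<otimes> gh f) \<in> carrier T"
    using Cons.prems by (intro M.finsum_closed) auto
  then show ?case
    using Cons by (simp add: M.finsum_insert Pi_def subset_iff mult_l_distr mult_assoc)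
qed

lemma shift_act_rels:
  assumes "(x, y) \<in> lpa_rels E" "\<And>n. F n \<in> carrier T"
  shows "shift_act T \<gamma> x F n = shift_act T \<gamma> y F n"
  using assms(1)
proof cases
  case (ck2 v es)
  then have "shift_act T \<gamma> y F n = (\<Oplus>e\<in>out_arcs E v. ed e \<otimes> gh e) \<otimes> F n"
    using assms(2) by (simp add: shift_act_edge_ghost_sum subset_iff out_arcs_def)
  then show ?thesis using ck2 regular_sum by simp
qed (simp_all add: gen_mult_assoc assms(2))

lemma shift_act_cong:
  assumes "(x, y) \<in> alg_cong K (lpa_gens E) (lpa_rels E)" "\<And>n. F n \<in> carrier T"
  shows "shift_act T \<gamma> x F = shift_act T \<gamma> y F"
proof -
  interpret pres: presentation K "lpa_gens E" "lpa_rels E" ..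
  from assms show ?thesis
  proof (induction arbitrary: F)
    case (rel x y)
    then show ?case by (intro ext shift_act_rels) auto
  next
    case (mul_cong x x' y y')
    then show ?case using pres.alg_cong_exprs[OF mul_cong.hyps(2)]
      by (intro ext) (simp add: shift_act_closed)
  next
    case (mul_assoc x y z)
    have "shift_act T \<gamma> (AMul y z) F = shift_act T \<gamma> y (shift_act T \<gamma> z F)"
      by (rule ext) simp
    then show ?case by (intro ext) simp
  next
    case (distrib_left x y z)
    have "shift_act T \<gamma> (AAdd y z) F = (\<lambda>n. shift_act T \<gamma> y F n \<oplus> shift_act T \<gamma> z F n)"
      by auto
    then show ?case using distrib_left by (intro ext) (simp add: shift_act_closed shift_act_add)
  next
    case (scale_mul_right k x y)
    have "shift_act T \<gamma> (AScale k y) F = (\<lambda>n. k \<odot> shift_act T \<gamma> y F n)"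
      by auto
    then show ?case using scale_mul_right by (intro ext) (simp add: shift_act_closed shift_act_smult)
  qed (auto intro!: ext simp: shift_act_closed M.a_ac M.r_neg smult_r_distr smult_l_distr
      smult_assoc1)
qed

end

context leavitt_path_algebra
begin

abbreviation homog :: "int \<Rightarrow> ('k, ('v, 'e) lpa_gen) alg_expr set \<Rightarrow> bool" where
  "homog \<equiv> lpa_homogeneous K E"

lemma homog_intros:
  "homog n \<zero>"
  "g \<in> lpa_gens E \<Longrightarrow> homog (gen_degree g) (\<gamma> g)"
  "\<lbrakk>homog n x; homog n y\<rbrakk> \<Longrightarrow> homog n (x \<oplus> y)"
  "\<lbrakk>k \<in> carrier K; homog n x\<rbrakk> \<Longrightarrow> homog n (k \<odot> x)"
  "\<lbrakk>homog m x; homog n y\<rbrakk> \<Longrightarrow> homog (m + n) (x \<otimes> y)"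
  unfolding T_eq \<gamma>_eq by (auto intro: lpa_homogeneous.intros)

lemma homog_induct [consumes 1, case_names zero gen add smult mult]:
  assumes "homog n x"
    and "\<And>n. P n \<zero>"
    and "\<And>g. g \<in> lpa_gens E \<Longrightarrow> P (gen_degree g) (\<gamma> g)"
    and "\<And>n x y. \<lbrakk>homog n x; homog n y; P n x; P n y\<rbrakk> \<Longrightarrow> P n (x \<oplus> y)"
    and "\<And>n k x. \<lbrakk>k \<in> carrier K; homog n x; P n x\<rbrakk> \<Longrightarrow> P n (k \<odot> x)"
    and "\<And>m n x y. \<lbrakk>homog m x; homog n y; P m x; P n y\<rbrakk> \<Longrightarrow> P (m + n) (x \<otimes> y)"
  shows "P n x"
  using assms(1)
  by induction (use assms(2-) in \<open>simp_all add: T_eq \<gamma>_eq\<close>)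

lemma homog_closed: "homog n x \<Longrightarrow> x \<in> carrier T"
  by (induction rule: homog_induct) (use gens_closed in auto)

lemma homog_family_closed: "\<forall>i\<in>D. homog (d i) (f i) \<Longrightarrow> f \<in> D \<rightarrow> carrier T"
  using homog_closed by blast

lemma homog_gens:
  "v \<in> verts E \<Longrightarrow> homog 0 (vx v)"
  "e \<in> arcs E \<Longrightarrow> homog 1 (ed e)"
  "e \<in> arcs E \<Longrightarrow> homog (- 1) (gh e)"
  using homog_intros(2)[of "Vertex v"] homog_intros(2)[of "Edge e"] homog_intros(2)[of "Ghost e"]
  by (simp_all add: lpa_gens_def)

lemma minus_as_smult: "x \<in> carrier T \<Longrightarrow> \<ominus> x = (\<ominus>\<^bsub>K\<^esub> \<one>\<^bsub>K\<^esub>) \<odot> x"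
  by (simp add: smult_l_minus)

lemma homog_minus: "homog n x \<Longrightarrow> homog n (\<ominus> x)"
  by (simp add: minus_as_smult homog_closed homog_intros(4))

lemma homog_finsum:
  assumes "finite D" "\<And>i. i \<in> D \<Longrightarrow> homog n (f i)"
  shows "homog n (\<Oplus>i\<in>D. f i)"
  using assms
proof (induction rule: finite_induct)
  case empty then show ?case by (simp add: homog_intros)
next
  case (insert i D)
  then have "f i \<in> carrier T" "f \<in> D \<rightarrow> carrier T" using homog_closed by blast+
  then show ?case using insert by (simp add: M.finsum_insert homog_intros)
qed

text \<open>The choice of a representative is immaterial by \<open>shift_act_cong\<close>.\<close>

definition shift ::
  "('k, ('v, 'e) lpa_gen) alg_expr set \<Rightarrow> (int \<Rightarrow> ('k, ('v, 'e) lpa_gen) alg_expr set) \<Rightarrow>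
   int \<Rightarrow> ('k, ('v, 'e) lpa_gen) alg_expr set" where
  "shift X = shift_act T \<gamma> (SOME x. x \<in> X)"

lemma shift_class:
  assumes "x \<in> alg_exprs K (lpa_gens E)" "\<And>n. F n \<in> carrier T"
  shows "shift (pres.expr_class x) F = shift_act T \<gamma> x F"
proof -
  have "x \<in> pres.expr_class x" using assms by (simp add: alg_cong.refl)
  then have "(SOME y. y \<in> pres.expr_class x) \<in> pres.expr_class x" by (rule someI)
  then show ?thesis unfolding shift_def using assms by (auto intro!: shift_act_cong alg_cong.sym)
qed

lemma class_cases:
  assumes "X \<in> carrier T"
  obtains x where "x \<in> alg_exprs K (lpa_gens E)" "X = pres.expr_class x"
  using assms unfolding T_presented by (rule pres.carrier_PA_cases)

lemma shift_ops:
  assumes X: "X \<in> carrier T" and Y: "Y \<in> carrier T" and k: "k \<in> carrier K"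
    and F: "\<And>n. F n \<in> carrier T"
  shows "shift X F n \<in> carrier T"
    and "shift (X \<oplus> Y) F n = shift X F n \<oplus> shift Y F n"
    and "shift (X \<otimes> Y) F = shift X (shift Y F)"
    and "shift (k \<odot> X) F n = k \<odot> shift X F n"
proof -
  obtain x where x: "x \<in> alg_exprs K (lpa_gens E)" "X = pres.expr_class x"
    using X by (rule class_cases)
  obtain y where y: "y \<in> alg_exprs K (lpa_gens E)" "Y = pres.expr_class y"
    using Y by (rule class_cases)
  have cl: "shift X F = shift_act T \<gamma> x F" "shift Y F = shift_act T \<gamma> y F"
    using x y F by (simp_all add: shift_class)
  show "shift X F n \<in> carrier T" using cl x F by (simp add: shift_act_closed)
  have "X \<oplus> Y = pres.expr_class (AAdd x y)"
    using x y by (simp add: T_presented pres.add_expr_class)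
  then show "shift (X \<oplus> Y) F n = shift X F n \<oplus> shift Y F n"
    using cl x y F by (simp add: shift_class alg_exprs.add)
  have "k \<odot> X = pres.expr_class (AScale k x)"
    using x k by (simp add: T_presented pres.smult_expr_class)
  then show "shift (k \<odot> X) F n = k \<odot> shift X F n"
    using cl x k F by (simp add: shift_class alg_exprs.scale)
  have "X \<otimes> Y = pres.expr_class (AMul x y)"
    using x y by (simp add: T_presented pres.mult_expr_class)
  then have "shift (X \<otimes> Y) F = shift_act T \<gamma> (AMul x y) F"
    using x y F by (simp add: shift_class alg_exprs.mul)
  also have "\<dots> = shift_act T \<gamma> x (shift Y F)" by (rule ext) (simp add: cl)
  also have "\<dots> = shift X (shift Y F)"
    using x y F by (simp add: shift_class shift_act_closed)
  finally show "shift (X \<otimes> Y) F = shift X (shift Y F)" .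
qed

lemmas shift_closed = shift_ops(1)[OF _ M.zero_closed pres.zero_closed]
  and shift_add = shift_ops(2)[OF _ _ pres.zero_closed]
  and shift_mult = shift_ops(3)[OF _ _ pres.zero_closed]
  and shift_smult = shift_ops(4)[OF _ M.zero_closed]

lemma shift_zero: "(\<And>n. F n \<in> carrier T) \<Longrightarrow> shift \<zero> F n = \<zero>"
  using shift_class[of AZero F] by (simp add: T_presented pres.zero_PA alg_exprs.zero)

lemma shift_homog:
  assumes "homog d X" "\<And>n. F n \<in> carrier T"
  shows "shift X F n = X \<otimes> F (n - d)"
  using assms
proof (induction arbitrary: F n rule: homog_induct)
  case (zero d) then show ?case by (simp add: shift_zero)
next
  case (gen g)
  then show ?case
    using shift_class[OF alg_exprs.gen[of g], of F] by (simp add: \<gamma>_class[symmetric])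
next
  case (add d x y)
  then show ?case by (simp add: shift_add homog_closed mult_l_distr)
next
  case (smult d k x)
  then show ?case by (simp add: shift_smult homog_closed smult_mult_left)
next
  case (mult c d x y)
  have "shift y F = (\<lambda>n. y \<otimes> F (n - d))" using mult by blast
  then have "shift (x \<otimes> y) F n = x \<otimes> (y \<otimes> F (n - c - d))"
    using mult by (simp add: shift_mult homog_closed)
  then show ?case using mult.hyps mult.prems by (simp add: mult_assoc homog_closed diff_diff_eq)
qed

lemma shift_finsum:
  assumes "finite D" "x \<in> D \<rightarrow> carrier T" "\<And>n. F n \<in> carrier T"
  shows "shift (\<Oplus>i\<in>D. x i) F n = (\<Oplus>i\<in>D. shift (x i) F n)"
  using assms
proof (induction rule: finite_induct)
  case empty then show ?case by (simp add: shift_zero)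
next
  case (insert i D)
  then show ?case by (simp add: M.finsum_insert Pi_def shift_add shift_closed M.finsum_closed)
qed

text \<open>
  Applied to the sequence with a local unit \<open>u\<close> at \<open>0\<close> and zeros elsewhere, a sum of homogeneous
  elements \<open>x\<^sub>n\<close> of degree \<open>n\<close> returns \<open>x\<^sub>m u\<close> at place \<open>m\<close>.
\<close>

theorem homog_sum_zero:
  assumes "finite D" and homog: "\<And>n. n \<in> D \<Longrightarrow> homog n (x n)"
    and sum: "(\<Oplus>n\<in>D. x n) = \<zero>" and m: "m \<in> D"
  shows "x m = \<zero>"
proof -
  have closed: "x n \<in> carrier T" if "n \<in> D" for n using homog_closed homog that by blast
  obtain V where V: "V \<subseteq> verts E" "x m \<otimes> vsum V = x m"
    using local_unit[OF closed[OF m]] by metis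
  define F where "F i = (if i = 0 then vsum V else \<zero>)" for i :: int
  have F: "F i \<in> carrier T" for i using V by (simp add: F_def vsum_closed)
  have "\<zero> = shift (\<Oplus>n\<in>D. x n) F m" using F by (simp add: sum shift_zero)
  also have "\<dots> = (\<Oplus>n\<in>D. shift (x n) F m)"
    using assms(1) closed F by (simp add: shift_finsum)
  also have "\<dots> = x m"
    by (rule finsum_only[OF assms(1) m closed[OF m]])
       (use m V closed in \<open>simp_all add: shift_homog[OF homog F] F_def\<close>)
  finally show ?thesis by simp
qed

definition graded_sum :: "('k, ('v, 'e) lpa_gen) alg_expr set \<Rightarrow> bool" where
  "graded_sum x \<longleftrightarrow>
    (\<exists>D c. finite D \<and> (\<forall>n\<in>D. homog n (c n)) \<and> x = (\<Oplus>n\<in>D. c n))"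

lemma graded_sumI:
  assumes "finite D" "\<And>n. n \<in> D \<Longrightarrow> homog n (c n)" "x = (\<Oplus>n\<in>D. c n)"
  shows "graded_sum x"
  using assms unfolding graded_sum_def by blast

lemma graded_sum_homog:
  assumes "homog n x" shows "graded_sum x"
  by (rule graded_sumI[of "{n}" "\<lambda>_. x"]) (use assms in \<open>simp_all add: M.finsum_insert homog_closed\<close>)

lemma graded_sum_add:
  assumes "graded_sum x" "graded_sum y" shows "graded_sum (x \<oplus> y)"
proof -
  obtain D c where D: "finite D" "\<forall>n\<in>D. homog n (c n)" "x = (\<Oplus>n\<in>D. c n)"
    using assms unfolding graded_sum_def by metis
  obtain D' c' where D': "finite D'" "\<forall>n\<in>D'. homog n (c' n)" "y = (\<Oplus>n\<in>D'. c' n)"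
    using assms unfolding graded_sum_def by metis
  define a where "a n = (if n \<in> D then c n else \<zero>)" for n
  define b where "b n = (if n \<in> D' then c' n else \<zero>)" for n
  have ab: "homog n (a n)" "homog n (b n)" for n
    using D D' by (auto simp: a_def b_def homog_intros)
  then have closed: "a n \<in> carrier T" "b n \<in> carrier T" for n using homog_closed by blast+
  have "(\<Oplus>n\<in>D \<union> D'. a n) = (\<Oplus>n\<in>D. a n)"
    by (rule finsum_extend) (use D D' closed in \<open>(blast | simp add: a_def)+\<close>)
  also have "\<dots> = x"
    unfolding D(3) by (rule M.finsum_cong') (use homog_family_closed[OF D(2)] in \<open>simp_all add: a_def\<close>)
  finally have x: "(\<Oplus>n\<in>D \<union> D'. a n) = x" .
  have "(\<Oplus>n\<in>D \<union> D'. b n) = (\<Oplus>n\<in>D'. b n)"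
    by (rule finsum_extend) (use D D' closed in \<open>(blast | simp add: b_def)+\<close>)
  also have "\<dots> = y"
    unfolding D'(3) by (rule M.finsum_cong') (use homog_family_closed[OF D'(2)] in \<open>simp_all add: b_def\<close>)
  finally have y: "(\<Oplus>n\<in>D \<union> D'. b n) = y" .
  have "(\<Oplus>n\<in>D \<union> D'. a n \<oplus> b n) = x \<oplus> y"
    using closed by (subst M.finsum_addf) (simp_all add: x y)
  then show ?thesis
    using D D' ab by (intro graded_sumI[of "D \<union> D'" "\<lambda>n. a n \<oplus> b n"]) (auto intro: homog_intros)
qed

lemma graded_sum_finsum:
  assumes "finite D" "\<And>i. i \<in> D \<Longrightarrow> graded_sum (f i)" "\<And>i. i \<in> D \<Longrightarrow> f i \<in> carrier T"
  shows "graded_sum (\<Oplus>i\<in>D. f i)"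
  using assms
proof (induction rule: finite_induct)
  case empty
  show ?case using graded_sum_homog homog_intros(1) by simp
next
  case (insert i D)
  then show ?case by (simp add: M.finsum_insert Pi_def graded_sum_add)
qed

text \<open>
  Each \<open>x c\<^sub>n\<close> is homogeneous; summing them one at a time with \<open>graded_sum_add\<close> avoids reindexing
  the sum by the shifted degrees.
\<close>

lemma graded_sum_homog_mult:
  assumes x: "homog m x" and "graded_sum y" shows "graded_sum (x \<otimes> y)"
proof -
  obtain D c where D: "finite D" "\<forall>n\<in>D. homog n (c n)" "y = (\<Oplus>n\<in>D. c n)"
    using assms unfolding graded_sum_def by metis
  have xT: "x \<in> carrier T" using x by (rule homog_closed)
  have closed: "c n \<in> carrier T" if "n \<in> D" for n using D that homog_closed by blast
  have "x \<otimes> y = (\<Oplus>n\<in>D. x \<otimes> c n)"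
    unfolding D(3) using D(1) xT closed by (intro finsum_mult_right) auto
  moreover have "graded_sum (\<Oplus>n\<in>D. x \<otimes> c n)"
    using D(1)
  proof (rule graded_sum_finsum)
    fix n assume "n \<in> D"
    then show "x \<otimes> c n \<in> carrier T" "graded_sum (x \<otimes> c n)"
      using xT closed D(2) graded_sum_homog[OF homog_intros(5)[OF x]] by auto
  qed
  ultimately show ?thesis by simp
qed

theorem homog_decomposition:
  assumes "x \<in> carrier T"
  shows "graded_sum x"
  using assms
proof (induction rule: lpa_induct)
  case zero show ?case using homog_intros(1) by (rule graded_sum_homog)
next
  case (gen g) then show ?case by (rule graded_sum_homog[OF homog_intros(2)])
next
  case (add x y) then show ?case by (simp add: graded_sum_add)
next
  case (neg x)
  then obtain D c where D: "finite D" "\<forall>n\<in>D. homog n (c n)" "x = (\<Oplus>n\<in>D. c n)"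
    unfolding graded_sum_def by metis
  have "\<ominus> x = (\<Oplus>n\<in>D. (\<ominus>\<^bsub>K\<^esub> \<one>\<^bsub>K\<^esub>) \<odot> c n)"
    using D neg.hyps homog_family_closed[OF D(2)] by (simp add: minus_as_smult finsum_smult_ldistr)
  then show ?case using D by (intro graded_sumI[of D]) (auto intro: homog_intros)
next
  case (mult x y)
  then obtain D c where D: "finite D" "\<forall>n\<in>D. homog n (c n)" "x = (\<Oplus>n\<in>D. c n)"
    unfolding graded_sum_def by metis
  then have closed: "c \<in> D \<rightarrow> carrier T" using homog_closed by blast
  have "x \<otimes> y = (\<Oplus>n\<in>D. c n \<otimes> y)"
    unfolding D(3) using D(1) mult.hyps(2) closed by (rule finsum_mult_left)
  moreover have "graded_sum (\<Oplus>n\<in>D. c n \<otimes> y)"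
    using D mult closed by (intro graded_sum_finsum) (auto intro: graded_sum_homog_mult)
  ultimately show ?case by simp
next
  case (smult k x)
  then obtain D c where D: "finite D" "\<forall>n\<in>D. homog n (c n)" "x = (\<Oplus>n\<in>D. c n)"
    unfolding graded_sum_def by metis
  have "k \<odot> x = (\<Oplus>n\<in>D. k \<odot> c n)"
    using D smult.hyps homog_family_closed[OF D(2)] by (simp add: finsum_smult_ldistr)
  then show ?case using D smult.hyps by (intro graded_sumI[of D]) (auto intro: homog_intros)
qed

text \<open>
  Both \<open>y\<close> and the components supplied by the definition of a graded ideal decompose the same
  element, so their differences are homogeneous elements with sum zero.
\<close>

lemma graded_ideal_components:
  assumes A: "graded_ideal K E A" and D: "finite D" "\<And>n. n \<in> D \<Longrightarrow> homog n (y n)"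
    and sum: "(\<Oplus>n\<in>D. y n) \<in> A" and m: "m \<in> D"
  shows "y m \<in> A"
proof -
  let ?y = "\<Oplus>n\<in>D. y n"
  have "\<forall>a\<in>A. \<exists>!c. (\<forall>n. c n \<in> A \<and> homog n (c n)) \<and> finite {n. c n \<noteq> \<zero>} \<and>
      a = (\<Oplus>n\<in>{n. c n \<noteq> \<zero>}. c n)"
    using A unfolding graded_ideal_def T_eq[symmetric] by (rule conjunct2)
  then have "\<exists>c. (\<forall>n. c n \<in> A \<and> homog n (c n)) \<and> finite {n. c n \<noteq> \<zero>} \<and>
      ?y = (\<Oplus>n\<in>{n. c n \<noteq> \<zero>}. c n)"
    using sum by (intro ex1_implies_ex) (rule bspec)
  then obtain c where "\<forall>n. c n \<in> A \<and> homog n (c n)" and fin: "finite {n. c n \<noteq> \<zero>}"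
      and y: "?y = (\<Oplus>n\<in>{n. c n \<noteq> \<zero>}. c n)"
    by (elim exE conjE)
  then have c: "c n \<in> A" "homog n (c n)" for n by simp_all
  define C where "C = {n. c n \<noteq> \<zero>}"
  define a where "a n = (if n \<in> D then y n else \<zero>)" for n
  have a: "homog n (a n)" for n using D by (simp add: a_def homog_intros)
  have closed: "a n \<in> carrier T" "c n \<in> carrier T" for n
    using a c(2) homog_closed by blast+
  have sum_c: "(\<Oplus>n\<in>D \<union> C. c n) = (\<Oplus>n\<in>C. c n)"
    by (rule finsum_extend) (use D fin closed in \<open>(blast | simp add: C_def)+\<close>)
  have "(\<Oplus>n\<in>D \<union> C. a n) = (\<Oplus>n\<in>D. a n)"
    by (rule finsum_extend) (use D fin closed in \<open>(blast | simp add: a_def C_def)+\<close>)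
  also have "\<dots> = (\<Oplus>n\<in>D. y n)"
    by (rule M.finsum_cong') (use homog_family_closed[of D "\<lambda>n. n" y] D(2) in \<open>simp_all add: a_def\<close>)
  finally have sum_a: "(\<Oplus>n\<in>D \<union> C. a n) = (\<Oplus>n\<in>C. c n)" by (simp add: y C_def)
  have "(\<Oplus>n\<in>D \<union> C. a n \<oplus> (\<ominus>\<^bsub>K\<^esub> \<one>\<^bsub>K\<^esub>) \<odot> c n) =
      (\<Oplus>n\<in>D \<union> C. a n) \<oplus> (\<ominus>\<^bsub>K\<^esub> \<one>\<^bsub>K\<^esub>) \<odot> (\<Oplus>n\<in>D \<union> C. c n)"
    using closed D fin by (subst M.finsum_addf) (simp_all add: finsum_smult_ldistr C_def)
  also have "\<dots> = \<zero>"
    unfolding sum_a sum_c using closed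
    by (simp add: minus_as_smult[symmetric] M.finsum_closed M.r_neg)
  finally have "(\<Oplus>n\<in>D \<union> C. a n \<oplus> (\<ominus>\<^bsub>K\<^esub> \<one>\<^bsub>K\<^esub>) \<odot> c n) = \<zero>" .
  then have "a m \<oplus> (\<ominus>\<^bsub>K\<^esub> \<one>\<^bsub>K\<^esub>) \<odot> c m = \<zero>"
    using a c m D fin
    by (intro homog_sum_zero[of "D \<union> C" "\<lambda>n. a n \<oplus> (\<ominus>\<^bsub>K\<^esub> \<one>\<^bsub>K\<^esub>) \<odot> c n" m])
       (simp_all add: homog_intros C_def)
  then have "a m \<oplus> \<ominus> c m = \<zero>"
    using closed by (simp add: minus_as_smult)
  then have "a m = c m"
    using closed[of m] M.minus_equality[of "a m" "\<ominus> c m"] by simp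
  then show ?thesis using c(1)[of m] m by (simp add: a_def)
qed

end

section \<open>Graded uniqueness\<close>

context leavitt_path_algebra
begin

text \<open>
  The span of the paths of length \<open>m\<close>. Paths grow on the left, so that a ghost edge multiplied from
  the left removes the last rule applied.
\<close>

inductive path_comb :: "nat \<Rightarrow> ('k, ('v, 'e) lpa_gen) alg_expr set \<Rightarrow> bool" where
  zero: "path_comb m \<zero>"
| vertex: "\<lbrakk>k \<in> carrier K; v \<in> verts E\<rbrakk> \<Longrightarrow> path_comb 0 (k \<odot> vx v)"
| edge: "\<lbrakk>e \<in> arcs E; path_comb m x\<rbrakk> \<Longrightarrow> path_comb (Suc m) (ed e \<otimes> x)"
| add: "\<lbrakk>path_comb m x; path_comb m y\<rbrakk> \<Longrightarrow> path_comb m (x \<oplus> y)"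

lemma path_comb_closed: "path_comb m x \<Longrightarrow> x \<in> carrier T"
  by (induction rule: path_comb.induct) auto

lemma path_comb_smult:
  assumes "path_comb m x" "k \<in> carrier K" shows "path_comb m (k \<odot> x)"
  using assms
proof (induction rule: path_comb.induct)
  case (vertex l v)
  then show ?case by (simp add: smult_assoc1[symmetric] path_comb.vertex)
next
  case (edge e m x)
  then show ?case by (simp add: smult_mult_right[symmetric] path_comb_closed path_comb.edge)
qed (simp_all add: path_comb.intros smult_r_distr path_comb_closed)

lemma vertex_path_comb:
  assumes "path_comb m x" "v \<in> verts E" shows "path_comb m (vx v \<otimes> x)"
  using assms
proof (induction rule: path_comb.induct)
  case (vertex l w)
  then show ?case by (simp add: smult_mult_right vertex_mult path_comb.intros)
next
  case (edge e m x)
  then show ?case by (simp add: gen_mult_assoc path_comb_closed path_comb.intros)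
qed (simp_all add: path_comb.intros mult_r_distr path_comb_closed)

lemma path_comb_vertex:
  assumes "path_comb m x" "v \<in> verts E" shows "path_comb m (x \<otimes> vx v)"
  using assms
proof (induction rule: path_comb.induct)
  case (vertex l w)
  then show ?case by (simp add: smult_mult_left vertex_mult path_comb.intros)
next
  case (edge e m x)
  then show ?case by (simp add: mult_assoc path_comb_closed path_comb.intros)
qed (simp_all add: path_comb.intros mult_l_distr path_comb_closed)

lemma path_comb_edge:
  assumes "path_comb m x" "f \<in> arcs E" shows "path_comb (Suc m) (x \<otimes> ed f)"
  using assms
proof (induction rule: path_comb.induct)
  case (vertex k w)
  have "k \<odot> ed f = ed f \<otimes> (k \<odot> vx (head E f))"
    using vertex by (simp add: smult_mult_right edge_head)
  then have "path_comb (Suc 0) (k \<odot> ed f)"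
    using vertex by (simp add: path_comb.intros)
  then show ?case using vertex by (simp add: smult_mult_left vertex_edge path_comb.zero)
next
  case (edge e m x)
  then show ?case by (simp add: mult_assoc path_comb_closed path_comb.intros)
qed (simp_all add: path_comb.intros mult_l_distr path_comb_closed)

lemma ghost_path_comb:
  assumes "path_comb (Suc m) x" "f \<in> arcs E" shows "path_comb m (gh f \<otimes> x)"
  using assms
proof (induction "Suc m" x rule: path_comb.induct)
  case (edge e x)
  then show ?case by (simp add: gen_mult_assoc path_comb_closed path_comb.zero vertex_path_comb)
qed (simp_all add: path_comb.intros mult_r_distr path_comb_closed)

lemma path_comb_0_vertex:
  assumes "path_comb 0 x" "v \<in> verts E"
  shows "\<exists>k\<in>carrier K. vx v \<otimes> x = k \<odot> vx v \<and> x \<otimes> vx v = k \<odot> vx v"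
  using assms
proof (induction "0::nat" x rule: path_comb.induct)
    case zero
    then show ?case by (intro bexI[of _ "\<zero>\<^bsub>K\<^esub>"]) simp_all
  next
    case (vertex l w)
    then show ?case
      by (intro bexI[of _ "if v = w then l else \<zero>\<^bsub>K\<^esub>"])
         (simp_all add: smult_mult_left smult_mult_right vertex_mult)
  next
    case (add x y)
    then obtain k l where "k \<in> carrier K" "vx v \<otimes> x = k \<odot> vx v" "x \<otimes> vx v = k \<odot> vx v"
      "l \<in> carrier K" "vx v \<otimes> y = l \<odot> vx v" "y \<otimes> vx v = l \<odot> vx v" by blast
    then show ?case
      using add
      by (intro bexI[of _ "k \<oplus>\<^bsub>K\<^esub> l"])
         (simp_all add: mult_l_distr mult_r_distr path_comb_closed smult_l_distr)
qed

text \<open>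
  Left multiplication by the idempotent \<open>\<Sum>\<^sub>D e e*\<close> fixes \<open>x\<close>. A combination \<open>x\<close> of paths of positive
  length is thereby recovered from the elements \<open>e* x\<close>, which are combinations of shorter paths.
\<close>

definition edge_expands :: "'e set \<Rightarrow> ('k, ('v, 'e) lpa_gen) alg_expr set \<Rightarrow> bool" where
  "edge_expands D x \<longleftrightarrow> finite D \<and> D \<subseteq> arcs E \<and> (\<Oplus>e\<in>D. ed e \<otimes> (gh e \<otimes> x)) = x"

lemma edge_expands_extend:
  assumes D: "edge_expands D x" and D': "finite D'" "D' \<subseteq> arcs E" "D \<subseteq> D'" and x: "x \<in> carrier T"
  shows "edge_expands D' x"
proof -
  have "gh f \<otimes> x = \<zero>" if "f \<in> D' - D" for f
  proof -
    have f: "f \<in> arcs E" using that D' by auto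
    have "gh f \<otimes> x = gh f \<otimes> (\<Oplus>e\<in>D. ed e \<otimes> (gh e \<otimes> x))"
      using D by (simp add: edge_expands_def)
    also have "\<dots> = (\<Oplus>e\<in>D. gh f \<otimes> (ed e \<otimes> (gh e \<otimes> x)))"
      using D f x by (intro finsum_mult_right) (simp_all add: edge_expands_def Pi_def subset_iff)
    also have "\<dots> = \<zero>"
    proof (rule finsum_all_zero)
      fix e assume "e \<in> D"
      then have "e \<in> arcs E" "f \<noteq> e" using D that by (auto simp: edge_expands_def)
      then show "gh f \<otimes> (ed e \<otimes> (gh e \<otimes> x)) = \<zero>" using f x by (simp add: gen_mult_assoc)
    qed
    finally show ?thesis .
  qed
  then have "(\<Oplus>e\<in>D'. ed e \<otimes> (gh e \<otimes> x)) = (\<Oplus>e\<in>D. ed e \<otimes> (gh e \<otimes> x))"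
    using D' x by (intro finsum_extend) (simp_all add: Pi_def subset_iff)
  then show ?thesis using D D' by (simp add: edge_expands_def)
qed

lemma edge_expands_add:
  assumes "edge_expands D x" "edge_expands D y" "x \<in> carrier T" "y \<in> carrier T"
  shows "edge_expands D (x \<oplus> y)"
proof -
  have D: "\<And>e. e \<in> D \<Longrightarrow> e \<in> arcs E" using assms by (auto simp: edge_expands_def)
  have "(\<Oplus>e\<in>D. ed e \<otimes> (gh e \<otimes> (x \<oplus> y))) =
      (\<Oplus>e\<in>D. ed e \<otimes> (gh e \<otimes> x) \<oplus> ed e \<otimes> (gh e \<otimes> y))"
    by (rule M.finsum_cong') (simp_all add: D assms Pi_def mult_r_distr)
  also have "\<dots> = (\<Oplus>e\<in>D. ed e \<otimes> (gh e \<otimes> x)) \<oplus> (\<Oplus>e\<in>D. ed e \<otimes> (gh e \<otimes> y))"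
    by (rule M.finsum_addf) (simp_all add: D assms Pi_def)
  finally show ?thesis using assms by (simp add: edge_expands_def)
qed

lemma path_comb_expansion:
  assumes "path_comb (Suc m) x"
  shows "\<exists>D. edge_expands D x"
  using assms
proof (induction "Suc m" x rule: path_comb.induct)
  case zero
  have "edge_expands {} \<zero>" by (simp add: edge_expands_def)
  then show ?case by blast
next
  case (edge e x)
  then have "edge_expands {e} (ed e \<otimes> x)"
    by (simp add: edge_expands_def M.finsum_insert path_comb_closed gen_mult_assoc)
  then show ?case by blast
next
  case (add x y)
  then obtain D D' where D: "edge_expands D x" "edge_expands D' y" by blast
  have xy: "x \<in> carrier T" "y \<in> carrier T" using add path_comb_closed by blast+
  have fin: "finite (D \<union> D')" "D \<union> D' \<subseteq> arcs E" using D by (auto simp: edge_expands_def)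
  have "edge_expands (D \<union> D') x" "edge_expands (D \<union> D') y"
    using edge_expands_extend[OF D(1) fin] edge_expands_extend[OF D(2) fin] xy by auto
  then show ?case using edge_expands_add xy by blast
qed

text \<open>
  The span of all \<open>\<alpha> \<beta>*\<close> with \<open>\<bar>\<alpha>\<bar> - \<bar>\<beta>\<bar> = n\<close> and \<open>\<bar>\<beta>\<bar> \<le> N\<close>. Ghost edges are appended on the right,
  where multiplication by an edge cancels them.
\<close>

inductive bounded_comb :: "int \<Rightarrow> nat \<Rightarrow> ('k, ('v, 'e) lpa_gen) alg_expr set \<Rightarrow> bool" where
  path: "path_comb m x \<Longrightarrow> bounded_comb (int m) N x"
| zero: "bounded_comb n N \<zero>"
| ghost: "\<lbrakk>e \<in> arcs E; bounded_comb (n + 1) N x\<rbrakk> \<Longrightarrow> bounded_comb n (Suc N) (x \<otimes> gh e)"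
| add: "\<lbrakk>bounded_comb n N x; bounded_comb n N y\<rbrakk> \<Longrightarrow> bounded_comb n N (x \<oplus> y)"

lemma bounded_comb_closed: "bounded_comb n N x \<Longrightarrow> x \<in> carrier T"
  by (induction rule: bounded_comb.induct) (auto simp: path_comb_closed)

lemma bounded_comb_mono:
  assumes "bounded_comb n N x" "N \<le> N'" shows "bounded_comb n N' x"
  using assms
proof (induction arbitrary: N' rule: bounded_comb.induct)
  case (ghost e n N x)
  then show ?case by (cases N') (auto intro: bounded_comb.ghost)
qed (auto intro: bounded_comb.intros)

lemma bounded_comb_smult:
  assumes "bounded_comb n N x" "k \<in> carrier K" shows "bounded_comb n N (k \<odot> x)"
  using assms
proof (induction rule: bounded_comb.induct)
  case (ghost e n N x)
  then show ?case
    by (simp add: smult_mult_left[symmetric] bounded_comb_closed bounded_comb.ghost)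
qed (simp_all add: bounded_comb.intros path_comb_smult smult_r_distr bounded_comb_closed)

lemma vertex_bounded_comb:
  assumes "bounded_comb n N x" "v \<in> verts E" shows "bounded_comb n N (vx v \<otimes> x)"
  using assms
proof (induction rule: bounded_comb.induct)
  case (ghost e n N x)
  then show ?case by (simp add: mult_assoc[symmetric] bounded_comb_closed bounded_comb.ghost)
qed (simp_all add: bounded_comb.intros vertex_path_comb mult_r_distr bounded_comb_closed)

lemma edge_bounded_comb:
  assumes "bounded_comb n N x" "f \<in> arcs E" shows "bounded_comb (n + 1) N (ed f \<otimes> x)"
  using assms
proof (induction rule: bounded_comb.induct)
  case (path m x N)
  then show ?case
    using bounded_comb.path[OF path_comb.edge[of f m x], of N] by (simp add: add.commute)
next
  case (ghost e n N x)
  then show ?case by (simp add: mult_assoc[symmetric] bounded_comb_closed bounded_comb.ghost)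
qed (simp_all add: bounded_comb.intros mult_r_distr bounded_comb_closed)

lemma ghost_bounded_comb:
  assumes "bounded_comb n N x" "f \<in> arcs E" shows "bounded_comb (n - 1) (Suc N) (gh f \<otimes> x)"
  using assms
proof (induction rule: bounded_comb.induct)
  case (path m x N)
  show ?case
  proof (cases m)
    case 0
    obtain k where k: "k \<in> carrier K" "vx (tail E f) \<otimes> x = k \<odot> vx (tail E f)"
      using path_comb_0_vertex[of x "tail E f"] path 0 by auto
    have "gh f \<otimes> x = gh f \<otimes> (vx (tail E f) \<otimes> x)"
      using path by (simp add: gen_mult_assoc path_comb_closed)
    also have "\<dots> = (k \<odot> vx (head E f)) \<otimes> gh f"
      using path k by (simp add: smult_mult_left smult_mult_right ghost_tail head_ghost)
    finally have "gh f \<otimes> x = (k \<odot> vx (head E f)) \<otimes> gh f" .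
    moreover have "bounded_comb (- 1 + 1) N (k \<odot> vx (head E f))"
      using bounded_comb.path[OF path_comb.vertex[OF k(1)], of "head E f" N] path by simp
    ultimately show ?thesis using bounded_comb.ghost[OF path(2)] 0 by simp
  next
    case (Suc l)
    then show ?thesis
      using path bounded_comb.path[OF ghost_path_comb[of l x f], of "Suc N"] by simp
  qed
next
  case (ghost e n N x)
  then have "bounded_comb (n - 1 + 1) (Suc N) (gh f \<otimes> x)" by simp
  then show ?case
    using ghost bounded_comb.ghost[OF ghost.hyps(1)]
    by (simp add: mult_assoc[symmetric] bounded_comb_closed)
qed (simp_all add: bounded_comb.intros mult_r_distr bounded_comb_closed)

lemma bounded_comb_vertex:
  assumes "bounded_comb n N x" "v \<in> verts E" shows "bounded_comb n N (x \<otimes> vx v)"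
  using assms
proof (induction rule: bounded_comb.induct)
  case (ghost e n N x)
  then show ?case
    by (simp add: mult_assoc ghost_vertex bounded_comb_closed bounded_comb.intros)
qed (simp_all add: bounded_comb.intros path_comb_vertex mult_l_distr bounded_comb_closed)

text \<open>
  The product \<open>\<beta>* f\<close> is zero or shorter than \<open>\<beta>*\<close>, unless \<open>\<beta>\<close> is a vertex. In that case the edge
  lengthens the path \<open>\<alpha>\<close> instead, which costs nothing; this is also why the truncated \<open>N - 1\<close> is
  right for \<open>N = 0\<close>.
\<close>

lemma bounded_comb_edge:
  assumes "bounded_comb n N x" "f \<in> arcs E" shows "bounded_comb (n + 1) (N - 1) (x \<otimes> ed f)"
  using assms
proof (induction rule: bounded_comb.induct)
  case (path m x N)
  then show ?case
    using bounded_comb.path[OF path_comb_edge[of m x f], of "N - 1"] by (simp add: add.commute)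
next
  case (ghost e n N x)
  then show ?case
    by (simp add: mult_assoc ghost_edge bounded_comb_closed bounded_comb_vertex bounded_comb.zero)
qed (simp_all add: bounded_comb.intros mult_l_distr bounded_comb_closed)

lemma homog_bounded_comb:
  assumes "homog n x" "bounded_comb m N y"
  shows "\<exists>N'. bounded_comb (n + m) N' (x \<otimes> y)"
  using assms
proof (induction arbitrary: m N y rule: homog_induct)
  case (zero n)
  then show ?case by (auto simp: bounded_comb_closed intro: bounded_comb.zero)
next
  case (gen g)
  from gen(1) consider v where "g = Vertex v" "v \<in> verts E" | e where "g = Edge e" "e \<in> arcs E"
    | e where "g = Ghost e" "e \<in> arcs E" by (auto simp: lpa_gens_def)
  then show ?case
  proof cases
    case 1
    then show ?thesis using vertex_bounded_comb[OF gen(2)] by auto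
  next
    case (2 e)
    then show ?thesis using edge_bounded_comb[OF gen(2)] by (auto simp: add.commute)
  next
    case (3 e)
    then show ?thesis using ghost_bounded_comb[OF gen(2)] by auto
  qed
next
  case (add n x x')
  obtain N1 where N1: "bounded_comb (n + m) N1 (x \<otimes> y)" using add by blast
  obtain N2 where N2: "bounded_comb (n + m) N2 (x' \<otimes> y)" using add by blast
  have "bounded_comb (n + m) (max N1 N2) (x \<otimes> y \<oplus> x' \<otimes> y)"
    using N1 N2 by (intro bounded_comb.add) (auto intro: bounded_comb_mono)
  then show ?case
    using add.hyps add.prems by (auto simp: mult_l_distr homog_closed bounded_comb_closed)
next
  case (smult n k x)
  then obtain N' where "bounded_comb (n + m) N' (x \<otimes> y)" by blast
  then have "bounded_comb (n + m) N' (k \<odot> (x \<otimes> y))" using smult.hyps by (simp add: bounded_comb_smult)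
  then show ?case
    using smult.hyps smult.prems by (auto simp: smult_mult_left homog_closed bounded_comb_closed)
next
  case (mult l n x x')
  then obtain N1 where "bounded_comb (n + m) N1 (x' \<otimes> y)" by blast
  then obtain N2 where "bounded_comb (l + (n + m)) N2 (x \<otimes> (x' \<otimes> y))" using mult by blast
  then show ?case
    using mult.hyps mult.prems by (auto simp: mult_assoc homog_closed bounded_comb_closed add.assoc)
qed

lemma bounded_comb_vsum:
  assumes "finite V" "V \<subseteq> verts E" shows "bounded_comb 0 0 (vsum V)"
  using assms
proof (induction rule: finite_induct)
  case empty then show ?case by (simp add: vsum_def bounded_comb.zero)
next
  case (insert v V)
  have "bounded_comb 0 0 (vx v)"
    using bounded_comb.path[OF path_comb.vertex[of "\<one>\<^bsub>K\<^esub>" v], of 0] insert by simp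
  moreover have "vsum (insert v V) = vx v \<oplus> vsum V"
    using insert by (simp add: vsum_def M.finsum_insert Pi_def subset_iff)
  ultimately show ?case using insert by (simp add: bounded_comb.add)
qed

text \<open>
  Left multiplication by a homogeneous element preserves the spans, up to a larger bound, and a
  local unit lies in one of them.
\<close>

theorem homog_imp_bounded_comb:
  assumes "homog n x" obtains N where "bounded_comb n N x"
proof -
  obtain V where V: "finite V" "V \<subseteq> verts E" "x \<otimes> vsum V = x"
    using local_unit[OF homog_closed[OF assms]] by metis
  then show ?thesis
    using homog_bounded_comb[OF assms bounded_comb_vsum] that by fastforce
qed

text \<open>Paths have no negative degree, so the part of degree \<open>n < 0\<close> is zero.\<close>

definition path_part :: "int \<Rightarrow> ('k, ('v, 'e) lpa_gen) alg_expr set \<Rightarrow> bool" where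
  "path_part n p \<longleftrightarrow> p = \<zero> \<or> (\<exists>m. n = int m \<and> path_comb m p)"

lemma path_part_add: "\<lbrakk>path_part n p; path_part n q\<rbrakk> \<Longrightarrow> path_part n (p \<oplus> q)"
  by (auto simp: path_part_def path_comb_closed intro: path_comb.add)

lemma path_part_closed: "path_part n p \<Longrightarrow> p \<in> carrier T"
  by (auto simp: path_part_def path_comb_closed)

lemma path_part_vertex: "\<lbrakk>path_part n p; v \<in> verts E\<rbrakk> \<Longrightarrow> path_part n (p \<otimes> vx v)"
  by (auto simp: path_part_def path_comb_vertex)

lemma bounded_comb_0:
  assumes "bounded_comb n 0 x" shows "path_part n x"
  using assms
proof (induction n "0::nat" x rule: bounded_comb.induct)
  case (add n x y)
  then show ?case by (simp add: path_part_add)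
qed (simp_all add: path_part_def)

text \<open>
  Right multiplication by the idempotent \<open>\<Sum>\<^sub>D e e*\<close> fixes \<open>x\<close>, as it does for every combination of
  products \<open>\<alpha> \<beta>*\<close> in which \<open>\<beta>\<close> begins with an edge of \<open>D\<close>.
\<close>

definition ghost_expands :: "'e set \<Rightarrow> ('k, ('v, 'e) lpa_gen) alg_expr set \<Rightarrow> bool" where
  "ghost_expands D x \<longleftrightarrow> finite D \<and> D \<subseteq> arcs E \<and> (\<Oplus>e\<in>D. x \<otimes> ed e \<otimes> gh e) = x"

lemma ghost_expands_edge:
  assumes D: "ghost_expands D x" and f: "f \<in> arcs E" "f \<notin> D" and x: "x \<in> carrier T"
  shows "x \<otimes> ed f = \<zero>"
proof -
  have "x \<otimes> ed f = (\<Oplus>e\<in>D. x \<otimes> ed e \<otimes> gh e) \<otimes> ed f"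
    using D by (simp add: ghost_expands_def)
  also have "\<dots> = (\<Oplus>e\<in>D. x \<otimes> ed e \<otimes> gh e \<otimes> ed f)"
    using D f x by (intro finsum_mult_left) (simp_all add: ghost_expands_def Pi_def subset_iff)
  also have "\<dots> = \<zero>"
  proof (rule finsum_all_zero)
    fix e assume "e \<in> D"
    then have "e \<in> arcs E" "f \<noteq> e" using D f by (auto simp: ghost_expands_def)
    then show "x \<otimes> ed e \<otimes> gh e \<otimes> ed f = \<zero>" using f x by (simp add: mult_assoc ghost_edge)
  qed
  finally show ?thesis .
qed

lemma ghost_expands_extend:
  assumes D: "ghost_expands D x" and D': "finite D'" "D' \<subseteq> arcs E" "D \<subseteq> D'" and x: "x \<in> carrier T"
  shows "ghost_expands D' x"
proof -
  have "x \<otimes> ed f = \<zero>" if "f \<in> D' - D" for f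
    using ghost_expands_edge[OF D _ _ x, of f] that D' by auto
  then have "(\<Oplus>e\<in>D'. x \<otimes> ed e \<otimes> gh e) = (\<Oplus>e\<in>D. x \<otimes> ed e \<otimes> gh e)"
    using D' x by (intro finsum_extend) (simp_all add: Pi_def subset_iff)
  then show ?thesis using D D' by (simp add: ghost_expands_def)
qed

lemma ghost_expands_add:
  assumes "ghost_expands D x" "ghost_expands D y" "x \<in> carrier T" "y \<in> carrier T"
  shows "ghost_expands D (x \<oplus> y)"
proof -
  have D: "\<And>e. e \<in> D \<Longrightarrow> e \<in> arcs E" using assms by (auto simp: ghost_expands_def)
  have "(\<Oplus>e\<in>D. (x \<oplus> y) \<otimes> ed e \<otimes> gh e) =
      (\<Oplus>e\<in>D. x \<otimes> ed e \<otimes> gh e \<oplus> y \<otimes> ed e \<otimes> gh e)"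
    by (rule M.finsum_cong') (simp_all add: D assms Pi_def mult_l_distr)
  also have "\<dots> = (\<Oplus>e\<in>D. x \<otimes> ed e \<otimes> gh e) \<oplus> (\<Oplus>e\<in>D. y \<otimes> ed e \<otimes> gh e)"
    by (rule M.finsum_addf) (simp_all add: D assms Pi_def)
  finally show ?thesis using assms by (simp add: ghost_expands_def)
qed

text \<open>
  The terms \<open>\<alpha> \<beta>*\<close> with \<open>\<beta>\<close> a vertex make up \<open>p\<close>; the others, with \<open>D\<close> the set of first edges of the
  paths \<open>\<beta>\<close>, make up \<open>z\<close>.
\<close>

lemma bounded_comb_decomposition:
  assumes "bounded_comb n N x"
  shows "\<exists>p z D. path_part n p \<and> z \<in> carrier T \<and> x = p \<oplus> z \<and> ghost_expands D z"
  using assms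
proof (induction rule: bounded_comb.induct)
  case (path m x N)
  then show ?case
    by (intro exI[of _ x] exI[of _ \<zero>] exI[of _ "{}"])
       (auto simp: path_part_def path_comb_closed ghost_expands_def)
next
  case (zero n N)
  show ?case
    by (intro exI[of _ \<zero>] exI[of _ "{}"]) (simp add: path_part_def ghost_expands_def)
next
  case (ghost e n N x)
  then have "x \<otimes> gh e \<otimes> ed e \<otimes> gh e = x \<otimes> gh e" "x \<in> carrier T"
    by (simp_all add: mult_assoc bounded_comb_closed gen_mult_assoc head_ghost)
  then show ?case
    using ghost
    by (intro exI[of _ \<zero>] exI[of _ "x \<otimes> gh e"] exI[of _ "{e}"])
       (simp add: path_part_def M.finsum_insert ghost_expands_def)
next
  case (add n N x y)
  obtain p z D where 1: "path_part n p" "z \<in> carrier T" "x = p \<oplus> z" "ghost_expands D z"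
    using add.IH(1) by blast
  obtain q w D' where 2: "path_part n q" "w \<in> carrier T" "y = q \<oplus> w" "ghost_expands D' w"
    using add.IH(2) by blast
  have fin: "finite (D \<union> D')" "D \<union> D' \<subseteq> arcs E"
    using 1(4) 2(4) by (auto simp: ghost_expands_def)
  have "ghost_expands (D \<union> D') z" "ghost_expands (D \<union> D') w"
    using ghost_expands_extend[OF 1(4) fin] ghost_expands_extend[OF 2(4) fin] 1(2) 2(2) by auto
  then have "ghost_expands (D \<union> D') (z \<oplus> w)" using ghost_expands_add 1(2) 2(2) by blast
  moreover have "x \<oplus> y = p \<oplus> q \<oplus> (z \<oplus> w)"
    using 1 2 path_part_closed by (simp add: M.a_ac)
  ultimately show ?case
    using 1(1,2) 2(1,2) path_part_add
    by (intro exI[of _ "p \<oplus> q"] exI[of _ "z \<oplus> w"] exI[of _ "D \<union> D'"]) simp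
qed

context
  fixes J
  assumes J: "two_sided_ideal J T"
    and faithful: "\<And>k v. \<lbrakk>k \<in> carrier K; v \<in> verts E; k \<odot> vx v \<in> J\<rbrakk> \<Longrightarrow> k = \<zero>\<^bsub>K\<^esub>"
begin

lemma J_mult: "\<lbrakk>a \<in> J; x \<in> carrier T\<rbrakk> \<Longrightarrow> x \<otimes> a \<in> J" "\<lbrakk>a \<in> J; x \<in> carrier T\<rbrakk> \<Longrightarrow> a \<otimes> x \<in> J"
  using J by (auto simp: two_sided_ideal_def)

lemma J_zero: "\<zero> \<in> J"
  using J by (auto simp: two_sided_ideal_def additive_subgroup.zero_closed)

text \<open>
  Ghost edges strip a combination of paths down to a combination of vertices, whose coefficients
  are then isolated by multiplication with single vertices.
\<close>

lemma path_comb_in_J_zero: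
  assumes "path_comb m x" "x \<in> J" shows "x = \<zero>"
  using assms
proof (induction m arbitrary: x)
  case 0
  have x: "x \<in> carrier T" using 0 path_comb_closed by blast
  obtain V where V: "finite V" "V \<subseteq> verts E" "vsum V \<otimes> x = x" using local_unit[OF x] by metis
  have "vx v \<otimes> x = \<zero>" if v: "v \<in> verts E" for v
  proof -
    obtain k where k: "k \<in> carrier K" "vx v \<otimes> x = k \<odot> vx v"
      using path_comb_0_vertex[OF 0(1) v] by blast
    have "k \<odot> vx v \<in> J" using J_mult(1)[OF 0(2), of "vx v"] v k by simp
    then show ?thesis using faithful[OF k(1) v] k v by simp
  qed
  then have "(\<Oplus>v\<in>V. vx v \<otimes> x) = \<zero>" using V by (intro finsum_all_zero) auto
  moreover have "vsum V \<otimes> x = (\<Oplus>v\<in>V. vx v \<otimes> x)"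
    unfolding vsum_def using V x by (intro finsum_mult_left) auto
  ultimately show ?case using V by simp
next
  case (Suc m)
  obtain D where D: "D \<subseteq> arcs E" "(\<Oplus>e\<in>D. ed e \<otimes> (gh e \<otimes> x)) = x"
    using path_comb_expansion[OF Suc.prems(1)] by (auto simp: edge_expands_def)
  have "(\<Oplus>e\<in>D. ed e \<otimes> (gh e \<otimes> x)) = \<zero>"
  proof (rule finsum_all_zero)
    fix e assume "e \<in> D"
    then have e: "e \<in> arcs E" using D by auto
    then have "gh e \<otimes> x = \<zero>"
      using Suc ghost_path_comb J_mult by simp
    then show "ed e \<otimes> (gh e \<otimes> x) = \<zero>" using e by simp
  qed
  then show ?case using D(2) by simp
qed

text \<open>
  The zero ideal is contained in \<open>J\<close>, so scalars act faithfully on vertices, and hence on edges.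
  Stripping edges from the left reduces the claim to that case.
\<close>

lemma path_comb_edge_cancel:
  assumes "path_comb m x" "e \<in> arcs E" "x \<otimes> ed e = \<zero>"
  shows "x \<otimes> vx (tail E e) = \<zero>"
  using assms
proof (induction m arbitrary: x)
  case 0
  have x: "x \<in> carrier T" using 0 path_comb_closed by blast
  obtain k where k: "k \<in> carrier K" "x \<otimes> vx (tail E e) = k \<odot> vx (tail E e)"
    using path_comb_0_vertex[OF 0(1) ends_in_verts(1)[OF 0(2)]] by blast
  have "k \<odot> ed e = x \<otimes> vx (tail E e) \<otimes> ed e"
    using k 0 by (simp add: smult_mult_left tail_edge)
  also have "\<dots> = \<zero>" using 0 x by (simp add: mult_assoc tail_edge)
  finally have "gh e \<otimes> (k \<odot> ed e) = \<zero>" using 0 by simp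
  then have "k \<odot> vx (head E e) = \<zero>" using 0 k by (simp add: smult_mult_right ghost_edge)
  then have "k = \<zero>\<^bsub>K\<^esub>" using faithful[OF k(1), of "head E e"] 0 J_zero by simp
  then show ?case using k 0 by simp
next
  case (Suc m)
  have x: "x \<in> carrier T" using Suc path_comb_closed by blast
  obtain D where D: "finite D" "D \<subseteq> arcs E" "(\<Oplus>e\<in>D. ed e \<otimes> (gh e \<otimes> x)) = x"
    using path_comb_expansion[OF Suc.prems(1)] by (auto simp: edge_expands_def)
  have "x \<otimes> vx (tail E e) = (\<Oplus>e\<in>D. ed e \<otimes> (gh e \<otimes> x)) \<otimes> vx (tail E e)"
    using D(3) by simp
  also have "\<dots> = (\<Oplus>f\<in>D. ed f \<otimes> (gh f \<otimes> x) \<otimes> vx (tail E e))"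
    using D x Suc.prems(2) by (intro finsum_mult_left) auto
  also have "\<dots> = \<zero>"
  proof (rule finsum_all_zero)
    fix f assume "f \<in> D"
    then have f: "f \<in> arcs E" using D by auto
    have "gh f \<otimes> x \<otimes> ed e = \<zero>" using f x Suc.prems by (simp add: mult_assoc)
    then have "gh f \<otimes> x \<otimes> vx (tail E e) = \<zero>"
      using Suc f ghost_path_comb by blast
    then show "ed f \<otimes> (gh f \<otimes> x) \<otimes> vx (tail E e) = \<zero>"
      using f x Suc.prems(2) by (simp add: mult_assoc)
  qed
  finally show ?case .
qed

text \<open>
  The heart of graded uniqueness. In the step from \<open>N\<close> to \<open>Suc N\<close> the induction hypothesis applies
  to all \<open>x e\<close>, and it remains to show \<open>x v = 0\<close> for each vertex \<open>v\<close>, by cases on how many edges \<open>v\<close>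
  emits.
\<close>

lemma bounded_comb_in_J_zero:
  assumes "bounded_comb n N x" "x \<in> J" shows "x = \<zero>"
  using assms
proof (induction N arbitrary: n x)
  case 0
  then show ?case using bounded_comb_0[OF 0(1)] path_comb_in_J_zero by (auto simp: path_part_def)
next
  case (Suc N)
  have x: "x \<in> carrier T" using Suc bounded_comb_closed by blast
  have x_edge: "x \<otimes> ed e = \<zero>" if "e \<in> arcs E" for e
    using Suc.IH[of "n + 1" "x \<otimes> ed e"] bounded_comb_edge[OF Suc.prems(1) that]
      J_mult(2)[OF Suc.prems(2)] that by simp
  obtain p z D where p: "path_part n p" and z: "z \<in> carrier T" and x_eq: "x = p \<oplus> z"
      and expands: "ghost_expands D z"
    using bounded_comb_decomposition[OF Suc.prems(1)] by blast
  then have D: "finite D" "D \<subseteq> arcs E" and z_eq: "(\<Oplus>e\<in>D. z \<otimes> ed e \<otimes> gh e) = z"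
    by (auto simp: ghost_expands_def)
  have pT: "p \<in> carrier T" using p by (rule path_part_closed)
  have z_edge: "z \<otimes> ed e = \<ominus> (p \<otimes> ed e)" if "e \<in> arcs E" for e
  proof -
    have "z \<otimes> ed e \<oplus> p \<otimes> ed e = \<zero>"
      using x_edge[OF that] that pT z by (simp add: x_eq mult_l_distr M.a_comm)
    then show ?thesis using M.minus_equality[of "z \<otimes> ed e" "p \<otimes> ed e"] that pT z by simp
  qed
  have p_edge: "p \<otimes> ed e = \<zero>" if e: "e \<in> arcs E" "e \<notin> D" for e
    using x_edge[OF e(1)] ghost_expands_edge[OF expands e z] pT z e(1)
    by (simp add: x_eq mult_l_distr)
  have x_vertex: "x \<otimes> vx v = \<zero>" if v: "v \<in> verts E" for v
  proof -
    define q where "q = p \<otimes> vx v"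
    have q: "path_part n q" unfolding q_def using p v by (rule path_part_vertex)
    then have qT: "q \<in> carrier T" by (rule path_part_closed)
    define Dv where "Dv = {e \<in> D. tail E e = v}"
    have Dv: "finite Dv" "Dv \<subseteq> arcs E" using D by (auto simp: Dv_def)
    have q_edge: "q \<otimes> ed e = p \<otimes> ed e" if "e \<in> arcs E" "tail E e = v" for e
      using that pT v by (simp add: q_def mult_assoc vertex_edge)
    have "z \<otimes> vx v = (\<Oplus>e\<in>D. z \<otimes> ed e \<otimes> gh e) \<otimes> vx v" using z_eq by simp
    also have "\<dots> = (\<Oplus>e\<in>D. z \<otimes> ed e \<otimes> gh e \<otimes> vx v)"
      using D z v by (intro finsum_mult_left) auto
    also have "\<dots> = (\<Oplus>e\<in>Dv. z \<otimes> ed e \<otimes> gh e \<otimes> vx v)"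
      using D z v by (intro finsum_extend) (auto simp: Dv_def mult_assoc ghost_vertex subset_iff)
    also have "\<dots> = (\<Oplus>e\<in>Dv. (\<ominus>\<^bsub>K\<^esub> \<one>\<^bsub>K\<^esub>) \<odot> (q \<otimes> ed e \<otimes> gh e))"
    proof (rule M.finsum_cong')
      show "(\<lambda>e. (\<ominus>\<^bsub>K\<^esub> \<one>\<^bsub>K\<^esub>) \<odot> (q \<otimes> ed e \<otimes> gh e)) \<in> Dv \<rightarrow> carrier T"
        using Dv qT by auto
      fix e assume "e \<in> Dv"
      then have e: "e \<in> arcs E" "tail E e = v" using Dv by (auto simp: Dv_def)
      have "z \<otimes> ed e \<otimes> gh e \<otimes> vx v = z \<otimes> ed e \<otimes> gh e"
        using e z v by (simp add: mult_assoc ghost_vertex)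
      also have "\<dots> = (\<ominus> (q \<otimes> ed e)) \<otimes> gh e"
        using e by (simp add: z_edge q_edge)
      also have "\<dots> = (\<ominus>\<^bsub>K\<^esub> \<one>\<^bsub>K\<^esub>) \<odot> (q \<otimes> ed e \<otimes> gh e)"
        using e qT by (simp add: mult_l_minus minus_as_smult[symmetric])
      finally show "z \<otimes> ed e \<otimes> gh e \<otimes> vx v = (\<ominus>\<^bsub>K\<^esub> \<one>\<^bsub>K\<^esub>) \<odot> (q \<otimes> ed e \<otimes> gh e)" .
    qed simp
    also have "\<dots> = \<ominus> (\<Oplus>e\<in>Dv. q \<otimes> ed e \<otimes> gh e)"
    proof -
      have "(\<lambda>e. q \<otimes> ed e \<otimes> gh e) \<in> Dv \<rightarrow> carrier T" using Dv qT by auto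
      then show ?thesis
        using Dv(1) by (simp add: minus_as_smult finsum_smult_ldistr M.finsum_closed)
    qed
    finally have "x \<otimes> vx v = q \<oplus> \<ominus> (\<Oplus>e\<in>Dv. q \<otimes> ed e \<otimes> gh e)"
      using pT z v by (simp add: x_eq mult_l_distr q_def)
    moreover have "q = (\<Oplus>e\<in>Dv. q \<otimes> ed e \<otimes> gh e)"
    proof -
      consider "out_arcs E v = {}" | "regular_vertex E v" | "infinite (out_arcs E v)"
        using v by (auto simp: regular_vertex_def)
      then show ?thesis
      proof cases
        case 1
        \<comment> \<open>At a sink \<open>x v\<close> is itself a combination of paths, and it lies in \<open>J\<close>.\<close>
        then have Dv_empty: "Dv = {}" using Dv by (auto simp: Dv_def out_arcs_def)
        then have "x \<otimes> vx v = q"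
          using \<open>x \<otimes> vx v = q \<oplus> \<ominus> _\<close> qT by simp
        then have "q \<in> J" using J_mult(2)[OF Suc.prems(2), of "vx v"] v by simp
        then have "q = \<zero>" using q path_comb_in_J_zero by (auto simp: path_part_def)
        then show ?thesis using Dv_empty by simp
      next
        case 2
        \<comment> \<open>Insert \<open>v = \<Sum> e e*\<close> to the right of \<open>q\<close>; edges outside \<open>D\<close> contribute nothing.\<close>
        have fin: "finite (out_arcs E v)" using 2 by (simp add: regular_vertex_def)
        have out: "e \<in> arcs E \<and> tail E e = v" if "e \<in> out_arcs E v" for e
          using that by (simp add: out_arcs_def)
        have "q = q \<otimes> vx v" using pT v by (simp add: q_def mult_assoc vertex_mult)
        also have "\<dots> = (\<Oplus>e\<in>out_arcs E v. q \<otimes> (ed e \<otimes> gh e))"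
          unfolding regular_sum[OF 2] using fin qT out by (intro finsum_mult_right) auto
        also have "\<dots> = (\<Oplus>e\<in>Dv. q \<otimes> (ed e \<otimes> gh e))"
        proof (rule finsum_extend[OF fin])
          show "Dv \<subseteq> out_arcs E v" using Dv by (auto simp: Dv_def out_arcs_def)
          show "(\<lambda>e. q \<otimes> (ed e \<otimes> gh e)) \<in> Dv \<rightarrow> carrier T" using Dv qT by auto
          fix e assume e: "e \<in> out_arcs E v - Dv"
          have e': "e \<in> arcs E" "tail E e = v"
            using out[OF DiffD1[OF e]] by blast+
          have "e \<notin> D" using DiffD2[OF e] e'(2) unfolding Dv_def by blast
          with e' show "q \<otimes> (ed e \<otimes> gh e) = \<zero>"
            using qT by (simp add: mult_assoc[symmetric] q_edge p_edge)
        qed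
        also have "\<dots> = (\<Oplus>e\<in>Dv. q \<otimes> ed e \<otimes> gh e)"
          using Dv qT by (intro M.finsum_cong') (auto simp: mult_assoc)
        finally show ?thesis .
      next
        case 3
        \<comment> \<open>Some edge from \<open>v\<close> lies outside the finite set \<open>D\<close>; it is cancelled from \<open>p e = 0\<close>.\<close>
        then have "\<not> out_arcs E v \<subseteq> D" using D(1) finite_subset by blast
        then obtain e where e: "e \<in> arcs E" "tail E e = v" "e \<notin> D"
          by (auto simp: out_arcs_def)
        have "p \<otimes> vx (tail E e) = \<zero>"
        proof (cases "p = \<zero>")
          case True
          then show ?thesis using e(1) by simp
        next
          case False
          then obtain m where "path_comb m p" using p by (auto simp: path_part_def)
          then show ?thesis using e(1) p_edge[OF e(1,3)] by (rule path_comb_edge_cancel)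
        qed
        then have q0: "q = \<zero>" using e by (simp add: q_def)
        have "(\<Oplus>e\<in>Dv. q \<otimes> ed e \<otimes> gh e) = \<zero>"
          using Dv by (intro finsum_all_zero) (auto simp: q0)
        then show ?thesis using q0 by simp
      qed
    qed
    ultimately show ?thesis using qT by (metis M.r_neg)
  qed
  obtain V where V: "finite V" "V \<subseteq> verts E" "x \<otimes> vsum V = x" using local_unit[OF x] by metis
  have "x \<otimes> vsum V = (\<Oplus>v\<in>V. x \<otimes> vx v)"
    unfolding vsum_def using V x by (intro finsum_mult_right) auto
  also have "\<dots> = \<zero>" using V x_vertex by (intro finsum_all_zero) auto
  finally show ?case using V by simp
qed

theorem graded_uniqueness:
  assumes "x \<in> J" and "finite D" "\<And>n. n \<in> D \<Longrightarrow> homog n (c n) \<and> c n \<in> J"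
    and "x = (\<Oplus>n\<in>D. c n)"
  shows "x = \<zero>"
proof -
  have "c n = \<zero>" if "n \<in> D" for n
    using assms(3)[OF that] homog_imp_bounded_comb bounded_comb_in_J_zero by metis
  then show ?thesis unfolding assms(4) by (rule finsum_all_zero)
qed

end

end

section \<open>Quotient algebras\<close>

text \<open>
  The two conditions on scalars are what the scalar multiplication of \<open>R / I\<close> on \<open>L / A\<close> needs in
  order to be well defined: independence of the representative in \<open>L\<close> and of the one in \<open>R\<close>.
\<close>

locale algebra_quotient = nonunital_algebra R L + R_ideal: ideal I R for R and L (structure) and I +
  fixes A
  assumes A_ideal: "two_sided_ideal A L"
    and smult_A: "\<lbrakk>r \<in> carrier R; a \<in> A\<rbrakk> \<Longrightarrow> r \<odot> a \<in> A"
    and I_smult: "\<lbrakk>r \<in> I; x \<in> carrier L\<rbrakk> \<Longrightarrow> r \<odot> x \<in> A"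
begin

abbreviation Q where "Q \<equiv> quotient_algebra L A"

lemma abelian_subgroup_A: "abelian_subgroup A L"
  using A_ideal M.abelian_group_axioms by (simp add: two_sided_ideal_def abelian_subgroupI3)

end

sublocale algebra_quotient \<subseteq> sub: abelian_subgroup A L
  by (rule abelian_subgroup_A)

context algebra_quotient
begin

lemma A_mult: "\<lbrakk>a \<in> A; x \<in> carrier L\<rbrakk> \<Longrightarrow> x \<otimes> a \<in> A" "\<lbrakk>a \<in> A; x \<in> carrier L\<rbrakk> \<Longrightarrow> a \<otimes> x \<in> A"
  using A_ideal by (auto simp: two_sided_ideal_def)

lemma coset_absorb:
  assumes "a \<in> A" "x \<in> carrier L" shows "A +> (a \<oplus> x) = A +> x"
proof -
  have "a \<oplus> x \<in> A +> x" using assms by (auto simp: a_r_coset_def r_coset_def)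
  then show ?thesis using sub.a_repr_independence' assms(2) by simp
qed

lemma coset_eq_A_iff: "x \<in> carrier L \<Longrightarrow> A +> x = A \<longleftrightarrow> x \<in> A"
  using sub.a_rcos_self sub.a_rcos_const by blast

lemma in_coset:
  assumes "x' \<in> A +> x" "x \<in> carrier L"
  obtains a where "a \<in> A" "x' = a \<oplus> x"
  using assms by (auto simp: a_r_coset_def r_coset_def)

lemma coset_closed [simp]: "x \<in> carrier L \<Longrightarrow> A +> x \<in> carrier Q"
  by (simp add: quotient_algebra_def FactRing_def a_rcosetsI sub.a_subset)

lemma carrier_Q_cases:
  assumes "X \<in> carrier Q"
  obtains x where "x \<in> carrier L" "X = A +> x"
  using assms by (auto simp: quotient_algebra_def FactRing_def A_RCOSETS_def' a_r_coset_def')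

lemma scalar_cases:
  assumes "k \<in> carrier (R Quot I)"
  obtains r where "r \<in> carrier R" "k = I +>\<^bsub>R\<^esub> r"
  using assms by (auto simp: FactRing_def A_RCOSETS_def' a_r_coset_def')

lemma zero_Q: "\<zero>\<^bsub>Q\<^esub> = A +> \<zero>"
  by (simp add: quotient_algebra_def FactRing_def sub.a_rcos_const)

lemma add_coset:
  "\<lbrakk>x \<in> carrier L; y \<in> carrier L\<rbrakk> \<Longrightarrow> (A +> x) \<oplus>\<^bsub>Q\<^esub> (A +> y) = A +> (x \<oplus> y)"
  by (simp add: quotient_algebra_def FactRing_def sub.a_rcos_sum)

lemma mult_coset:
  assumes x: "x \<in> carrier L" and y: "y \<in> carrier L"
  shows "(A +> x) \<otimes>\<^bsub>Q\<^esub> (A +> y) = A +> (x \<otimes> y)"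
proof -
  have "A +> (x' \<otimes> y') = A +> (x \<otimes> y)" if x': "x' \<in> A +> x" and y': "y' \<in> A +> y" for x' y'
  proof -
    obtain a where a: "a \<in> A" "x' = a \<oplus> x" using x' x by (rule in_coset)
    obtain b where b: "b \<in> A" "y' = b \<oplus> y" using y' y by (rule in_coset)
    have "x' \<otimes> y' = (a \<otimes> (b \<oplus> y) \<oplus> x \<otimes> b) \<oplus> x \<otimes> y"
      using a b x y by (simp add: mult_l_distr mult_r_distr M.a_ac)
    moreover have "a \<otimes> (b \<oplus> y) \<oplus> x \<otimes> b \<in> A"
      using a b x y by (simp add: A_mult)
    ultimately show ?thesis using x y by (simp add: coset_absorb)
  qed
  moreover have "x \<in> A +> x" "y \<in> A +> y" using x y by (simp_all add: sub.a_rcos_self)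
  ultimately have "(\<Union>x'\<in>A +> x. \<Union>y'\<in>A +> y. A +> (x' \<otimes> y')) = A +> (x \<otimes> y)" by blast
  then show ?thesis by (simp add: quotient_algebra_def FactRing_def rcoset_mult_def)
qed

lemma smult_coset:
  assumes r: "r \<in> carrier R" and x: "x \<in> carrier L"
  shows "(I +>\<^bsub>R\<^esub> r) \<odot>\<^bsub>Q\<^esub> (A +> x) = A +> (r \<odot> x)"
proof -
  have "A +> (r' \<odot> x') = A +> (r \<odot> x)" if r': "r' \<in> I +>\<^bsub>R\<^esub> r" and x': "x' \<in> A +> x" for r' x'
  proof -
    obtain a where a: "a \<in> A" "x' = a \<oplus> x" using x' x by (rule in_coset)
    obtain i where i: "i \<in> I" "r' = i \<oplus>\<^bsub>R\<^esub> r"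
      using r' by (auto simp: a_r_coset_def r_coset_def)
    have "r' \<odot> x' = (i \<odot> a \<oplus> r \<odot> a \<oplus> i \<odot> x) \<oplus> r \<odot> x"
      using a i x r by (simp add: smult_l_distr smult_r_distr M.a_ac)
    moreover have "i \<odot> a \<oplus> r \<odot> a \<oplus> i \<odot> x \<in> A"
      using a i x r by (simp add: smult_A I_smult)
    ultimately show ?thesis using x r by (simp add: coset_absorb)
  qed
  moreover have "r \<in> I +>\<^bsub>R\<^esub> r" "x \<in> A +> x"
    using x r by (simp_all add: sub.a_rcos_self R_ideal.a_rcos_self)
  ultimately have "(\<Union>r'\<in>I +>\<^bsub>R\<^esub> r. \<Union>x'\<in>A +> x. A +> (r' \<odot> x')) = A +> (r \<odot> x)" by blast
  then show ?thesis by (simp add: quotient_algebra_def)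
qed

lemmas coset_ops = zero_Q add_coset mult_coset smult_coset

lemma scalar_ops:
  assumes "r \<in> carrier R" "s \<in> carrier R"
  shows "(I +>\<^bsub>R\<^esub> r) \<oplus>\<^bsub>R Quot I\<^esub> (I +>\<^bsub>R\<^esub> s) = I +>\<^bsub>R\<^esub> (r \<oplus>\<^bsub>R\<^esub> s)"
    and "(I +>\<^bsub>R\<^esub> r) \<otimes>\<^bsub>R Quot I\<^esub> (I +>\<^bsub>R\<^esub> s) = I +>\<^bsub>R\<^esub> (r \<otimes>\<^bsub>R\<^esub> s)"
  using assms by (simp_all add: FactRing_def R_ideal.a_rcos_sum R_ideal.rcoset_mult_add)

lemma scalar_one: "\<one>\<^bsub>R Quot I\<^esub> = I +>\<^bsub>R\<^esub> \<one>\<^bsub>R\<^esub>"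
  by (simp add: FactRing_def)

lemma abelian_group_Q: "abelian_group Q"
proof (rule abelian_groupI)
  show "\<zero>\<^bsub>Q\<^esub> \<in> carrier Q" by (simp add: zero_Q)
next
  fix X assume "X \<in> carrier Q"
  then obtain x where x: "x \<in> carrier L" "X = A +> x" by (rule carrier_Q_cases)
  then have "(A +> (\<ominus> x)) \<oplus>\<^bsub>Q\<^esub> X = \<zero>\<^bsub>Q\<^esub>" by (simp add: coset_ops M.l_neg)
  then show "\<exists>Y\<in>carrier Q. Y \<oplus>\<^bsub>Q\<^esub> X = \<zero>\<^bsub>Q\<^esub>"
    by (rule bexI) (use x in simp)
qed (elim carrier_Q_cases, simp add: coset_ops M.a_ac)+

lemma nonunital_algebra_Q: "nonunital_algebra (R Quot I) Q"
proof (rule nonunital_algebra.intro)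
  show "Module.module (R Quot I) Q"
  proof (rule Module.moduleI)
    show "cring (R Quot I)" using R_ideal.quotient_is_cring R.is_cring .
    show "abelian_group Q" by (rule abelian_group_Q)
  qed (elim carrier_Q_cases scalar_cases,
       simp add: coset_ops scalar_ops scalar_one smult_l_distr smult_r_distr smult_assoc1)+
  show "nonunital_algebra_axioms (R Quot I) Q"
    by (unfold_locales; elim carrier_Q_cases scalar_cases)
       (simp_all add: coset_ops mult_assoc mult_r_distr mult_l_distr smult_mult_left
         smult_mult_right)
qed

lemma finsum_coset:
  assumes "finite D" "f \<in> D \<rightarrow> carrier L"
  shows "(\<Oplus>\<^bsub>Q\<^esub>i\<in>D. A +> f i) = A +> (\<Oplus>i\<in>D. f i)"
  using assms
proof (induction rule: finite_induct)
  case empty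
  interpret Q: nonunital_algebra "R Quot I" Q by (rule nonunital_algebra_Q)
  show ?case by (simp add: zero_Q)
next
  case (insert i D)
  interpret Q: nonunital_algebra "R Quot I" Q by (rule nonunital_algebra_Q)
  show ?case using insert by (simp add: Q.M.finsum_insert M.finsum_insert Pi_def add_coset)
qed

lemma a_inv_coset:
  assumes "x \<in> carrier L" shows "\<ominus>\<^bsub>Q\<^esub> (A +> x) = A +> (\<ominus> x)"
proof -
  interpret Q: nonunital_algebra "R Quot I" Q by (rule nonunital_algebra_Q)
  show ?thesis using assms by (intro Q.M.minus_equality) (simp_all add: coset_ops M.l_neg)
qed

lemma coset_zero_iff: "x \<in> carrier L \<Longrightarrow> A +> x = \<zero>\<^bsub>Q\<^esub> \<longleftrightarrow> x \<in> A"
  by (simp add: quotient_algebra_def FactRing_def coset_eq_A_iff)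

text \<open>The relations are equations between sums of products, so they pass to cosets.\<close>

lemma coset_leavitt_family:
  assumes "leavitt_family R L E \<gamma>"
  shows "leavitt_family (R Quot I) Q E (\<lambda>g. A +> \<gamma> g)"
proof -
  interpret F: leavitt_family R L E \<gamma> by fact
  interpret Q: nonunital_algebra "R Quot I" Q by (rule nonunital_algebra_Q)
  have mult: "(A +> \<gamma> g) \<otimes>\<^bsub>Q\<^esub> (A +> \<gamma> h) = A +> (\<gamma> g \<otimes> \<gamma> h)"
    if "g \<in> lpa_gens E" "h \<in> lpa_gens E" for g h
    using that F.gens_closed by (intro mult_coset) auto
  show ?thesis
  proof (rule leavitt_family.intro[OF nonunital_algebra_Q], rule leavitt_family_axioms.intro)
    show "wf_digraph E" by (rule F.wf)
    show "(\<lambda>g. A +> \<gamma> g) \<in> lpa_gens E \<rightarrow> carrier Q" using F.gens_closed by (simp add: Pi_iff)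
    fix v assume v: "regular_vertex E v"
    have "A +> \<gamma> (Vertex v) = (\<Oplus>\<^bsub>Q\<^esub>e\<in>out_arcs E v. A +> (\<gamma> (Edge e) \<otimes> \<gamma> (Ghost e)))"
      unfolding F.regular_sum[OF v] using v
      by (intro finsum_coset[symmetric]) (auto simp: regular_vertex_def)
    also have "\<dots> = (\<Oplus>\<^bsub>Q\<^esub>e\<in>out_arcs E v. (A +> \<gamma> (Edge e)) \<otimes>\<^bsub>Q\<^esub> (A +> \<gamma> (Ghost e)))"
      by (rule Q.M.finsum_cong') (simp_all add: mult_coset Pi_def)
    finally show "A +> \<gamma> (Vertex v) =
        (\<Oplus>\<^bsub>Q\<^esub>e\<in>out_arcs E v. (A +> \<gamma> (Edge e)) \<otimes>\<^bsub>Q\<^esub> (A +> \<gamma> (Ghost e)))" .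
  qed (simp_all add: mult_coset zero_Q F.gen_mult)
qed

end

section \<open>Families for the quotient graph\<close>

text \<open>The vertex or edge of \<open>E\<close> that a vertex or edge of the quotient graph lies over.\<close>

fun original :: "'a copy \<Rightarrow> 'a" where
  "original (Plain x) = x"
| "original (Primed x) = x"

text \<open>
  A family for \<open>E\<close> in which \<open>H\<close> and the elements \<open>v\<^sup>H\<close> with \<open>v \<in> S\<close> vanish, as it arises modulo
  the ideal \<open>A\<close>.
\<close>

locale quotient_graph_family = leavitt_family K T E \<gamma>
  for K and T (structure) and E :: "('v, 'e) pre_digraph"
    and \<gamma> :: "('v, 'e) lpa_gen \<Rightarrow> 'b" +
  fixes H S :: "'v set"
  assumes head_H: "\<lbrakk>e \<in> arcs E; tail E e \<in> H\<rbrakk> \<Longrightarrow> head E e \<in> H"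
    and vertex_H: "\<lbrakk>v \<in> verts E; v \<in> H\<rbrakk> \<Longrightarrow> \<gamma> (Vertex v) = \<zero>"
    and vertex_S: "\<lbrakk>v \<in> breaking_vertices E H; v \<in> S\<rbrakk> \<Longrightarrow>
      \<gamma> (Vertex v) = (\<Oplus>e\<in>arcs_leaving E H v. \<gamma> (Edge e) \<otimes> \<gamma> (Ghost e))"
begin

abbreviation "F \<equiv> quotient_graph E H S"
abbreviation "B \<equiv> breaking_vertices E H - S"

definition leaving_sum :: "'v \<Rightarrow> 'b" where
  "leaving_sum v = (\<Oplus>e\<in>arcs_leaving E H v. ed e \<otimes> gh e)"

text \<open>
  A vertex in \<open>B\<^sub>H - S\<close> is split into two idempotents. The first has to be the sum over the leaving
  edges because \<open>Plain v\<close> is regular in the quotient graph and emits only those edges and their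
  primed copies; the second, \<open>v\<^sup>H\<close>, belongs to a sink.
\<close>

fun qvx :: "'v copy \<Rightarrow> 'b" where
  "qvx (Plain v) = (if v \<in> B then leaving_sum v else vx v)"
| "qvx (Primed v) = vx v \<ominus> leaving_sum v"

fun qgen :: "('v copy, 'e copy) lpa_gen \<Rightarrow> 'b" where
  "qgen (Vertex w) = qvx w"
| "qgen (Edge x) = ed (original x) \<otimes> qvx (head F x)"
| "qgen (Ghost x) = qvx (head F x) \<otimes> gh (original x)"

lemma leaving:
  assumes "e \<in> arcs_leaving E H v" shows "e \<in> arcs E" "tail E e = v" "head E e \<notin> H"
  using assms by (auto simp: arcs_leaving_def out_arcs_def)

lemma breaking:
  assumes "v \<in> breaking_vertices E H"
  shows "v \<in> verts E" "v \<notin> H" "finite (arcs_leaving E H v)" "arcs_leaving E H v \<noteq> {}"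
  using assms by (auto simp: breaking_vertices_def infinite_emitter_def)

lemma leaving_sum_closed [simp]: "leaving_sum v \<in> carrier T"
  unfolding leaving_sum_def by (rule M.finsum_closed) (auto dest: leaving)

lemma leaving_sum_edge:
  assumes "finite (arcs_leaving E H v)" "e \<in> arcs_leaving E H v"
  shows "leaving_sum v \<otimes> ed e = ed e" "gh e \<otimes> leaving_sum v = gh e"
proof -
  have e: "e \<in> arcs E" using assms(2) by (rule leaving)
  have closed: "(\<lambda>f. ed f \<otimes> gh f) \<in> arcs_leaving E H v \<rightarrow> carrier T" by (auto dest: leaving)
  show "leaving_sum v \<otimes> ed e = ed e"
    unfolding leaving_sum_def finsum_mult_left[OF assms(1) gen_closed(2)[OF e] closed]
    by (rule finsum_only[OF assms gen_closed(2)[OF e]])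
       (use e leaving(1) in \<open>simp_all add: mult_assoc ghost_edge edge_head\<close>)
  show "gh e \<otimes> leaving_sum v = gh e"
    unfolding leaving_sum_def finsum_mult_right[OF assms(1) gen_closed(3)[OF e] closed]
    by (rule finsum_only[OF assms gen_closed(3)[OF e]])
       (use e leaving(1) in \<open>simp_all add: gen_mult_assoc head_ghost\<close>)
qed

lemma leaving_sum_vertex:
  assumes "finite (arcs_leaving E H v)" "v \<in> verts E"
  shows "vx v \<otimes> leaving_sum v = leaving_sum v" "leaving_sum v \<otimes> vx v = leaving_sum v"
proof -
  have v: "vx v \<in> carrier T" using assms(2) by simp
  have closed: "(\<lambda>f. ed f \<otimes> gh f) \<in> arcs_leaving E H v \<rightarrow> carrier T" by (auto dest: leaving)
  show "vx v \<otimes> leaving_sum v = leaving_sum v"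
    unfolding leaving_sum_def finsum_mult_right[OF assms(1) v closed]
    by (rule M.finsum_cong')
       (use assms leaving(1,2) in \<open>simp_all add: gen_mult_assoc Pi_def\<close>)
  show "leaving_sum v \<otimes> vx v = leaving_sum v"
    unfolding leaving_sum_def finsum_mult_left[OF assms(1) v closed]
    by (rule M.finsum_cong')
       (use assms leaving(1,2) in \<open>simp_all add: mult_assoc ghost_vertex Pi_def\<close>)
qed

lemma leaving_sum_idem:
  assumes "finite (arcs_leaving E H v)"
  shows "leaving_sum v \<otimes> leaving_sum v = leaving_sum v"
proof -
  have closed: "(\<lambda>f. ed f \<otimes> gh f) \<in> arcs_leaving E H v \<rightarrow> carrier T" by (auto dest: leaving)
  have "leaving_sum v \<otimes> leaving_sum v = (\<Oplus>e\<in>arcs_leaving E H v. leaving_sum v \<otimes> (ed e \<otimes> gh e))"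
    using finsum_mult_right[OF assms leaving_sum_closed closed] by (simp add: leaving_sum_def)
  also have "\<dots> = (\<Oplus>e\<in>arcs_leaving E H v. ed e \<otimes> gh e)"
    by (rule M.finsum_cong')
       (use leaving(1) in \<open>simp_all add: Pi_def mult_assoc[symmetric] leaving_sum_edge[OF assms]\<close>)
  finally show ?thesis by (simp only: leaving_sum_def[symmetric])
qed

lemma verts_F: "verts F = Plain ` (verts E - H) \<union> Primed ` B"
  by (simp add: quotient_graph_def)

lemma arcs_F:
  assumes "x \<in> arcs F"
  shows "original x \<in> arcs E" "head E (original x) \<notin> H" "tail E (original x) \<notin> H"
    "tail F x = Plain (tail E (original x))" "original (head F x) = head E (original x)"
    "head F x \<in> verts F" "tail F x \<in> verts F"
proof -
  have "(\<exists>e. x = Plain e \<and> e \<in> arcs E \<and> head E e \<notin> H) \<or> (\<exists>e. x = Primed e \<and> e \<in> arcs E \<and> head E e \<in> B)"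
    using assms by (auto simp: quotient_graph_def)
  then show 1: "original x \<in> arcs E" "head E (original x) \<notin> H"
    "tail F x = Plain (tail E (original x))" "original (head F x) = head E (original x)"
    "head F x \<in> verts F"
    by (auto simp: quotient_graph_def breaking)
  show "tail E (original x) \<notin> H" using 1 head_H by blast
  then show "tail F x \<in> verts F" using 1 by (auto simp: verts_F)
qed

lemma wf_F: "wf_digraph F"
  by unfold_locales (erule arcs_F(6) arcs_F(7))+

lemma qvx_closed: "w \<in> verts F \<Longrightarrow> qvx w \<in> carrier T"
  by (auto simp: verts_F breaking a_minus_def)

lemma original_verts: "w \<in> verts F \<Longrightarrow> original w \<in> verts E"
  by (auto simp: verts_F breaking)

lemma qvx_original:
  assumes "w \<in> verts F"
  shows "vx (original w) \<otimes> qvx w = qvx w" "qvx w \<otimes> vx (original w) = qvx w"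
  using assms
  by (auto simp del: Diff_iff simp: verts_F breaking a_minus_def mult_r_distr mult_l_distr
    mult_r_minus mult_l_minus vertex_idem leaving_sum_vertex)

text \<open>
  Idempotents over different vertices of \<open>E\<close> are separated by these vertices; over the same vertex
  they are complementary in it.
\<close>

lemma qvx_mult:
  assumes w: "w \<in> verts F" and w': "w' \<in> verts F"
  shows "qvx w \<otimes> qvx w' = (if w = w' then qvx w else \<zero>)"
proof (cases "original w = original w'")
  case False
  have "qvx w \<otimes> qvx w' = (qvx w \<otimes> vx (original w)) \<otimes> (vx (original w') \<otimes> qvx w')"
    by (simp only: qvx_original w w')
  also have "\<dots> = qvx w \<otimes> (vx (original w) \<otimes> (vx (original w') \<otimes> qvx w'))"
    by (simp add: mult_assoc qvx_closed original_verts w w')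
  also have "\<dots> = \<zero>"
    using False by (simp add: gen_mult_assoc qvx_closed original_verts w w')
  finally show ?thesis using False by auto
next
  case True
  define v where "v = original w"
  have v: "v \<in> verts E" unfolding v_def using w by (rule original_verts)
  have w_cases: "w = Plain v \<or> w = Primed v" "w' = Plain v \<or> w' = Primed v"
    using True by (cases w; cases w'; simp add: v_def)+
  show ?thesis
  proof (cases "v \<in> B")
    case False
    then have "w = Plain v" "w' = Plain v" using w_cases w w' by (auto simp: verts_F)
    then show ?thesis using False v by (simp add: vertex_idem del: Diff_iff)
  next
    case True
    then have fin: "finite (arcs_leaving E H v)" by (simp add: breaking)
    let ?s = "leaving_sum v"
    note mult = leaving_sum_vertex[OF fin v] leaving_sum_idem[OF fin] vertex_idem[OF v]
    have "?s \<otimes> (vx v \<ominus> ?s) = \<zero>" "(vx v \<ominus> ?s) \<otimes> ?s = \<zero>"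
      "(vx v \<ominus> ?s) \<otimes> (vx v \<ominus> ?s) = vx v \<ominus> ?s"
      using v by (simp_all add: a_minus_def mult_l_distr mult_r_distr mult_l_minus mult_r_minus
          mult M.r_neg M.l_neg M.minus_add M.a_assoc)
    then show ?thesis
      using w_cases by (elim disjE) (simp_all add: mult True del: Diff_iff)
  qed
qed

lemma qvx_tail_edge:
  assumes "x \<in> arcs F"
  shows "qvx (tail F x) \<otimes> ed (original x) = ed (original x)"
    and "gh (original x) \<otimes> qvx (tail F x) = gh (original x)"
proof -
  let ?v = "tail E (original x)"
  have "original x \<in> arcs_leaving E H ?v"
    using arcs_F[OF assms] by (simp add: arcs_leaving_def out_arcs_def)
  then show "qvx (tail F x) \<otimes> ed (original x) = ed (original x)"
    "gh (original x) \<otimes> qvx (tail F x) = gh (original x)"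
    using arcs_F[OF assms] leaving_sum_edge[of ?v "original x"]
    by (simp_all add: breaking tail_edge ghost_tail)
qed

lemma arc_F_eqI:
  assumes "x \<in> arcs F" "y \<in> arcs F" "original x = original y" "head F x = head F y"
  shows "x = y"
  using assms by (auto simp: quotient_graph_def)

lemma regular_F:
  assumes w: "regular_vertex F w"
  obtains v where "w = Plain v" "v \<in> verts E" "v \<notin> H" "finite (arcs_leaving E H v)"
    "arcs_leaving E H v \<noteq> {}"
    "out_arcs F w = Plain ` arcs_leaving E H v \<union> Primed ` {e \<in> arcs_leaving E H v. head E e \<in> B}"
proof -
  have wF: "w \<in> verts F" and out: "out_arcs F w \<noteq> {}" "finite (out_arcs F w)"
    using w by (auto simp: regular_vertex_def)
  then obtain x where "x \<in> arcs F" "tail F x = w" by (auto simp: out_arcs_def)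
  then obtain v where v: "w = Plain v" using arcs_F(4) by metis
  have eq: "out_arcs F w = Plain ` arcs_leaving E H v \<union> Primed ` {e \<in> arcs_leaving E H v. head E e \<in> B}"
    unfolding v by (auto simp: quotient_graph_def out_arcs_def arcs_leaving_def breaking)
  have "finite (Plain ` arcs_leaving E H v)" using out(2) eq by simp
  then have fin: "finite (arcs_leaving E H v)" by (rule finite_imageD) (simp add: inj_on_def)
  show ?thesis using that[of v] v wF eq out(1) fin by (auto simp: verts_F)
qed

text \<open>
  By \<open>regular_F\<close>, this is the value required at a vertex that is regular in the quotient graph. For
  \<open>v \<in> B\<^sub>H - S\<close> it holds by definition and for \<open>v \<in> S\<close> by the vanishing of \<open>v\<^sup>H\<close>. Any other such \<open>v\<close>
  emits only finitely many edges in \<open>E\<close>, and in its relation the edges into \<open>H\<close> vanish.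
\<close>

lemma qvx_regular_F:
  assumes v: "v \<in> verts E" "v \<notin> H" "finite (arcs_leaving E H v)" "arcs_leaving E H v \<noteq> {}"
  shows "qvx (Plain v) = leaving_sum v"
proof (cases "v \<in> breaking_vertices E H")
  case True
  then show ?thesis using vertex_S by (auto simp: leaving_sum_def)
next
  case False
  then have fin: "finite (out_arcs E v)" using v by (auto simp: breaking_vertices_def infinite_emitter_def)
  have "arcs_leaving E H v \<subseteq> out_arcs E v" by (auto simp: arcs_leaving_def)
  then have reg: "regular_vertex E v" using v fin by (auto simp: regular_vertex_def)
  have "vx v = leaving_sum v"
    unfolding leaving_sum_def regular_sum[OF reg]
  proof (rule finsum_extend[OF fin])
    fix e assume "e \<in> out_arcs E v - arcs_leaving E H v"
    then have e: "e \<in> arcs E" "head E e \<in> H" by (auto simp: arcs_leaving_def out_arcs_def)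
    then have "ed e = \<zero>" using edge_head[OF e(1)] vertex_H by simp
    then show "ed e \<otimes> gh e = \<zero>" using e(1) by simp
  qed (auto simp: arcs_leaving_def out_arcs_def)
  then show ?thesis using False by simp
qed

text \<open>
  The edges of the quotient graph over one edge \<open>e\<close> of \<open>E\<close> contribute \<open>e p e*\<close>, where \<open>p\<close> runs over
  the idempotents into which the range of \<open>e\<close> has been split. These add up to the range of \<open>e\<close>, so
  together they contribute \<open>e e*\<close>.
\<close>

lemma regular_sum_F:
  assumes "regular_vertex F w"
  shows "qgen (Vertex w) = (\<Oplus>x\<in>out_arcs F w. qgen (Edge x) \<otimes> qgen (Ghost x))"
proof -
  obtain v where w: "w = Plain v" and v: "v \<in> verts E" "v \<notin> H"
      and fin: "finite (arcs_leaving E H v)" and ne: "arcs_leaving E H v \<noteq> {}"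
      and out: "out_arcs F w =
        Plain ` arcs_leaving E H v \<union> Primed ` {e \<in> arcs_leaving E H v. head E e \<in> B}"
    using assms by (rule regular_F)
  let ?D = "arcs_leaving E H v" and ?D' = "{e \<in> arcs_leaving E H v. head E e \<in> B}"
  let ?g = "\<lambda>x. qgen (Edge x) \<otimes> qgen (Ghost x)"
  let ?h = "\<lambda>w e. ed e \<otimes> (qvx w \<otimes> gh e)"
  have "\<And>x. x \<in> out_arcs F w \<Longrightarrow> x \<in> arcs F" by (simp add: out_arcs_def)
  then have PF: "Plain e \<in> arcs F" if "e \<in> ?D" for e using that unfolding out by blast
  have PrF: "Primed e \<in> arcs F" if "e \<in> ?D'" for e
    using \<open>\<And>x. x \<in> out_arcs F w \<Longrightarrow> x \<in> arcs F\<close> that unfolding out by blast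
  have heads: "head F (Plain e) = Plain (head E e)" "head F (Primed e) = Primed (head E e)" for e
    by (simp_all add: quotient_graph_def)
  have g: "?g x = ?h (head F x) (original x)" if "x \<in> arcs F" for x
  proof -
    have c: "original x \<in> arcs E" "qvx (head F x) \<in> carrier T"
        "qvx (head F x) \<otimes> qvx (head F x) = qvx (head F x)"
      using arcs_F[OF that] by (simp_all add: qvx_closed qvx_mult)
    have "?g x = ed (original x) \<otimes> (qvx (head F x) \<otimes> qvx (head F x) \<otimes> gh (original x))"
      using c(1,2) by (simp add: mult_assoc)
    then show ?thesis by (simp add: c(3))
  qed
  have gP: "?g (Plain e) = ?h (Plain (head E e)) e" "?h (Plain (head E e)) e \<in> carrier T"
    if "e \<in> ?D" for e
    using g[OF PF[OF that]] arcs_F[OF PF[OF that]] qvx_closed[of "Plain (head E e)"]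
    by (simp_all only: heads original.simps) (simp_all add: heads)
  have gPr: "?g (Primed e) = ?h (Primed (head E e)) e" "?h (Primed (head E e)) e \<in> carrier T"
    if "e \<in> ?D'" for e
    using g[OF PrF[OF that]] arcs_F[OF PrF[OF that]] qvx_closed[of "Primed (head E e)"]
    by (simp_all only: heads original.simps) (simp_all add: heads)
  \<comment> \<open>The primed edges, extended by zero to all edges leaving \<open>v\<close>, can be added term by term.\<close>
  define pr where "pr e = (if head E e \<in> B then ?h (Primed (head E e)) e else \<zero>)" for e
  have pr_closed: "pr e \<in> carrier T" if "e \<in> ?D" for e
    using that gPr(2)[of e] by (simp add: pr_def)
  have "(\<Oplus>x\<in>out_arcs F w. ?g x) = (\<Oplus>x\<in>Plain ` ?D. ?g x) \<oplus> (\<Oplus>x\<in>Primed ` ?D'. ?g x)"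
    unfolding out
    by (rule M.finsum_Un_disjoint) (use fin gP gPr in \<open>auto simp del: qgen.simps\<close>)
  also have "(\<Oplus>x\<in>Plain ` ?D. ?g x) = (\<Oplus>e\<in>?D. ?g (Plain e))"
    by (rule M.finsum_reindex) (use gP in \<open>auto simp: inj_on_def simp del: qgen.simps\<close>)
  also have "\<dots> = (\<Oplus>e\<in>?D. ?h (Plain (head E e)) e)"
    by (rule M.finsum_cong') (use gP in \<open>auto simp del: qgen.simps qvx.simps\<close>)
  also have "(\<Oplus>x\<in>Primed ` ?D'. ?g x) = (\<Oplus>e\<in>?D'. ?g (Primed e))"
    by (rule M.finsum_reindex) (use gPr in \<open>auto simp: inj_on_def simp del: qgen.simps\<close>)
  also have "\<dots> = (\<Oplus>e\<in>?D'. pr e)"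
    by (rule M.finsum_cong')
       (use gPr pr_closed in \<open>auto simp: pr_def simp del: qgen.simps qvx.simps\<close>)
  also have "\<dots> = (\<Oplus>e\<in>?D. pr e)"
    by (rule finsum_extend[symmetric]) (use fin pr_closed in \<open>auto simp: pr_def\<close>)
  also have "(\<Oplus>e\<in>?D. ?h (Plain (head E e)) e) \<oplus> (\<Oplus>e\<in>?D. pr e) =
      (\<Oplus>e\<in>?D. ?h (Plain (head E e)) e \<oplus> pr e)"
    by (rule M.finsum_addf[symmetric])
       (use gP pr_closed in \<open>auto simp del: qgen.simps qvx.simps\<close>)
  also have "\<dots> = leaving_sum v"
    unfolding leaving_sum_def[of v]
  proof (rule M.finsum_cong')
    fix e assume e: "e \<in> ?D"
    have eE: "e \<in> arcs E" using e by (rule leaving)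
    show "?h (Plain (head E e)) e \<oplus> pr e = ed e \<otimes> gh e"
    proof (cases "head E e \<in> B")
      case True
      let ?s = "leaving_sum (head E e)"
      have "?h (Plain (head E e)) e \<oplus> pr e = ed e \<otimes> ((?s \<oplus> (vx (head E e) \<ominus> ?s)) \<otimes> gh e)"
        using True eE by (simp add: pr_def mult_l_distr mult_r_distr a_minus_def del: Diff_iff)
      also have "?s \<oplus> (vx (head E e) \<ominus> ?s) = vx (head E e)"
        using eE by (simp add: a_minus_def M.a_lcomm M.r_neg)
      finally show ?thesis using eE by (simp add: head_ghost)
    next
      case False
      then show ?thesis using eE by (simp add: pr_def head_ghost del: Diff_iff)
    qed
  qed (auto dest: leaving)
  also have "\<dots> = qgen (Vertex w)" using qvx_regular_F[OF v fin ne] by (simp add: w)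
  finally show ?thesis by simp
qed

text \<open>
  A vertex or edge of \<open>E\<close> that survives in the quotient graph is the sum of the plain and the primed
  generator over it, if both exist; the generators that do not survive are zero.
\<close>

lemma generators_in_span:
  assumes zero: "\<zero> \<in> C" and add: "\<And>x y. \<lbrakk>x \<in> C; y \<in> C\<rbrakk> \<Longrightarrow> x \<oplus> y \<in> C"
    and gens: "\<And>g. g \<in> lpa_gens F \<Longrightarrow> qgen g \<in> C"
    and g: "g \<in> lpa_gens E"
  shows "\<gamma> g \<in> C"
proof -
  have split: "leaving_sum v \<oplus> (vx v \<ominus> leaving_sum v) = vx v" if "v \<in> verts E" for v
    using that by (simp add: a_minus_def M.a_lcomm M.r_neg)
  consider v where "g = Vertex v" "v \<in> verts E" | e where "g = Edge e" "e \<in> arcs E"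
    | e where "g = Ghost e" "e \<in> arcs E"
    using g by (auto simp: lpa_gens_def)
  then show ?thesis
  proof cases
    case (1 v)
    consider "v \<in> H" | "v \<notin> H" "v \<notin> B" | "v \<notin> H" "v \<in> B" by blast
    then show ?thesis
    proof cases
      case 1
      then show ?thesis using zero vertex_H \<open>g = Vertex v\<close> \<open>v \<in> verts E\<close> by simp
    next
      case 2
      have "Vertex (Plain v) \<in> lpa_gens F"
        using 2 \<open>v \<in> verts E\<close> by (simp add: lpa_gens_def verts_F image_iff)
      from gens[OF this] show ?thesis using 2(2) \<open>g = Vertex v\<close> by (simp del: Diff_iff)
    next
      case 3
      have "Vertex (Plain v) \<in> lpa_gens F" "Vertex (Primed v) \<in> lpa_gens F"
        using 3 \<open>v \<in> verts E\<close> by (simp_all add: lpa_gens_def verts_F image_iff)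
      from add[OF this[THEN gens]] show ?thesis
        using 3(2) \<open>g = Vertex v\<close> split[OF \<open>v \<in> verts E\<close>] by (simp del: Diff_iff)
    qed
  next
    case (2 e)
    let ?v = "head E e"
    consider "?v \<in> H" | "?v \<notin> H" "?v \<notin> B" | "?v \<notin> H" "?v \<in> B" by blast
    then show ?thesis
    proof cases
      case 1
      then have "ed e = \<zero>" using edge_head[OF 2(2)] vertex_H[of ?v] 2(2) by simp
      then show ?thesis using zero 2(1) by simp
    next
      case v: 2
      have "Edge (Plain e) \<in> lpa_gens F"
        using v 2(2) by (simp add: lpa_gens_def quotient_graph_def image_iff)
      from gens[OF this] show ?thesis
        using v(2) 2 by (simp add: quotient_graph_def edge_head del: Diff_iff)
    next
      case v: 3
      have "Edge (Plain e) \<in> lpa_gens F" "Edge (Primed e) \<in> lpa_gens F"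
        using v 2(2) by (simp_all add: lpa_gens_def quotient_graph_def image_iff)
      from add[OF this[THEN gens]] have "ed e \<otimes> leaving_sum ?v \<oplus> ed e \<otimes> (vx ?v \<ominus> leaving_sum ?v) \<in> C"
        using v(2) by (simp add: quotient_graph_def del: Diff_iff)
      moreover have "ed e \<otimes> leaving_sum ?v \<oplus> ed e \<otimes> (vx ?v \<ominus> leaving_sum ?v) = ed e"
        using mult_r_distr[of "ed e" "leaving_sum ?v" "vx ?v \<ominus> leaving_sum ?v"] split[of ?v] 2(2)
        by (simp add: edge_head)
      ultimately show ?thesis using 2(1) by simp
    qed
  next
    case (3 e)
    let ?v = "head E e"
    consider "?v \<in> H" | "?v \<notin> H" "?v \<notin> B" | "?v \<notin> H" "?v \<in> B" by blast
    then show ?thesis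
    proof cases
      case 1
      then have "gh e = \<zero>" using head_ghost[OF 3(2)] vertex_H[of ?v] 3(2) by simp
      then show ?thesis using zero 3(1) by simp
    next
      case v: 2
      have "Ghost (Plain e) \<in> lpa_gens F"
        using v 3(2) by (simp add: lpa_gens_def quotient_graph_def image_iff)
      from gens[OF this] show ?thesis
        using v(2) 3 by (simp add: quotient_graph_def head_ghost del: Diff_iff)
    next
      case v: 3
      have "Ghost (Plain e) \<in> lpa_gens F" "Ghost (Primed e) \<in> lpa_gens F"
        using v 3(2) by (simp_all add: lpa_gens_def quotient_graph_def image_iff)
      from add[OF this[THEN gens]] have "leaving_sum ?v \<otimes> gh e \<oplus> (vx ?v \<ominus> leaving_sum ?v) \<otimes> gh e \<in> C"
        using v(2) by (simp add: quotient_graph_def del: Diff_iff)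
      moreover have "leaving_sum ?v \<otimes> gh e \<oplus> (vx ?v \<ominus> leaving_sum ?v) \<otimes> gh e = gh e"
        using mult_l_distr[of "leaving_sum ?v" "vx ?v \<ominus> leaving_sum ?v" "gh e"] split[of ?v] 3(2)
        by (simp add: head_ghost)
      ultimately show ?thesis using 3(1) by simp
    qed
  qed
qed

theorem quotient_leavitt_family: "leavitt_family K T F qgen"
proof (rule leavitt_family.intro[OF nonunital_algebra_axioms], rule leavitt_family_axioms.intro)
  show "wf_digraph F" by (rule wf_F)
  show "qgen \<in> lpa_gens F \<rightarrow> carrier T"
    by (auto simp: lpa_gens_def qvx_closed arcs_F simp del: qvx.simps)
  show "\<And>w. regular_vertex F w \<Longrightarrow>
      qgen (Vertex w) = (\<Oplus>x\<in>out_arcs F w. qgen (Edge x) \<otimes> qgen (Ghost x))"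
    by (rule regular_sum_F)
next
  fix x assume x: "x \<in> arcs F"
  note xF = arcs_F[OF x] qvx_tail_edge[OF x]
  have h: "qvx (head F x) \<in> carrier T" "qvx (tail F x) \<in> carrier T"
      "qvx (head F x) \<otimes> qvx (head F x) = qvx (head F x)"
    using xF by (simp_all add: qvx_closed qvx_mult del: qvx.simps)
  show "qgen (Vertex (tail F x)) \<otimes> qgen (Edge x) = qgen (Edge x)"
    using xF(1,8) h by (simp add: mult_assoc[symmetric] del: qvx.simps)
  show "qgen (Edge x) \<otimes> qgen (Vertex (head F x)) = qgen (Edge x)"
    using xF(1) h by (simp add: mult_assoc del: qvx.simps)
  show "qgen (Vertex (head F x)) \<otimes> qgen (Ghost x) = qgen (Ghost x)"
    using xF(1) h by (simp add: mult_assoc[symmetric] del: qvx.simps)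
  show "qgen (Ghost x) \<otimes> qgen (Vertex (tail F x)) = qgen (Ghost x)"
    using xF(1,9) h by (simp add: mult_assoc del: qvx.simps)
  have ghost_edge_F: "qgen (Ghost x) \<otimes> qgen (Edge y) =
      (if original x = original y then qvx (head F x) \<otimes> qvx (head F y) else \<zero>)"
    if y: "y \<in> arcs F" for y
  proof -
    note yF = arcs_F[OF y]
    have hy: "qvx (head F y) \<in> carrier T" using yF by (simp add: qvx_closed del: qvx.simps)
    have "vx (head E (original y)) \<otimes> qvx (head F y) = qvx (head F y)"
      using qvx_original(1)[OF yF(6)] yF(5) by simp
    then show ?thesis
      using xF(1) yF(1) h hy by (simp add: mult_assoc gen_mult_assoc del: qvx.simps)
  qed
  show "qgen (Ghost x) \<otimes> qgen (Edge x) = qgen (Vertex (head F x))"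
    using ghost_edge_F[OF x] h by (simp del: qvx.simps)
  fix y assume y: "y \<in> arcs F" "x \<noteq> y"
  show "qgen (Ghost x) \<otimes> qgen (Edge y) = \<zero>"
    using ghost_edge_F[OF y(1)] arc_F_eqI[OF x y(1)] y(2) qvx_mult[OF xF(6) arcs_F(6)[OF y(1)]]
    by (auto simp del: qgen.simps qvx.simps)
qed (simp_all add: qvx_mult del: qvx.simps)

end

section \<open>Basic ideals\<close>

text \<open>It suffices to check closure under single edges.\<close>

lemma hereditaryI:
  assumes "wf_digraph E" "H \<subseteq> verts E"
    and step: "\<And>e. \<lbrakk>e \<in> arcs E; tail E e \<in> H\<rbrakk> \<Longrightarrow> head E e \<in> H"
  shows "hereditary E H"
proof -
  interpret wf_digraph E by fact
  have "awalk v p w \<Longrightarrow> v \<in> H \<Longrightarrow> w \<in> H" for v p w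
    by (induction p arbitrary: v) (auto simp: awalk_Nil_iff awalk_Cons_iff intro: step)
  then show ?thesis using assms(2) by (auto simp: hereditary_def)
qed

locale basic_ideal = leavitt_path_algebra R L E \<gamma>
  for R :: "('r, 'n) ring_scheme" and L (structure) and E :: "('v, 'e) pre_digraph" and \<gamma> +
  fixes I A H S
  assumes I_ideal: "ideal I R" and basic: "basic_graded_ideal R E I A"
    and H_def: "H = {v \<in> verts E. lpa_incl R E (Vertex v) \<in> A}"
    and S_def: "S = {v \<in> breaking_vertices E H. breaking_elem R E H v \<in> A}"
begin

lemma graded_A: "graded_ideal R E A"
  using basic by (simp add: basic_graded_ideal_def)

lemma ideal_A: "two_sided_ideal A L"
  using graded_A by (simp add: graded_ideal_def T_eq)

lemma H_iff: "v \<in> verts E \<Longrightarrow> v \<in> H \<longleftrightarrow> vx v \<in> A"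
  by (simp add: H_def \<gamma>_eq)

lemma breaking_elem_eq:
  "breaking_elem R E H' v = vx v \<ominus> (\<Oplus>e\<in>arcs_leaving E H' v. ed e \<otimes> gh e)"
  by (simp add: breaking_elem_def T_eq \<gamma>_eq)

lemma A_additive: "additive_subgroup A L"
  using ideal_A by (simp add: two_sided_ideal_def)

lemma A_mult: "\<lbrakk>a \<in> A; x \<in> carrier L\<rbrakk> \<Longrightarrow> x \<otimes> a \<in> A" "\<lbrakk>a \<in> A; x \<in> carrier L\<rbrakk> \<Longrightarrow> a \<otimes> x \<in> A"
  using ideal_A by (auto simp: two_sided_ideal_def)

lemma A_smult: "\<lbrakk>r \<in> carrier R; a \<in> A\<rbrakk> \<Longrightarrow> r \<odot> a \<in> A"
  using ideal_smult_closed[OF ideal_A] .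

lemma A_finsum:
  assumes "finite D" "\<And>i. i \<in> D \<Longrightarrow> f i \<in> A"
  shows "(\<Oplus>i\<in>D. f i) \<in> A"
  using assms
proof (induction rule: finite_induct)
  interpret additive_subgroup A L by (rule A_additive)
  case empty show ?case by simp
next
  interpret additive_subgroup A L by (rule A_additive)
  case (insert i D)
  then show ?case by (simp add: M.finsum_insert Pi_def)
qed

lemma in_saturated_function:
  "r \<in> saturated_function R E A (H', S') \<longleftrightarrow> r \<in> carrier R \<and>
    (\<forall>v\<in>H'. r \<odot> vx v \<in> A) \<and> (\<forall>w\<in>S'. r \<odot> breaking_elem R E H' w \<in> A)"
  by (simp add: saturated_function_def T_eq \<gamma>_eq)

lemma saturated_function_values:
  assumes "(H', S') \<in> admissible_pairs E" "H' \<noteq> {} \<or> S' \<noteq> {}"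
  shows "saturated_function R E A (H', S') = I \<or> saturated_function R E A (H', S') = carrier R"
proof -
  have "saturated_function R E A (H', S') \<in>
      saturated_function R E A ` (admissible_pairs E - {({}, {})})"
    using assms by blast
  then show ?thesis using basic unfolding basic_graded_ideal_def Let_def by auto
qed

lemma I_carrier: "i \<in> I \<Longrightarrow> i \<in> carrier R"
proof -
  interpret ideal I R by (rule I_ideal)
  show "i \<in> I \<Longrightarrow> i \<in> carrier R" by (rule a_Hcarr)
qed

text \<open>
  The pair \<open>(E\<^sup>0, \<emptyset>)\<close> is admissible, and both values that the saturated function may take on it
  contain \<open>I\<close>.
\<close>

lemma I_smult_vertex:
  assumes r: "r \<in> I" and v: "v \<in> verts E" shows "r \<odot> vx v \<in> A"
proof -
  have "hereditary E (verts E)"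
    by (rule hereditaryI[OF wf_E]) auto
  moreover have "saturated E (verts E)" by (simp add: saturated_def regular_vertex_def)
  ultimately have "(verts E, {}) \<in> admissible_pairs E" by (simp add: admissible_pairs_def)
  then have "r \<in> saturated_function R E A (verts E, {})"
    using saturated_function_values[of "verts E" "{}"] v r I_carrier by blast
  then show ?thesis using v by (simp add: in_saturated_function)
qed

lemma I_smult:
  assumes r: "r \<in> I" and x: "x \<in> carrier L" shows "r \<odot> x \<in> A"
proof -
  have rR: "r \<in> carrier R" using r by (rule I_carrier)
  obtain V where V: "finite V" "V \<subseteq> verts E" "vsum V \<otimes> x = x" using local_unit[OF x] by metis
  have "r \<odot> vsum V = (\<Oplus>v\<in>V. r \<odot> vx v)"
    unfolding vsum_def using V rR by (intro finsum_smult_ldistr) auto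
  also have "\<dots> \<in> A" using V r I_smult_vertex by (intro A_finsum) auto
  finally have "(r \<odot> vsum V) \<otimes> x \<in> A" using x by (rule A_mult(2))
  then show ?thesis using V rR x by (simp add: smult_mult_left vsum_closed)
qed

text \<open>
  These sets, which depend on \<open>r\<close>, are the arguments at which the saturated function detects that
  \<open>r\<close> lies in \<open>I\<close>; for \<open>r = 1\<close> the set is \<open>H\<close>.
\<close>

lemma annihilated_vertices_admissible:
  assumes r: "r \<in> carrier R"
  defines "G \<equiv> {v \<in> verts E. r \<odot> vx v \<in> A}"
  shows "hereditary E G" "saturated E G"
proof -
  show "hereditary E G"
  proof (rule hereditaryI[OF wf_E])
    fix e assume e: "e \<in> arcs E" "tail E e \<in> G"
    have "gh e \<otimes> (r \<odot> vx (tail E e)) \<otimes> ed e \<in> A"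
      using e A_mult by (simp add: G_def)
    moreover have "gh e \<otimes> (r \<odot> vx (tail E e)) \<otimes> ed e = r \<odot> vx (head E e)"
      using e r by (simp add: smult_mult_left smult_mult_right ghost_tail ghost_edge)
    ultimately show "head E e \<in> G" using e by (simp add: G_def)
  qed (auto simp: G_def)
  show "saturated E G"
    unfolding saturated_def
  proof (intro allI impI)
    fix v assume v: "regular_vertex E v" and sub: "head E ` out_arcs E v \<subseteq> G"
    have fin: "finite (out_arcs E v)" and vE: "v \<in> verts E" using v by (auto simp: regular_vertex_def)
    have out: "e \<in> arcs E" if "e \<in> out_arcs E v" for e using that by (simp add: out_arcs_def)
    have "r \<odot> vx v = (\<Oplus>e\<in>out_arcs E v. r \<odot> (ed e \<otimes> gh e))"
      unfolding regular_sum[OF v] using fin r out by (intro finsum_smult_ldistr) auto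
    also have "\<dots> \<in> A"
    proof (rule A_finsum[OF fin])
      fix e assume e: "e \<in> out_arcs E v"
      then have "r \<odot> vx (head E e) \<in> A" using subsetD[OF sub imageI[OF e]] by (simp add: G_def)
      then have "ed e \<otimes> (r \<odot> vx (head E e)) \<otimes> gh e \<in> A" using out[OF e] A_mult by simp
      then show "r \<odot> (ed e \<otimes> gh e) \<in> A"
        using out[OF e] r by (simp add: smult_mult_left smult_mult_right edge_head)
    qed
    finally show "v \<in> G" using vE by (simp add: G_def)
  qed
qed

lemma H_admissible: "hereditary E H" "saturated E H"
proof -
  have "{v \<in> verts E. \<one>\<^bsub>R\<^esub> \<odot> vx v \<in> A} = H" by (auto simp: H_def \<gamma>_eq[symmetric])
  then show "hereditary E H" "saturated E H"
    using annihilated_vertices_admissible[of "\<one>\<^bsub>R\<^esub>"] by simp_all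
qed

text \<open>
  At the set of vertices annihilated by \<open>r\<close> modulo \<open>A\<close> the saturated function has a value that
  contains \<open>r\<close>. It does not contain \<open>1\<close>, since \<open>v\<close> belongs to this set but not to \<open>H\<close>.
\<close>

lemma vertex_scalar_in_I:
  assumes r: "r \<in> carrier R" and v: "v \<in> verts E" "v \<notin> H" and rv: "r \<odot> vx v \<in> A"
  shows "r \<in> I"
proof -
  let ?G = "{v \<in> verts E. r \<odot> vx v \<in> A}"
  have "(?G, {}) \<in> admissible_pairs E"
    using annihilated_vertices_admissible[OF r] by (simp add: admissible_pairs_def)
  moreover have "?G \<noteq> {}" using v rv by blast
  ultimately have "saturated_function R E A (?G, {}) = I \<or> saturated_function R E A (?G, {}) = carrier R"
    by (rule saturated_function_values[OF _ disjI1])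
  moreover have "\<one>\<^bsub>R\<^esub> \<notin> saturated_function R E A (?G, {})"
    using v rv by (auto simp: in_saturated_function H_iff)
  moreover have "r \<in> saturated_function R E A (?G, {})"
    using r by (simp add: in_saturated_function)
  ultimately show ?thesis by auto
qed

text \<open>
  At \<open>(H, {v})\<close> the saturated function has a value that contains \<open>r\<close>, but not \<open>1\<close> since \<open>v \<notin> S\<close>.
\<close>

lemma breaking_scalar_in_I:
  assumes r: "r \<in> carrier R" and v: "v \<in> breaking_vertices E H" "v \<notin> S"
    and rv: "r \<odot> breaking_elem R E H v \<in> A"
  shows "r \<in> I"
proof -
  have vE: "v \<in> verts E" using v(1) by (simp add: breaking_vertices_def infinite_emitter_def)
  have closed: "breaking_elem R E H v \<in> carrier L"
    unfolding breaking_elem_eq a_minus_def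
    using vE by (intro M.a_closed M.a_inv_closed M.finsum_closed)
      (auto simp: arcs_leaving_def out_arcs_def)
  have "(H, {v}) \<in> admissible_pairs E"
    using H_admissible v by (simp add: admissible_pairs_def)
  then have "saturated_function R E A (H, {v}) = I \<or> saturated_function R E A (H, {v}) = carrier R"
    using saturated_function_values by simp
  moreover have "\<one>\<^bsub>R\<^esub> \<notin> saturated_function R E A (H, {v})"
    using v closed by (auto simp: in_saturated_function S_def)
  moreover have "r \<in> saturated_function R E A (H, {v})"
    using r rv A_smult by (auto simp: in_saturated_function H_def \<gamma>_eq)
  ultimately show ?thesis by auto
qed

lemma algebra_quotient_A: "algebra_quotient R L I A"
  by (rule algebra_quotient.intro[OF nonunital_algebra_axioms I_ideal])
     (rule algebra_quotient_axioms.intro[OF ideal_A A_smult I_smult])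

end

sublocale basic_ideal \<subseteq> AQ: algebra_quotient R L I A
  by (rule algebra_quotient_A)

context basic_ideal
begin

abbreviation \<gamma>Q where "\<gamma>Q g \<equiv> A +> \<gamma> g"

lemma coset_edge_ghost_sum:
  assumes "finite D" "D \<subseteq> arcs E"
  shows "(\<Oplus>\<^bsub>AQ.Q\<^esub>e\<in>D. \<gamma>Q (Edge e) \<otimes>\<^bsub>AQ.Q\<^esub> \<gamma>Q (Ghost e)) = A +> (\<Oplus>e\<in>D. ed e \<otimes> gh e)"
proof -
  interpret Q: nonunital_algebra "R Quot I" AQ.Q by (rule AQ.nonunital_algebra_Q)
  have "(\<Oplus>\<^bsub>AQ.Q\<^esub>e\<in>D. \<gamma>Q (Edge e) \<otimes>\<^bsub>AQ.Q\<^esub> \<gamma>Q (Ghost e)) = (\<Oplus>\<^bsub>AQ.Q\<^esub>e\<in>D. A +> (ed e \<otimes> gh e))"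
    by (rule Q.M.finsum_cong') (use assms in \<open>simp_all add: AQ.mult_coset Pi_def subset_iff\<close>)
  also have "\<dots> = A +> (\<Oplus>e\<in>D. ed e \<otimes> gh e)"
    using assms by (intro AQ.finsum_coset) auto
  finally show ?thesis .
qed

lemma breaking_leaving:
  assumes "v \<in> breaking_vertices E H"
  shows "v \<in> verts E" "finite (arcs_leaving E H v)" "arcs_leaving E H v \<subseteq> arcs E"
  using assms by (auto simp: breaking_vertices_def infinite_emitter_def arcs_leaving_def out_arcs_def)

lemma quotient_graph_family_Q: "quotient_graph_family (R Quot I) AQ.Q E \<gamma>Q H S"
proof (rule quotient_graph_family.intro[OF AQ.coset_leavitt_family[OF leavitt_family_axioms]],
    rule quotient_graph_family_axioms.intro)
  fix e assume e: "e \<in> arcs E" "tail E e \<in> H"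
  have "pre_digraph.awalk E (tail E e) [e] (head E e)"
    using e(1) by (simp add: pre_digraph.awalk_def pre_digraph.cas.simps)
  then show "head E e \<in> H" using H_admissible(1) e(2) by (auto simp: hereditary_def)
next
  fix v assume "v \<in> verts E" "v \<in> H"
  then show "\<gamma>Q (Vertex v) = \<zero>\<^bsub>AQ.Q\<^esub>" by (simp add: AQ.coset_zero_iff H_iff)
next
  fix v assume v: "v \<in> breaking_vertices E H" "v \<in> S"
  let ?s = "\<Oplus>e\<in>arcs_leaving E H v. ed e \<otimes> gh e"
  have s: "?s \<in> carrier L" using breaking_leaving[OF v(1)] by (intro M.finsum_closed) auto
  have vx: "vx v \<in> carrier L" using breaking_leaving[OF v(1)] by simp
  have "vx v \<ominus> ?s \<in> A" using v by (simp add: S_def breaking_elem_eq)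
  then have "A +> ((vx v \<ominus> ?s) \<oplus> ?s) = A +> ?s" using s by (rule AQ.coset_absorb)
  moreover have "(vx v \<ominus> ?s) \<oplus> ?s = vx v"
    using s vx by (simp add: a_minus_def M.a_assoc M.l_neg)
  ultimately have "A +> vx v = A +> ?s" by simp
  then show "\<gamma>Q (Vertex v) =
      (\<Oplus>\<^bsub>AQ.Q\<^esub>e\<in>arcs_leaving E H v. \<gamma>Q (Edge e) \<otimes>\<^bsub>AQ.Q\<^esub> \<gamma>Q (Ghost e))"
    using coset_edge_ghost_sum[OF breaking_leaving(2,3)[OF v(1)]] by simp
qed

end

sublocale basic_ideal \<subseteq> QF: quotient_graph_family "R Quot I" "quotient_algebra L A" E "\<lambda>g. A +> \<gamma> g" H S
  by (rule quotient_graph_family_Q)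

section \<open>The isomorphism\<close>

context basic_ideal
begin

abbreviation "LF \<equiv> lpa (R Quot I) QF.F"

definition \<Psi> where "\<Psi> = presented_hom AQ.Q QF.qgen"

lemma leavitt_path_algebra_F: "leavitt_path_algebra (R Quot I) LF QF.F (lpa_incl (R Quot I) QF.F)"
  by (rule leavitt_path_algebra.intro) (use AQ.R_ideal.quotient_is_cring[OF K_cring] QF.wf_F in simp_all)

end

sublocale basic_ideal \<subseteq>
  LF: leavitt_path_algebra "R Quot I" "lpa (R Quot I) (quotient_graph E H S)" "quotient_graph E H S"
    "lpa_incl (R Quot I) (quotient_graph E H S)"
  by (rule leavitt_path_algebra_F)

context basic_ideal
begin

lemma \<Psi>_hom: "algebra_hom (R Quot I) LF AQ.Q \<Psi>"
  unfolding \<Psi>_def using QF.quotient_leavitt_family by (rule leavitt_family.lpa_hom)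

lemma \<Psi>_incl: "g \<in> lpa_gens QF.F \<Longrightarrow> \<Psi> (lpa_incl (R Quot I) QF.F g) = QF.qgen g"
  unfolding \<Psi>_def using QF.quotient_leavitt_family by (rule leavitt_family.lpa_hom_incl)

lemmas \<Psi>_ops = algebra_homD[OF \<Psi>_hom]

lemma \<Psi>_zero: "\<Psi> \<zero>\<^bsub>LF\<^esub> = \<zero>\<^bsub>AQ.Q\<^esub>"
  using LF.nonunital_algebra_T AQ.nonunital_algebra_Q \<Psi>_hom by (rule algebra_hom_zero)

lemma \<Psi>_minus: "X \<in> carrier LF \<Longrightarrow> \<Psi> (\<ominus>\<^bsub>LF\<^esub> X) = \<ominus>\<^bsub>AQ.Q\<^esub> \<Psi> X"
proof -
  interpret abelian_group_hom LF AQ.Q \<Psi>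
    using LF.nonunital_algebra_T AQ.nonunital_algebra_Q \<Psi>_hom by (rule algebra_hom_abelian_group_hom)
  show "X \<in> carrier LF \<Longrightarrow> \<Psi> (\<ominus>\<^bsub>LF\<^esub> X) = \<ominus>\<^bsub>AQ.Q\<^esub> \<Psi> X" by (rule hom_a_inv)
qed

lemma \<Psi>_surj: "\<Psi> ` carrier LF = carrier AQ.Q"
proof
  show "\<Psi> ` carrier LF \<subseteq> carrier AQ.Q" using \<Psi>_ops(1) by blast
  let ?C = "\<Psi> ` carrier LF"
  have C_zero: "\<zero>\<^bsub>AQ.Q\<^esub> \<in> ?C"
    by (rule image_eqI[of _ _ "\<zero>\<^bsub>LF\<^esub>"]) (simp_all add: \<Psi>_zero)
  have C_add: "X \<oplus>\<^bsub>AQ.Q\<^esub> Y \<in> ?C" if XY: "X \<in> ?C" "Y \<in> ?C" for X Y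
  proof -
    obtain X' Y' where X': "X' \<in> carrier LF" "X = \<Psi> X'" and Y': "Y' \<in> carrier LF" "Y = \<Psi> Y'"
      using XY by (elim imageE)
    then show ?thesis by (intro image_eqI[of _ _ "X' \<oplus>\<^bsub>LF\<^esub> Y'"]) (simp_all add: \<Psi>_ops)
  qed
  have C_mult: "X \<otimes>\<^bsub>AQ.Q\<^esub> Y \<in> ?C" if XY: "X \<in> ?C" "Y \<in> ?C" for X Y
  proof -
    obtain X' Y' where X': "X' \<in> carrier LF" "X = \<Psi> X'" and Y': "Y' \<in> carrier LF" "Y = \<Psi> Y'"
      using XY by (elim imageE)
    then show ?thesis by (intro image_eqI[of _ _ "X' \<otimes>\<^bsub>LF\<^esub> Y'"]) (simp_all add: \<Psi>_ops)
  qed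
  have C_neg: "\<ominus>\<^bsub>AQ.Q\<^esub> X \<in> ?C" if X: "X \<in> ?C" for X
  proof -
    obtain X' where "X' \<in> carrier LF" "X = \<Psi> X'" using X by (elim imageE)
    then show ?thesis by (intro image_eqI[of _ _ "\<ominus>\<^bsub>LF\<^esub> X'"]) (simp_all add: \<Psi>_minus)
  qed
  have C_smult: "k \<odot>\<^bsub>AQ.Q\<^esub> X \<in> ?C" if k: "k \<in> carrier (R Quot I)" and X: "X \<in> ?C" for k X
  proof -
    obtain X' where "X' \<in> carrier LF" "X = \<Psi> X'" using X by (elim imageE)
    then show ?thesis using k
      by (intro image_eqI[of _ _ "k \<odot>\<^bsub>LF\<^esub> X'"]) (simp_all add: \<Psi>_ops LF.smult_closed)
  qed
  have C_gens: "QF.qgen g \<in> ?C" if g: "g \<in> lpa_gens QF.F" for g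
    using LF.gens_closed g by (intro image_eqI[of _ _ "lpa_incl (R Quot I) QF.F g"]) (auto simp: \<Psi>_incl)
  have "A +> x \<in> ?C" if "x \<in> carrier L" for x
    using that
  proof (induction rule: lpa_induct)
    case zero
    show ?case using C_zero by (simp only: AQ.zero_Q)
  next
    case (gen g)
    show ?case using C_zero C_add C_gens gen by (rule QF.generators_in_span)
  next
    case (add x y)
    then show ?case using C_add[of "A +> x" "A +> y"]
      by (simp add: AQ.add_coset)
  next
    case (neg x)
    then show ?case using C_neg[of "A +> x"]
      by (simp add: AQ.a_inv_coset)
  next
    case (mult x y)
    then show ?case using C_mult[of "A +> x" "A +> y"]
      by (simp add: AQ.mult_coset)
  next
    case (smult r x)
    have "I +>\<^bsub>R\<^esub> r \<in> carrier (R Quot I)"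
      using smult.hyps(1) by (simp add: FactRing_def pres.a_rcosetsI AQ.R_ideal.a_subset)
    then show ?case
      using smult C_smult[of "I +>\<^bsub>R\<^esub> r" "A +> x"]
      by (simp add: AQ.smult_coset)
  qed
  then show "carrier AQ.Q \<subseteq> ?C" by (auto elim: AQ.carrier_Q_cases)
qed

lemma leaving_sum_coset:
  assumes "v \<in> breaking_vertices E H"
  shows "QF.leaving_sum v = A +> (\<Oplus>e\<in>arcs_leaving E H v. ed e \<otimes> gh e)"
  unfolding QF.leaving_sum_def using coset_edge_ghost_sum breaking_leaving(2,3)[OF assms] .

lemma Primed_coset:
  assumes v: "v \<in> breaking_vertices E H"
  shows "QF.qvx (Primed v) = A +> breaking_elem R E H v"
proof -
  let ?s = "\<Oplus>e\<in>arcs_leaving E H v. ed e \<otimes> gh e"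
  have "?s \<in> carrier L" "vx v \<in> carrier L"
    using breaking_leaving[OF v] by (auto intro!: M.finsum_closed)
  then show ?thesis
    using v by (simp add: leaving_sum_coset breaking_elem_eq a_minus_def AQ.a_inv_coset AQ.add_coset)
qed

lemma homog_breaking:
  assumes v: "v \<in> breaking_vertices E H"
  shows "homog 0 (\<Oplus>e\<in>arcs_leaving E H v. ed e \<otimes> gh e)" "homog 0 (breaking_elem R E H v)"
proof -
  show 1: "homog 0 (\<Oplus>e\<in>arcs_leaving E H v. ed e \<otimes> gh e)"
  proof (rule homog_finsum)
    show "finite (arcs_leaving E H v)" using breaking_leaving[OF v] by simp
    fix e assume "e \<in> arcs_leaving E H v"
    then have "e \<in> arcs E" using breaking_leaving[OF v] by auto
    then show "homog 0 (ed e \<otimes> gh e)" using homog_intros(5)[OF homog_gens(2,3)] by simp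
  qed
  show "homog 0 (breaking_elem R E H v)"
    unfolding breaking_elem_eq a_minus_def
    using breaking_leaving[OF v] 1 by (simp add: homog_intros homog_minus homog_gens)
qed

lemma qvx_homog:
  assumes "w \<in> verts QF.F"
  obtains x where "homog 0 x" "QF.qvx w = A +> x"
proof (cases w)
  case (Plain v)
  then have v: "v \<in> verts E" using assms by (auto simp: QF.verts_F)
  show ?thesis
  proof (cases "v \<in> QF.B")
    case True
    then show ?thesis
      using that[OF homog_breaking(1)[of v]] Plain by (simp add: leaving_sum_coset)
  next
    case False
    then show ?thesis using that[OF homog_gens(1)[OF v]] Plain by (simp del: Diff_iff)
  qed
next
  case (Primed v)
  then have "v \<in> breaking_vertices E H" using assms by (auto simp: QF.verts_F)
  then show ?thesis
    using that[OF homog_breaking(2)[of v]] Primed_coset[of v] Primed by simp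
qed

text \<open>
  The representatives of the generators are cosets of homogeneous elements of the right degree, and
  such cosets are closed under the operations.
\<close>

lemma \<Psi>_graded:
  assumes "LF.homog n X"
  shows "\<exists>x. homog n x \<and> \<Psi> X = A +> x"
  using assms
proof (induction rule: LF.homog_induct)
  case (zero n)
  show ?case by (intro exI[of _ \<zero>]) (simp add: homog_intros \<Psi>_zero AQ.zero_Q)
next
  case (gen g)
  consider w where "g = Vertex w" "w \<in> verts QF.F" | y where "g = Edge y" "y \<in> arcs QF.F"
    | y where "g = Ghost y" "y \<in> arcs QF.F"
    using gen by (auto simp: lpa_gens_def)
  then show ?case
  proof cases
    case (1 w)
    obtain x where "homog 0 x" "QF.qvx w = A +> x" using 1(2) by (rule qvx_homog)
    then show ?thesis using 1 \<Psi>_incl[OF gen] by (intro exI[of _ x]) simp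
  next
    case (2 y)
    obtain x where x: "homog 0 x" "QF.qvx (head QF.F y) = A +> x"
      using QF.arcs_F(6)[OF 2(2)] by (rule qvx_homog)
    have y: "original y \<in> arcs E" using 2(2) by (rule QF.arcs_F)
    have "homog (1 + 0) (ed (original y) \<otimes> x)"
      using homog_intros(5)[OF homog_gens(2)[OF y] x(1)] .
    then show ?thesis
      using 2 x y homog_closed[OF x(1)] \<Psi>_incl[OF gen]
      by (intro exI[of _ "ed (original y) \<otimes> x"]) (simp add: AQ.mult_coset)
  next
    case (3 y)
    obtain x where x: "homog 0 x" "QF.qvx (head QF.F y) = A +> x"
      using QF.arcs_F(6)[OF 3(2)] by (rule qvx_homog)
    have y: "original y \<in> arcs E" using 3(2) by (rule QF.arcs_F)
    have "homog (0 + - 1) (x \<otimes> gh (original y))"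
      using homog_intros(5)[OF x(1) homog_gens(3)[OF y]] .
    then show ?thesis
      using 3 x y homog_closed[OF x(1)] \<Psi>_incl[OF gen]
      by (intro exI[of _ "x \<otimes> gh (original y)"]) (simp add: AQ.mult_coset)
  qed
next
  case (add n X Y)
  then obtain x y where xy: "homog n x" "\<Psi> X = A +> x" "homog n y" "\<Psi> Y = A +> y" by blast
  have "\<Psi> (X \<oplus>\<^bsub>LF\<^esub> Y) = A +> (x \<oplus> y)"
    using add.hyps[THEN LF.homog_closed] xy(1,3)[THEN homog_closed] xy
    by (simp add: \<Psi>_ops AQ.add_coset)
  then show ?case using homog_intros(3)[OF xy(1,3)] by blast
next
  case (smult n k X)
  then obtain x where x: "homog n x" "\<Psi> X = A +> x" by blast
  obtain r where r: "r \<in> carrier R" "k = I +>\<^bsub>R\<^esub> r" using smult.hyps(1) by (rule AQ.scalar_cases)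
  have "\<Psi> (k \<odot>\<^bsub>LF\<^esub> X) = A +> (r \<odot> x)"
    using smult.hyps LF.homog_closed[OF smult.hyps(2)] homog_closed[OF x(1)] x r
    by (simp add: \<Psi>_ops(4) AQ.smult_coset)
  then show ?case using homog_intros(4)[OF r(1) x(1)] by blast
next
  case (mult m n X Y)
  then obtain x y where xy: "homog m x" "\<Psi> X = A +> x" "homog n y" "\<Psi> Y = A +> y" by blast
  have "\<Psi> (X \<otimes>\<^bsub>LF\<^esub> Y) = A +> (x \<otimes> y)"
    using mult.hyps[THEN LF.homog_closed] xy(1,3)[THEN homog_closed] xy
    by (simp add: \<Psi>_ops AQ.mult_coset)
  then show ?case using homog_intros(5)[OF xy(1,3)] by blast
qed

text \<open>
  Each idempotent \<open>qvx w\<close> is the coset of a vertex outside \<open>H\<close>, or of \<open>v\<^sup>H\<close> with \<open>v \<notin> S\<close>, or can be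
  compressed to such a vertex by a leaving edge.
\<close>

lemma qvx_faithful:
  assumes r: "r \<in> carrier R" and w: "w \<in> verts QF.F"
    and zero: "(I +>\<^bsub>R\<^esub> r) \<odot>\<^bsub>AQ.Q\<^esub> QF.qvx w = \<zero>\<^bsub>AQ.Q\<^esub>"
  shows "r \<in> I"
proof (cases w)
  case (Plain v)
  then have v: "v \<in> verts E" "v \<notin> H" using w by (auto simp: QF.verts_F)
  show ?thesis
  proof (cases "v \<in> QF.B")
    case False
    then have "r \<odot> vx v \<in> A"
      using zero Plain v r by (simp add: AQ.smult_coset AQ.coset_zero_iff del: Diff_iff)
    then show ?thesis using r v by (intro vertex_scalar_in_I)
  next
    case True
    then have br: "v \<in> breaking_vertices E H" by simp
    obtain e where e: "e \<in> arcs_leaving E H v"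
      using br by (auto simp: breaking_vertices_def)
    have eE: "e \<in> arcs E" "head E e \<notin> H" using e by (auto simp: arcs_leaving_def out_arcs_def)
    let ?s = "QF.leaving_sum v" and ?k = "I +>\<^bsub>R\<^esub> r"
    have k: "?k \<in> carrier (R Quot I)"
      using r by (simp add: FactRing_def pres.a_rcosetsI AQ.R_ideal.a_subset)
    \<comment> \<open>Between \<open>e*\<close> and \<open>e\<close> the sum over the leaving edges becomes the range of \<open>e\<close>.\<close>
    have "\<zero>\<^bsub>AQ.Q\<^esub> = \<gamma>Q (Ghost e) \<otimes>\<^bsub>AQ.Q\<^esub> (?k \<odot>\<^bsub>AQ.Q\<^esub> ?s) \<otimes>\<^bsub>AQ.Q\<^esub> \<gamma>Q (Edge e)"
      using zero True Plain eE(1) by (simp del: Diff_iff)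
    also have "\<dots> = ?k \<odot>\<^bsub>AQ.Q\<^esub> (\<gamma>Q (Ghost e) \<otimes>\<^bsub>AQ.Q\<^esub> ?s \<otimes>\<^bsub>AQ.Q\<^esub> \<gamma>Q (Edge e))"
      using k eE(1) by (simp add: QF.smult_mult_left QF.smult_mult_right)
    also have "\<dots> = ?k \<odot>\<^bsub>AQ.Q\<^esub> \<gamma>Q (Vertex (head E e))"
      using QF.leaving_sum_edge(2)[OF breaking_leaving(2)[OF br] e] QF.ghost_edge_same[OF eE(1)] by simp
    also have "\<dots> = A +> (r \<odot> vx (head E e))" using r eE(1) by (simp add: AQ.smult_coset)
    finally have "r \<odot> vx (head E e) \<in> A"
      using r eE(1) by (simp add: AQ.coset_zero_iff[symmetric])
    then show ?thesis using r eE by (intro vertex_scalar_in_I[of r "head E e"]) simp_all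
  qed
next
  case (Primed v)
  then have v: "v \<in> breaking_vertices E H" "v \<notin> S" using w by (auto simp: QF.verts_F)
  have b: "breaking_elem R E H v \<in> carrier L" using homog_breaking(2)[OF v(1)] by (rule homog_closed)
  have "A +> (r \<odot> breaking_elem R E H v) = \<zero>\<^bsub>AQ.Q\<^esub>"
    using zero Primed_coset[OF v(1)] Primed b r by (simp add: AQ.smult_coset)
  then have "r \<odot> breaking_elem R E H v \<in> A" using b r by (simp add: AQ.coset_zero_iff)
  then show ?thesis using r v by (intro breaking_scalar_in_I)
qed

definition ker_\<Psi> where "ker_\<Psi> = {X \<in> carrier LF. \<Psi> X = \<zero>\<^bsub>AQ.Q\<^esub>}"

lemma kernel_ideal: "two_sided_ideal ker_\<Psi> LF"
proof -
  interpret h: abelian_group_hom LF AQ.Q \<Psi>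
    using LF.nonunital_algebra_T AQ.nonunital_algebra_Q \<Psi>_hom by (rule algebra_hom_abelian_group_hom)
  have "ker_\<Psi> = a_kernel LF AQ.Q \<Psi>" unfolding ker_\<Psi>_def a_kernel_def' by (rule HOL.refl)
  then have "additive_subgroup ker_\<Psi> LF" using h.additive_subgroup_a_kernel by simp
  then show ?thesis
    unfolding two_sided_ideal_def by (simp add: ker_\<Psi>_def \<Psi>_ops)
qed

lemma kernel_faithful:
  assumes k: "k \<in> carrier (R Quot I)" and w: "w \<in> verts QF.F"
    and kw: "k \<odot>\<^bsub>LF\<^esub> lpa_incl (R Quot I) QF.F (Vertex w) \<in> ker_\<Psi>"
  shows "k = \<zero>\<^bsub>R Quot I\<^esub>"
proof -
  obtain r where r: "r \<in> carrier R" "k = I +>\<^bsub>R\<^esub> r" using k by (rule AQ.scalar_cases)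
  have "k \<odot>\<^bsub>AQ.Q\<^esub> QF.qvx w = \<zero>\<^bsub>AQ.Q\<^esub>"
    using kw k w \<Psi>_incl[of "Vertex w"]
    by (simp add: ker_\<Psi>_def \<Psi>_ops(4) lpa_gens_def del: QF.qvx.simps)
  then have "r \<in> I" using qvx_faithful r w by simp
  then show ?thesis using r by (simp add: FactRing_def AQ.R_ideal.a_rcos_const)
qed

text \<open>
  Homogeneous representatives of the images of the components add up to an element of \<open>A\<close>. As \<open>A\<close> is
  graded, each representative lies in \<open>A\<close>.
\<close>

lemma kernel_components:
  assumes X: "(\<Oplus>\<^bsub>LF\<^esub>n\<in>D. c n) \<in> ker_\<Psi>" and D: "finite D" "\<And>n. n \<in> D \<Longrightarrow> LF.homog n (c n)"
    and m: "m \<in> D"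
  shows "c m \<in> ker_\<Psi>"
proof -
  have "\<forall>n\<in>D. \<exists>x. homog n x \<and> \<Psi> (c n) = A +> x" using \<Psi>_graded D(2) by blast
  then obtain y where "\<forall>n\<in>D. homog n (y n) \<and> \<Psi> (c n) = A +> y n"
    by (elim exE[OF bchoice])
  then have y: "homog n (y n)" "\<Psi> (c n) = A +> y n" if "n \<in> D" for n using that by simp_all
  have c: "c n \<in> carrier LF" if "n \<in> D" for n using D(2)[OF that] by (rule LF.homog_closed)
  have yc: "y n \<in> carrier L" if "n \<in> D" for n using y(1)[OF that] by (rule homog_closed)
  have "\<zero>\<^bsub>AQ.Q\<^esub> = \<Psi> (\<Oplus>\<^bsub>LF\<^esub>n\<in>D. c n)" using X by (simp add: ker_\<Psi>_def)
  also have "\<dots> = (\<Oplus>\<^bsub>AQ.Q\<^esub>n\<in>D. \<Psi> (c n))"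
    using c D(1) by (intro algebra_hom_finsum[OF LF.nonunital_algebra_T AQ.nonunital_algebra_Q \<Psi>_hom]) auto
  also have "\<dots> = (\<Oplus>\<^bsub>AQ.Q\<^esub>n\<in>D. A +> y n)"
    by (rule QF.M.finsum_cong') (use y(2) yc in \<open>simp_all add: Pi_def\<close>)
  also have "\<dots> = A +> (\<Oplus>n\<in>D. y n)" using D(1) yc by (intro AQ.finsum_coset) auto
  finally have "(\<Oplus>n\<in>D. y n) \<in> A"
    using yc by (simp add: AQ.coset_zero_iff[symmetric] M.finsum_closed Pi_def)
  then have "y m \<in> A" using graded_ideal_components[OF graded_A D(1) y(1)] m by simp
  then show ?thesis using y(2)[OF m] yc[OF m] c[OF m] by (simp add: ker_\<Psi>_def AQ.coset_zero_iff)
qed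

lemma kernel_trivial:
  assumes X: "X \<in> ker_\<Psi>" shows "X = \<zero>\<^bsub>LF\<^esub>"
proof -
  have "X \<in> carrier LF" using X by (simp add: ker_\<Psi>_def)
  then obtain D c where D: "finite D" "\<forall>n\<in>D. LF.homog n (c n)" "X = (\<Oplus>\<^bsub>LF\<^esub>n\<in>D. c n)"
    using LF.homog_decomposition[unfolded LF.graded_sum_def] by blast
  show ?thesis
  proof (rule LF.graded_uniqueness[OF kernel_ideal kernel_faithful X D(1) _ D(3)])
    fix n assume n: "n \<in> D"
    have "c n \<in> ker_\<Psi>" using X D n by (intro kernel_components[of c D n]) simp_all
    then show "LF.homog n (c n) \<and> c n \<in> ker_\<Psi>" using D(2) n by simp
  qed
qed

lemma \<Psi>_bij: "bij_betw \<Psi> (carrier LF) (carrier AQ.Q)"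
proof -
  interpret h: abelian_group_hom LF AQ.Q \<Psi>
    using LF.nonunital_algebra_T AQ.nonunital_algebra_Q \<Psi>_hom by (rule algebra_hom_abelian_group_hom)
  have "inj_on \<Psi> (carrier LF)"
  proof (rule inj_onI)
    fix X Y assume XY: "X \<in> carrier LF" "Y \<in> carrier LF" "\<Psi> X = \<Psi> Y"
    then have "\<Psi> (X \<oplus>\<^bsub>LF\<^esub> (\<ominus>\<^bsub>LF\<^esub> Y)) = \<zero>\<^bsub>AQ.Q\<^esub>" by (simp add: QF.M.r_neg)
    then have "X \<oplus>\<^bsub>LF\<^esub> (\<ominus>\<^bsub>LF\<^esub> Y) = \<zero>\<^bsub>LF\<^esub>"
      using XY by (intro kernel_trivial) (simp add: ker_\<Psi>_def)
    then show "X = Y" using XY LF.M.minus_equality[of X "\<ominus>\<^bsub>LF\<^esub> Y"] by simp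
  qed
  then show ?thesis using \<Psi>_surj by (simp add: bij_betw_def)
qed

end

theorem corollary4p4:
  fixes R :: "('r, 'm) ring_scheme" and E :: "('v, 'e) pre_digraph"
    and I :: "'r set" and A :: "('r, ('v, 'e) lpa_gen) alg_expr set set"
    and H S :: "'v set"
  assumes "wf_digraph E" and "cring R" and "ideal I R"
    and "basic_graded_ideal R E I A"
    and "H = {v \<in> verts E. lpa_incl R E (Vertex v) \<in> A}"
    and "S = {v \<in> breaking_vertices E H. breaking_elem R E H v \<in> A}"
  shows "\<exists>\<phi>. \<phi> \<in> algebra_isos (R Quot I)
    (quotient_algebra (lpa R E) A) (lpa (R Quot I) (quotient_graph E H S))"
proof -
  interpret basic_ideal R "lpa R E" E "lpa_incl R E" I A H S
    by (rule basic_ideal.intro[OF leavitt_path_algebra.intro[OF assms(2,1) HOL.refl HOL.refl]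
          basic_ideal_axioms.intro[OF assms(3-6)]])
  show ?thesis
    using bij_algebra_hom_inverse[OF LF.nonunital_algebra_T \<Psi>_hom \<Psi>_bij] by blast
qed

end
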